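(* Let $a=(a_1,a_2,a_3,a_4)\in\mathbb{R}^4$ satisfy $a_i>0$ and $a_i<a_j+a_k+a_l$ for all $i$ (where $\{i,j,k,l\}=\{1,2,3,4\}$), and suppose $a_1\pm a_2\pm a_3\pm a_4\neq 0$ for all choices of signs. Let $\bar a=(s-a_1,s-a_2,s-a_3,s-a_4)$ with $s=\frac{a_1+a_2+a_3+a_4}{2}$. Then: (i) The complexified configuration space $Q^{\mathbb{C}}(a)$ of non-oriented quadrilaterals with side lengths $a$ is an elliptic curve $\mathbb{C}/\Lambda$ with a rectangular lattice $\Lambda$. (ii) There is a natural isomorphism $Q^{\mathbb{C}}(a)\to Q^{\mathbb{C}}(\bar a)$ that identifies two quadrilaterals with the same diagonal lengths. (iii) If $Q_{or}^{\mathbb{C}}(a)$ has a rectangular lattice, then $Q_{or}^{\mathbb{C}}(\bar a)$ has a rhombic lattice. In particular, the isomorphism in (ii) does not lift to an isomorphism $Q_{or}^{\mathbb{C}}(a)\to Q_{or}^{\mathbb{C}}(\bar a)$ along the double covers $Q_{or}^{\mathbb{C}}(a)\to Q^{\mathbb{C}}(a)\cong Q^{\mathbb{C}}(\bar a)\leftarrow Q_{or}^{\mathbb{C}}(\bar a)$.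
   Context: Indices are taken modulo $4$ in $\{1,2,3,4\}$; $\bar a_i=s-a_i$. A quadrilateral with side lengths $a$ is an ordered quadruple $(A,B,C,D)$ of points of $\mathbb{R}^2$ with $|AB|=a_1$, $|BC|=a_2$, $|CD|=a_3$, $|DA|=a_4$. $\phi_i$ is the exterior (turning) angle from the direction of side $i-1$ to the direction of side $i$ when the perimeter is traversed in the order $1,2,3,4$ (so $\phi_1,\dots,\phi_4$ sit at $A,\dots,D$), and $z_i=\tan\frac{\phi_i}{2}$. The complexified configuration space $Q_{or}^{\mathbb{C}}(a)$ of oriented quadrilaterals is the algebraic curve in $(\mathbb{CP}^1)^4\ni(z_1,z_2,z_3,z_4)$ given by the following six equations, each understood in bihomogeneous form. For $i=1,2,3,4$: $$\bar a_i(s-a_i-a_{i+2})z_i^2z_{i+1}^2+\bar a_{i+3}(s-a_{i+2}-a_{i+3})z_i^2+\bar a_{i+1}(s-a_{i+1}-a_{i+2})z_{i+1}^2-2a_{i+1}a_{i+3}z_iz_{i+1}+s\bar a_{i+2}=0,$$ and for $i=1,2$: $$(s-a_{i+2}-a_{i+3})(s-a_{i+1}-a_{i+3})z_i^2z_{i+2}^2-\bar a_i\bar a_{i+3}z_i^2+\bar a_{i+1}\bar a_{i+2}z_{i+2}^2+s(s-a_{i+1}-a_{i+2})=0.$$ The complexified configuration space of non-oriented quadrilaterals is the quotient $Q^{\mathbb{C}}(a)=Q_{or}^{\mathbb{C}}(a)/\big((z_1,z_2,z_3,z_4)\sim(-z_1,-z_2,-z_3,-z_4)\big)$; the quotient map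 is a double cover of elliptic curves. It is the complexification of the space of congruence classes (orientation-reversing congruences allowed) of quadrilaterals with side lengths $a$. The squared diagonal lengths are meromorphic functions on $Q^{\mathbb{C}}(a)$: the squared length of the diagonal $AC$ is $a_1^2+a_2^2+2a_1a_2\cos\phi_2$ and that of $BD$ is $a_1^2+a_4^2+2a_1a_4\cos\phi_1$, where $\cos\phi_i=\frac{1-z_i^2}{1+z_i^2}$. "Same diagonal lengths" means that corresponding points have equal squared lengths of $AC$ and equal squared lengths of $BD$.
   Formalization: In (iii) the first sentence is proved with lattice shapes taken compatibly with complex conjugation, and also abstractly for rectangular lattices that are not square; with square lattices allowed abstractly it fails, e.g. for a=(1,1,1,√(3+2√3)). *)

theory Defs
  imports "HOL-Analysis.Analysis"
begin

section \<open>Complex spaces\<close>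

text \<open>
  A (reduced) complex space is represented by its topology together with its sheaf of
  holomorphic functions: \<open>hol X U\<close> consists of the functions that are holomorphic on the
  open set \<open>U\<close>; only their values on \<open>U\<close> matter.  Holomorphic functions on a quotient are
  the invariant ones upstairs, and holomorphic functions on a subspace are those that are locally
  restrictions of ambient holomorphic functions.
\<close>

record 'a cspace =
  tops :: "'a topology"
  hol :: "'a set \<Rightarrow> ('a \<Rightarrow> complex) set"

definition points :: "'a cspace \<Rightarrow> 'a set" where
  "points X = topspace (tops X)"

definition quotient_topology :: "'a topology \<Rightarrow> ('a \<Rightarrow> 'b) \<Rightarrow> 'b topology" where
  "quotient_topology T p =
     topology (\<lambda>U. U \<subseteq> p ` topspace T \<and> openin T {x \<in> topspace T. p x \<in> U})"

lemma openin_quotient_topology: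
  "openin (quotient_topology T p) U \<longleftrightarrow>
     U \<subseteq> p ` topspace T \<and> openin T {x \<in> topspace T. p x \<in> U}"
proof -
  have "istopology (\<lambda>U. U \<subseteq> p ` topspace T \<and> openin T {x \<in> topspace T. p x \<in> U})"
    unfolding istopology_def
  proof (intro conjI allI impI; (elim conjE)?)
    fix S S' assume "openin T {x \<in> topspace T. p x \<in> S}" "openin T {x \<in> topspace T. p x \<in> S'}"
    then have "openin T ({x \<in> topspace T. p x \<in> S} \<inter> {x \<in> topspace T. p x \<in> S'})" by blast
    also have "{x \<in> topspace T. p x \<in> S} \<inter> {x \<in> topspace T. p x \<in> S'}
        = {x \<in> topspace T. p x \<in> S \<inter> S'}" by blast
    finally show "openin T {x \<in> topspace T. p x \<in> S \<inter> S'}" .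
  next
    fix K assume *: "\<forall>U\<in>K. U \<subseteq> p ` topspace T \<and> openin T {x \<in> topspace T. p x \<in> U}"
    then have "openin T (\<Union>U\<in>K. {x \<in> topspace T. p x \<in> U})" by blast
    also have "(\<Union>U\<in>K. {x \<in> topspace T. p x \<in> U}) = {x \<in> topspace T. p x \<in> \<Union>K}" by blast
    finally show "openin T {x \<in> topspace T. p x \<in> \<Union>K}" .
  qed blast+
  then show ?thesis
    by (simp add: quotient_topology_def topology_inverse')
qed

lemma topspace_quotient_topology [simp]: "topspace (quotient_topology T p) = p ` topspace T"
proof (rule antisym)
  show "topspace (quotient_topology T p) \<subseteq> p ` topspace T"
    using openin_topspace[of "quotient_topology T p"] unfolding openin_quotient_topology by blast
  have "{x \<in> topspace T. p x \<in> p ` topspace T} = topspace T" by auto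
  then have "openin (quotient_topology T p) (p ` topspace T)"
    by (simp add: openin_quotient_topology)
  then show "p ` topspace T \<subseteq> topspace (quotient_topology T p)"
    by (rule openin_subset)
qed

lemma quotient_map_quotient_topology: "quotient_map T (quotient_topology T p) p"
  by (simp add: quotient_map_def openin_quotient_topology)

definition quotient_space :: "'a cspace \<Rightarrow> ('a \<Rightarrow> 'b) \<Rightarrow> 'b cspace" where
  "quotient_space X p =
     \<lparr>tops = quotient_topology (tops X) p,
      hol = (\<lambda>U. {f. f \<circ> p \<in> hol X {x \<in> points X. p x \<in> U}})\<rparr>"

definition subspace_of :: "'a cspace \<Rightarrow> 'a set \<Rightarrow> 'a cspace" where
  "subspace_of X S =
     \<lparr>tops = subtopology (tops X) S,
      hol = (\<lambda>U. {f. \<forall>x\<in>U. \<exists>V g. openin (tops X) V \<and> x \<in> V \<and> g \<in> hol X V \<and>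
                                  (\<forall>y \<in> U \<inter> V. f y = g y)})\<rparr>"

definition biholomorphic :: "'a cspace \<Rightarrow> 'b cspace \<Rightarrow> ('a \<Rightarrow> 'b) \<Rightarrow> bool" where
  "biholomorphic X Y h \<longleftrightarrow>
     homeomorphic_map (tops X) (tops Y) h \<and>
     (\<forall>V f. openin (tops Y) V \<longrightarrow> (f \<in> hol Y V \<longleftrightarrow> f \<circ> h \<in> hol X {x \<in> points X. h x \<in> V}))"

section \<open>Lattices and complex tori\<close>

definition lattice_of :: "complex \<Rightarrow> complex \<Rightarrow> complex set" where
  "lattice_of v w = {of_int m * v + of_int n * w | m n. True}"

definition rectangular :: "complex set \<Rightarrow> bool" where
  "rectangular \<Lambda> \<longleftrightarrow> (\<exists>v w. v \<noteq> 0 \<and> w \<noteq> 0 \<and> v \<bullet> w = 0 \<and> \<Lambda> = lattice_of v w)"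

text \<open>The condition \<open>Im (v * cnj w) \<noteq> 0\<close> is linear independence over the reals.\<close>

definition rhombic :: "complex set \<Rightarrow> bool" where
  "rhombic \<Lambda> \<longleftrightarrow> (\<exists>v w. Im (v * cnj w) \<noteq> 0 \<and> norm v = norm w \<and> \<Lambda> = lattice_of v w)"

text \<open>
  The same two shapes for a lattice whose torus carries the real structure induced by
  \<open>cnj\<close>: the rectangle has its sides, respectively the rhombus has its diagonals, parallel to the
  coordinate axes.  A square lattice is both \<open>rectangular\<close> and \<open>rhombic\<close>, but no lattice
  is both \<open>real_rectangular\<close> and \<open>real_rhombic\<close>.
\<close>

definition real_rectangular :: "complex set \<Rightarrow> bool" where
  "real_rectangular \<Lambda> \<longleftrightarrow>
     (\<exists>x y :: real. x \<noteq> 0 \<and> y \<noteq> 0 \<and> \<Lambda> = lattice_of (of_real x) (\<i> * of_real y))"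

definition real_rhombic :: "complex set \<Rightarrow> bool" where
  "real_rhombic \<Lambda> \<longleftrightarrow> (\<exists>w. Re w \<noteq> 0 \<and> Im w \<noteq> 0 \<and> \<Lambda> = lattice_of w (cnj w))"

lemma real_rectangular_imp_rectangular: "real_rectangular \<Lambda> \<Longrightarrow> rectangular \<Lambda>"
  unfolding real_rectangular_def rectangular_def
proof (elim exE conjE)
  fix x y :: real assume "x \<noteq> 0" "y \<noteq> 0" "\<Lambda> = lattice_of (of_real x) (\<i> * of_real y)"
  then show "\<exists>v w. v \<noteq> 0 \<and> w \<noteq> 0 \<and> v \<bullet> w = 0 \<and> \<Lambda> = lattice_of v w"
    by (intro exI[of _ "of_real x"] exI[of _ "\<i> * of_real y"]) (simp add: inner_complex_def)
qed

lemma real_rhombic_imp_rhombic: "real_rhombic \<Lambda> \<Longrightarrow> rhombic \<Lambda>"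
  unfolding real_rhombic_def rhombic_def
proof (elim exE conjE)
  fix w assume "Re w \<noteq> 0" "Im w \<noteq> 0" "\<Lambda> = lattice_of w (cnj w)"
  then show "\<exists>v w. Im (v * cnj w) \<noteq> 0 \<and> norm v = norm w \<and> \<Lambda> = lattice_of v w"
    by (intro exI[of _ w] exI[of _ "cnj w"]) (simp add: complex_mod_cnj)
qed

definition complex_plane :: "complex cspace" where
  "complex_plane = \<lparr>tops = euclidean, hol = (\<lambda>U. {f. f holomorphic_on U})\<rparr>"

definition lattice_coset :: "complex set \<Rightarrow> complex \<Rightarrow> complex set" where
  "lattice_coset \<Lambda> z = (\<lambda>l. z + l) ` \<Lambda>"

definition torus :: "complex set \<Rightarrow> complex set cspace" where
  "torus \<Lambda> = quotient_space complex_plane (lattice_coset \<Lambda>)"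

text \<open>
  \<open>real_torus \<Lambda> X \<tau>\<close>: \<open>X\<close> is isomorphic to \<open>\<complex>/\<Lambda>\<close> by an isomorphism that carries
  complex conjugation of \<open>\<complex>\<close> to the complex conjugation \<open>\<tau>\<close> of \<open>X\<close>.
\<close>

definition real_torus :: "complex set \<Rightarrow> 'a cspace \<Rightarrow> ('a \<Rightarrow> 'a) \<Rightarrow> bool" where
  "real_torus \<Lambda> X \<tau> \<longleftrightarrow>
     (\<exists>h. biholomorphic (torus \<Lambda>) X h \<and>
          (\<forall>z. h (lattice_coset \<Lambda> (cnj z)) = \<tau> (h (lattice_coset \<Lambda> z))))"

definition has_rectangular_lattice :: "'a cspace \<Rightarrow> ('a \<Rightarrow> 'a) \<Rightarrow> bool" where
  "has_rectangular_lattice X \<tau> \<longleftrightarrow> (\<exists>\<Lambda>. real_rectangular \<Lambda> \<and> real_torus \<Lambda> X \<tau>)"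

definition has_rhombic_lattice :: "'a cspace \<Rightarrow> ('a \<Rightarrow> 'a) \<Rightarrow> bool" where
  "has_rhombic_lattice X \<tau> \<longleftrightarrow> (\<exists>\<Lambda>. real_rhombic \<Lambda> \<and> real_torus \<Lambda> X \<tau>)"

section \<open>The complex projective line and its fourth power\<close>

text \<open>The class of \<open>(x, y)\<close> is the point \<open>[x : y]\<close>, that is, \<open>z = x / y\<close>.\<close>

definition cp1_rel :: "complex \<times> complex \<Rightarrow> complex \<times> complex \<Rightarrow> bool" where
  "cp1_rel p q \<longleftrightarrow> p \<noteq> (0, 0) \<and> q \<noteq> (0, 0) \<and> fst p * snd q = fst q * snd p"

quotient_type cp1 = "complex \<times> complex" / partial: cp1_rel
proof (rule part_equivpI)
  show "\<exists>p. cp1_rel p p"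
    by (rule exI[of _ "(1, 0)"]) (simp add: cp1_rel_def)
  show "symp cp1_rel"
    by (auto simp: symp_def cp1_rel_def)
  show "transp cp1_rel"
  proof (rule transpI)
    fix p q r :: "complex \<times> complex"
    assume pq: "cp1_rel p q" and qr: "cp1_rel q r"
    obtain a b where p: "p = (a, b)" by (cases p)
    obtain c d where q: "q = (c, d)" by (cases q)
    obtain e f where r: "r = (e, f)" by (cases r)
    have 1: "a * d = c * b" and 2: "c * f = e * d" and 3: "c \<noteq> 0 \<or> d \<noteq> 0"
      using pq qr by (auto simp: cp1_rel_def p q r)
    have "c * (a * f) = a * (c * f)" by (simp add: ac_simps)
    also have "\<dots> = e * (a * d)" by (simp add: 2 ac_simps)
    also have "\<dots> = c * (e * b)" by (simp add: 1 ac_simps)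
    finally have c: "c * (a * f) = c * (e * b)" .
    have "d * (a * f) = (a * d) * f" by (simp add: ac_simps)
    also have "\<dots> = b * (c * f)" by (simp add: 1 ac_simps)
    also have "\<dots> = d * (e * b)" by (simp add: 2 ac_simps)
    finally have "d * (a * f) = d * (e * b)" .
    with c have "c = 0 \<or> a * f = e * b" "d = 0 \<or> a * f = e * b" by simp_all
    then have "a * f = e * b" using 3 by blast
    then show "cp1_rel p r"
      using pq qr by (simp add: cp1_rel_def p q r)
  qed
qed

lift_definition cp1_neg :: "cp1 \<Rightarrow> cp1" is "\<lambda>(x, y). (- x, y)"
  by (auto simp: cp1_rel_def)

lift_definition cp1_cnj :: "cp1 \<Rightarrow> cp1" is "\<lambda>(x, y). (cnj x, cnj y)"
  by (auto simp: cp1_rel_def) (metis complex_cnj_mult)+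

definition neg4 :: "cp1 ^ 4 \<Rightarrow> cp1 ^ 4" where
  "neg4 P = (\<chi> i. cp1_neg (P $ i))"

definition cnj4 :: "cp1 ^ 4 \<Rightarrow> cp1 ^ 4" where
  "cnj4 P = (\<chi> i. cp1_cnj (P $ i))"

text \<open>
  A pair of vectors \<open>(x, y)\<close> collects homogeneous coordinates \<open>[x\<^sub>i : y\<^sub>i]\<close> of four points.
  Holomorphy in several variables is complex differentiability: the real derivative exists and
  commutes with complex scalars.
\<close>

definition hom_coords :: "((complex ^ 4) \<times> (complex ^ 4)) set" where
  "hom_coords = {(x, y). \<forall>i. (x $ i, y $ i) \<noteq> (0, 0)}"

definition hom_space :: "((complex ^ 4) \<times> (complex ^ 4)) cspace" where
  "hom_space =
     \<lparr>tops = top_of_set hom_coords,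
      hol = (\<lambda>U. {f. \<forall>p\<in>U. \<exists>D. (f has_derivative D) (at p) \<and>
                            (\<forall>c u v. D (c *s u, c *s v) = c * D (u, v))})\<rparr>"

definition hom_proj :: "(complex ^ 4) \<times> (complex ^ 4) \<Rightarrow> cp1 ^ 4" where
  "hom_proj = (\<lambda>(x, y). \<chi> i. abs_cp1 (x $ i, y $ i))"

definition cp1_power4 :: "(cp1 ^ 4) cspace" where
  "cp1_power4 = quotient_space hom_space hom_proj"

section \<open>Configuration spaces of quadrilaterals\<close>

text \<open>
  Indices range over the type \<open>4\<close>, whose arithmetic is modulo 4 (so the index 4 is 0).
\<close>

definition half_perimeter :: "real ^ 4 \<Rightarrow> real" where
  "half_perimeter a = (\<Sum>i\<in>UNIV. a $ i) / 2"

definition bar :: "real ^ 4 \<Rightarrow> real ^ 4" where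
  "bar a = (\<chi> i. half_perimeter a - a $ i)"

definition adjacent_form :: "real ^ 4 \<Rightarrow> 4 \<Rightarrow> complex ^ 4 \<Rightarrow> complex ^ 4 \<Rightarrow> complex" where
  "adjacent_form a i x y = (let s = half_perimeter a in
      of_real (bar a $ i * (s - a $ i - a $ (i + 2))) * (x $ i)\<^sup>2 * (x $ (i + 1))\<^sup>2
    + of_real (bar a $ (i + 3) * (s - a $ (i + 2) - a $ (i + 3))) * (x $ i)\<^sup>2 * (y $ (i + 1))\<^sup>2
    + of_real (bar a $ (i + 1) * (s - a $ (i + 1) - a $ (i + 2))) * (y $ i)\<^sup>2 * (x $ (i + 1))\<^sup>2
    - of_real (2 * a $ (i + 1) * a $ (i + 3)) * (x $ i * y $ i) * (x $ (i + 1) * y $ (i + 1))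
    + of_real (s * bar a $ (i + 2)) * (y $ i)\<^sup>2 * (y $ (i + 1))\<^sup>2)"

definition opposite_form :: "real ^ 4 \<Rightarrow> 4 \<Rightarrow> complex ^ 4 \<Rightarrow> complex ^ 4 \<Rightarrow> complex" where
  "opposite_form a i x y = (let s = half_perimeter a in
      of_real ((s - a $ (i + 2) - a $ (i + 3)) * (s - a $ (i + 1) - a $ (i + 3)))
        * (x $ i)\<^sup>2 * (x $ (i + 2))\<^sup>2
    - of_real (bar a $ i * bar a $ (i + 3)) * (x $ i)\<^sup>2 * (y $ (i + 2))\<^sup>2
    + of_real (bar a $ (i + 1) * bar a $ (i + 2)) * (y $ i)\<^sup>2 * (x $ (i + 2))\<^sup>2
    + of_real (s * (s - a $ (i + 1) - a $ (i + 2))) * (y $ i)\<^sup>2 * (y $ (i + 2))\<^sup>2)"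

definition Qor_set :: "real ^ 4 \<Rightarrow> (cp1 ^ 4) set" where
  "Qor_set a = hom_proj ` {(x, y) \<in> hom_coords.
     (\<forall>i. adjacent_form a i x y = 0) \<and> (\<forall>i\<in>{1, 2}. opposite_form a i x y = 0)}"

definition Qor :: "real ^ 4 \<Rightarrow> (cp1 ^ 4) cspace" where
  "Qor a = subspace_of cp1_power4 (Qor_set a)"

definition unoriented :: "cp1 ^ 4 \<Rightarrow> (cp1 ^ 4) set" where
  "unoriented P = {P, neg4 P}"

definition Q :: "real ^ 4 \<Rightarrow> (cp1 ^ 4) set cspace" where
  "Q a = quotient_space (Qor a) unoriented"

text \<open>
  \<open>sq_diagonal b c z\<close> is \<open>b\<^sup>2 + c\<^sup>2 + 2 b c (1 - z\<^sup>2) / (1 + z\<^sup>2)\<close> as a point of the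
  projective line.  It does not depend on the chosen representative of \<open>z\<close>, and for
  \<open>b, c \<noteq> 0\<close> numerator and denominator never vanish simultaneously.
\<close>

definition sq_diagonal :: "real \<Rightarrow> real \<Rightarrow> cp1 \<Rightarrow> cp1" where
  "sq_diagonal b c z = (case rep_cp1 z of (x, y) \<Rightarrow>
     abs_cp1 (of_real (b\<^sup>2 + c\<^sup>2) * (y\<^sup>2 + x\<^sup>2) + of_real (2 * b * c) * (y\<^sup>2 - x\<^sup>2), y\<^sup>2 + x\<^sup>2))"

definition sq_AC :: "real ^ 4 \<Rightarrow> cp1 ^ 4 \<Rightarrow> cp1" where
  "sq_AC a P = sq_diagonal (a $ 1) (a $ 2) (P $ 2)"

definition sq_BD :: "real ^ 4 \<Rightarrow> cp1 ^ 4 \<Rightarrow> cp1" where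
  "sq_BD a P = sq_diagonal (a $ 1) (a $ 4) (P $ 1)"

definition diagonal_isomorphism ::
    "real ^ 4 \<Rightarrow> real ^ 4 \<Rightarrow> ((cp1 ^ 4) set \<Rightarrow> (cp1 ^ 4) set) \<Rightarrow> bool" where
  "diagonal_isomorphism a b h \<longleftrightarrow>
     biholomorphic (Q a) (Q b) h \<and>
     (\<forall>P \<in> points (Qor a). \<forall>P' \<in> points (Qor b). h (unoriented P) = unoriented P' \<longrightarrow>
        sq_AC a P = sq_AC b P' \<and> sq_BD a P = sq_BD b P')"

definition is_lift ::
    "real ^ 4 \<Rightarrow> ((cp1 ^ 4) set \<Rightarrow> (cp1 ^ 4) set) \<Rightarrow> (cp1 ^ 4 \<Rightarrow> cp1 ^ 4) \<Rightarrow> bool" where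
  "is_lift a h g \<longleftrightarrow> (\<forall>P \<in> points (Qor a). unoriented (g P) = h (unoriented P))"

end

theory Submission
  imports Defs "HOL-Complex_Analysis.Complex_Analysis"
begin

text \<open>
  The equation between the opposite half-angle tangents \<open>z\<^sub>2 = F / G\<close> and \<open>z\<^sub>4 = H / K\<close> is
  parametrized by the intersection of two quadrics
  \<open>H\<^sup>2 = \<beta> F\<^sup>2 - \<delta> G\<^sup>2\<close>, \<open>K\<^sup>2 = \<alpha> F\<^sup>2 + \<gamma> G\<^sup>2\<close>, and \<open>z\<^sub>1\<close> and \<open>z\<^sub>3\<close> are rational
  functions on it.  Passing from \<open>a\<close> to \<open>bar a\<close> fixes \<open>\<alpha>\<close> and changes the sign of \<open>\<delta>\<close>, so
  one of the two side vectors has \<open>\<alpha> \<delta> < 0\<close>.  For that one, \<open>(F, G, H, K)\<close> are real multiples of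
  the four theta functions of the rectangular lattice spanned by \<open>L\<close> and \<open>2\<pi>\<i>\<close>.  The coordinates for
  the other one are \<open>(H, G, F, K)\<close> up to constants, which gives the isomorphism preserving diagonals.
  The periods of \<open>F / G\<close> and \<open>H / K\<close> form the lattice spanned by \<open>L\<close> and \<open>4\<pi>\<i>\<close>, those of
  \<open>H / G\<close> and \<open>F / K\<close> the rhombic lattice spanned by \<open>L \<plusminus> 2\<pi>\<i>\<close>; modulo the sign change of all
  \<open>z\<^sub>i\<close> both become the lattice of \<open>L\<close> and \<open>2\<pi>\<i>\<close>.  An isomorphism between two tori is affine,
  \<open>u \<mapsto> c u + d\<close>; if it respects the squared diagonal \<open>AC\<close>, which is an even function of degree 2,
  then \<open>c = \<plusminus>1\<close>, so a lift would force the two lattices to coincide.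
\<close>

text \<open>The obstacle is that all data live on the projective line: formulas for the tangents at
  \<open>A\<close> and \<open>C\<close> can become 0/0, and the comparison of \<open>BD\<close>
  needs a denominator that vanishes somewhere. Hence each of these vertices gets two alternative
  pairs of homogeneous coordinates, and identities proved where a denominator is nonzero are
  extended by the identity theorem. The modulus comes from \<beta> \<gamma> + \<alpha> \<delta> = a1
  a2 a3 a4. Since \<beta> and \<gamma> are positive, the right-hand side keeps - \<alpha> \<delta> /
  (\<beta> \<gamma>) below 1, and \<alpha> \<delta> < 0 keeps it above 0. The structure sheaf
  consists of restrictions of ambient functions, so a bijective parametrization is not enough: near
  each point some coordinate must be a local parameter. One of \<open>z_2\<close>,
  \<open>z_4\<close> always is, because a reflection of the plane at half a lattice point multiplies
  them by opposite signs. If it is \<open>bar a\<close> that has \<alpha> \<delta> < 0, then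
  \<open>Qor a\<close> is the rhombic curve and the premise of (iii) has to be refuted: an
  isomorphism of tori that respects conjugation has a real slope.\<close>

no_notation fps_nth (infixl "$" 75)

section \<open>Quotients of the plane by lattices\<close>

text \<open>Working with the map from the plane, not with a biholomorphism from
  \<open>torus \<Lambda>\<close>, keeps the explicit formulas on the plane; the biholomorphism is
  recovered by comparison with \<open>uniformized_torus\<close>.\<close>

definition uniformized :: "complex set \<Rightarrow> 'a cspace \<Rightarrow> (complex \<Rightarrow> 'a) \<Rightarrow> bool" where
  "uniformized \<Lambda> X \<pi> \<longleftrightarrow> quotient_map euclidean (tops X) \<pi> \<and>
     (\<forall>V f. openin (tops X) V \<longrightarrow> (f \<in> hol X V \<longleftrightarrow> (f \<circ> \<pi>) holomorphic_on {z. \<pi> z \<in> V})) \<and>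
     (\<forall>u v. \<pi> u = \<pi> v \<longleftrightarrow> u - v \<in> \<Lambda>)"

lemma uniformizedD:
  assumes "uniformized \<Lambda> X \<pi>"
  shows "quotient_map euclidean (tops X) \<pi>" "points X = range \<pi>"
    "openin (tops X) V \<Longrightarrow> f \<in> hol X V \<longleftrightarrow> (f \<circ> \<pi>) holomorphic_on {z. \<pi> z \<in> V}"
    "\<pi> u = \<pi> v \<longleftrightarrow> u - v \<in> \<Lambda>"
proof -
  show *: "quotient_map euclidean (tops X) \<pi>" using assms by (simp add: uniformized_def)
  show "points X = range \<pi>"
    using quotient_imp_surjective_map[OF *] by (simp add: points_def)
qed (use assms in \<open>auto simp: uniformized_def\<close>)

section \<open>Lattice cosets and the comparison of uniformizations\<close>

lemma lattice_of_0 [simp]: "0 \<in> lattice_of v w"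
  unfolding lattice_of_def by (rule CollectI, rule exI[of _ 0], rule exI[of _ 0]) simp

lemma lattice_of_add: "x \<in> lattice_of v w \<Longrightarrow> y \<in> lattice_of v w \<Longrightarrow> x + y \<in> lattice_of v w"
  unfolding lattice_of_def
proof safe
  fix m n m' n' :: int
  show "\<exists>ma na. of_int m * v + of_int n * w + (of_int m' * v + of_int n' * w)
      = of_int ma * v + of_int na * w \<and> True"
    by (rule exI[of _ "m + m'"], rule exI[of _ "n + n'"]) (simp add: algebra_simps)
qed

lemma lattice_of_minus: "x \<in> lattice_of v w \<Longrightarrow> - x \<in> lattice_of v w"
  unfolding lattice_of_def
proof safe
  fix m n :: int
  show "\<exists>ma na. - (of_int m * v + of_int n * w) = of_int ma * v + of_int na * w \<and> True"
    by (rule exI[of _ "- m"], rule exI[of _ "- n"]) simp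
qed

lemma lattice_of_diff: "x \<in> lattice_of v w \<Longrightarrow> y \<in> lattice_of v w \<Longrightarrow> x - y \<in> lattice_of v w"
  using lattice_of_add[of x v w "- y"] lattice_of_minus[of y v w] by simp

lemma lattice_coset_eq_iff:
  assumes "\<Lambda> = lattice_of v w"
  shows "lattice_coset \<Lambda> x = lattice_coset \<Lambda> y \<longleftrightarrow> x - y \<in> \<Lambda>"
proof
  assume "lattice_coset \<Lambda> x = lattice_coset \<Lambda> y"
  moreover have "x + 0 \<in> lattice_coset \<Lambda> x"
    unfolding lattice_coset_def assms using lattice_of_0 by blast
  ultimately have "x \<in> lattice_coset \<Lambda> y" by simp
  then show "x - y \<in> \<Lambda>" by (auto simp: lattice_coset_def)
next
  have *: "lattice_coset \<Lambda> a \<subseteq> lattice_coset \<Lambda> b" if "a - b \<in> \<Lambda>" for a b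
  proof
    fix c assume "c \<in> lattice_coset \<Lambda> a"
    then obtain l where l: "l \<in> \<Lambda>" "c = a + l" by (auto simp: lattice_coset_def)
    then have "c = b + ((a - b) + l)" "(a - b) + l \<in> \<Lambda>"
      using lattice_of_add that assms by auto
    then show "c \<in> lattice_coset \<Lambda> b" unfolding lattice_coset_def by blast
  qed
  assume "x - y \<in> \<Lambda>"
  then show "lattice_coset \<Lambda> x = lattice_coset \<Lambda> y"
    using *[of x y] *[of y x] lattice_of_minus[of "x - y" v w] assms by simp
qed

lemma uniformized_torus:
  assumes "\<Lambda> = lattice_of v w"
  shows "uniformized \<Lambda> (torus \<Lambda>) (lattice_coset \<Lambda>)"
proof -
  have "quotient_map euclidean (tops (torus \<Lambda>)) (lattice_coset \<Lambda>)"
    using quotient_map_quotient_topology[of euclidean "lattice_coset \<Lambda>"]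
    by (simp add: torus_def quotient_space_def complex_plane_def)
  then show ?thesis
    using lattice_coset_eq_iff[OF assms]
    by (simp add: uniformized_def torus_def quotient_space_def complex_plane_def points_def)
qed

text \<open>Both maps have the same fibres, so each descends along the other; the quotient property
  makes the descended maps continuous, and they are mutually inverse.\<close>

lemma uniformized_biholomorphic:
  assumes X: "uniformized \<Lambda> X \<pi>" and Y: "uniformized \<Lambda> Y \<rho>"
  shows "\<exists>h. biholomorphic X Y h \<and> (\<forall>z. h (\<pi> z) = \<rho> z)"
proof -
  note X' = uniformizedD[OF X] and Y' = uniformizedD[OF Y]
  define h k where "h = (\<lambda>x. \<rho> (SOME z. \<pi> z = x))" and "k = (\<lambda>y. \<pi> (SOME z. \<rho> z = y))"
  have h: "h (\<pi> z) = \<rho> z" for z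
  proof -
    have "\<pi> (SOME z'. \<pi> z' = \<pi> z) = \<pi> z" by (rule someI[of _ z]) simp
    then show ?thesis by (simp add: h_def X'(4) Y'(4))
  qed
  have k: "k (\<rho> z) = \<pi> z" for z
  proof -
    have "\<rho> (SOME z'. \<rho> z' = \<rho> z) = \<rho> z" by (rule someI[of _ z]) simp
    then show ?thesis by (simp add: k_def X'(4) Y'(4))
  qed
  have hc: "continuous_map (tops X) (tops Y) h"
  proof -
    have "continuous_map euclidean (tops Y) (h \<circ> \<pi>)"
      using quotient_imp_continuous_map[OF Y'(1)] by (simp add: o_def h)
    then show ?thesis using continuous_compose_quotient_map_eq[OF X'(1)] by blast
  qed
  have kc: "continuous_map (tops Y) (tops X) k"
  proof -
    have "continuous_map euclidean (tops X) (k \<circ> \<rho>)"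
      using quotient_imp_continuous_map[OF X'(1)] by (simp add: o_def k)
    then show ?thesis using continuous_compose_quotient_map_eq[OF Y'(1)] by blast
  qed
  have "homeomorphic_maps (tops X) (tops Y) h k"
    unfolding homeomorphic_maps_def
    using hc kc X'(2) Y'(2) h k by (auto simp: points_def)
  then have hom: "homeomorphic_map (tops X) (tops Y) h"
    using homeomorphic_map_maps by blast
  have "f \<in> hol Y V \<longleftrightarrow> f \<circ> h \<in> hol X {x \<in> points X. h x \<in> V}" if V: "openin (tops Y) V" for V f
  proof -
    have o: "openin (tops X) {x \<in> points X. h x \<in> V}"
      using openin_continuous_map_preimage[OF hc V] by (simp add: points_def)
    have e: "{z. \<pi> z \<in> {x \<in> points X. h x \<in> V}} = {z. \<rho> z \<in> V}"
      using X'(2) h by auto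
    have e2: "(f \<circ> h) \<circ> \<pi> = f \<circ> \<rho>" by (auto simp: h)
    show ?thesis unfolding X'(3)[OF o] Y'(3)[OF V] e e2 ..
  qed
  then have "biholomorphic X Y h" using hom by (auto simp: biholomorphic_def)
  then show ?thesis using h by blast
qed

lemma uniformized_compose:
  assumes X: "uniformized \<Lambda> X \<pi>" and h: "biholomorphic X Y h"
  shows "uniformized \<Lambda> Y (h \<circ> \<pi>)"
proof -
  note X' = uniformizedD[OF X]
  have hom: "homeomorphic_map (tops X) (tops Y) h" using h by (simp add: biholomorphic_def)
  have q: "quotient_map euclidean (tops Y) (h \<circ> \<pi>)"
    using quotient_map_compose[OF X'(1)] hom homeomorphic_map_def by blast
  have inj: "inj_on h (points X)"
    using homeomorphic_imp_injective_map[OF hom] by (simp add: points_def)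
  have "f \<in> hol Y V \<longleftrightarrow> (f \<circ> (h \<circ> \<pi>)) holomorphic_on {z. (h \<circ> \<pi>) z \<in> V}"
    if V: "openin (tops Y) V" for V f
  proof -
    have o: "openin (tops X) {x \<in> points X. h x \<in> V}"
      using openin_continuous_map_preimage[OF homeomorphic_imp_continuous_map[OF hom] V]
      by (simp add: points_def)
    have e: "{z. \<pi> z \<in> {x \<in> points X. h x \<in> V}} = {z. (h \<circ> \<pi>) z \<in> V}"
      using X'(2) by auto
    have "f \<in> hol Y V \<longleftrightarrow> f \<circ> h \<in> hol X {x \<in> points X. h x \<in> V}"
      using h V by (auto simp: biholomorphic_def)
    also have "\<dots> \<longleftrightarrow> ((f \<circ> h) \<circ> \<pi>) holomorphic_on {z. (h \<circ> \<pi>) z \<in> V}"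
      unfolding X'(3)[OF o] e ..
    finally show ?thesis by (simp only: o_assoc)
  qed
  moreover have "(h \<circ> \<pi>) u = (h \<circ> \<pi>) v \<longleftrightarrow> u - v \<in> \<Lambda>" for u v
  proof -
    have "h (\<pi> u) = h (\<pi> v) \<longleftrightarrow> \<pi> u = \<pi> v"
      using inj X'(2) by (auto dest: inj_onD)
    then show ?thesis by (simp add: X'(4))
  qed
  ultimately show ?thesis using q unfolding uniformized_def by blast
qed

section \<open>Discreteness, period domains and Liouville's theorem\<close>

text \<open>Pairing \<open>l = m v + n w\<close> with \<open>cnj w\<close> and \<open>cnj v\<close>
  reads off \<open>m\<close> and \<open>n\<close> times the covolume
  \<open>\<bar>Im (v * cnj w)\<bar>\<close>, up to sign. For a short \<open>l\<close> both pairings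
  are smaller than the covolume, so both integers vanish.\<close>

lemma lattice_discrete:
  assumes "Im (v * cnj w) \<noteq> 0"
  shows "\<exists>e>0. \<forall>l\<in>lattice_of v w. norm l < e \<longrightarrow> l = 0"
proof -
  define d where "d = \<bar>Im (v * cnj w)\<bar>"
  have d: "d > 0" using assms by (simp add: d_def)
  define e where "e = d / (norm v + norm w + 1)"
  have pos: "norm v + norm w + 1 > 0" by (smt (verit) norm_ge_zero)
  have e: "e > 0" using d pos by (simp add: e_def)
  have "l = 0" if l: "l \<in> lattice_of v w" "norm l < e" for l
  proof -
    obtain m n :: int where mn: "l = of_int m * v + of_int n * w"
      using l(1) by (auto simp: lattice_of_def)
    have lt: "norm l * (norm v + norm w + 1) < d"
      using l(2) pos by (simp add: e_def field_simps)
    have "\<bar>Im (l * cnj w)\<bar> \<le> norm l * norm w"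
      using abs_Im_le_cmod[of "l * cnj w"] by (simp add: norm_mult)
    also have "\<dots> \<le> norm l * (norm v + norm w + 1)"
      by (intro mult_left_mono) auto
    finally have 1: "\<bar>Im (l * cnj w)\<bar> < d" using lt by simp
    have "\<bar>Im (l * cnj v)\<bar> \<le> norm l * norm v"
      using abs_Im_le_cmod[of "l * cnj v"] by (simp add: norm_mult)
    also have "\<dots> \<le> norm l * (norm v + norm w + 1)"
      by (intro mult_left_mono) auto
    finally have 2: "\<bar>Im (l * cnj v)\<bar> < d" using lt by simp
    have "Im (l * cnj w) = of_int m * Im (v * cnj w)"
      by (simp add: mn algebra_simps)
    then have "\<bar>of_int m :: real\<bar> * d < 1 * d" using 1 by (simp add: d_def abs_mult)
    then have "m = 0" using d by (simp add: mult_less_cancel_right)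
    have "Im (l * cnj v) = - of_int n * Im (v * cnj w)"
      by (simp add: mn algebra_simps)
    then have "\<bar>of_int n :: real\<bar> * d < 1 * d" using 2 by (simp add: d_def abs_mult)
    then have "n = 0" using d by (simp add: mult_less_cancel_right)
    then show ?thesis using \<open>m = 0\<close> mn by simp
  qed
  then show ?thesis using e by blast
qed

text \<open>The real coefficients are those of Cramer's rule; rounding them down leaves coefficients
  in [0, 1), so the remainder is bounded by the two edges.\<close>

lemma lattice_reduce:
  assumes "Im (v * cnj w) \<noteq> 0"
  shows "\<exists>l\<in>lattice_of v w. norm (z - l) \<le> norm v + norm w"
proof -
  define \<alpha> \<beta> where "\<alpha> = Im (z * cnj w) / Im (v * cnj w)"
    and "\<beta> = - Im (z * cnj v) / Im (v * cnj w)"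
  have D: "Im (v * cnj w) = Im v * Re w - Re v * Im w" by simp
  have z: "z = of_real \<alpha> * v + of_real \<beta> * w"
  proof (rule complex_eqI)
    have eq: "\<alpha> * Im (v * cnj w) = Im (z * cnj w)" "\<beta> * Im (v * cnj w) = - Im (z * cnj v)"
      using assms by (simp_all add: \<alpha>_def \<beta>_def)
    have "Im (v * cnj w) * (\<alpha> * Re v + \<beta> * Re w) = (\<alpha> * Im (v * cnj w)) * Re v + (\<beta> * Im (v * cnj w)) * Re w"
      by (simp only: algebra_simps)
    also have "\<dots> = Im (v * cnj w) * Re z" unfolding eq by (simp add: algebra_simps)
    finally show "Re z = Re (of_real \<alpha> * v + of_real \<beta> * w)" using assms by simp
    have "Im (v * cnj w) * (\<alpha> * Im v + \<beta> * Im w) = (\<alpha> * Im (v * cnj w)) * Im v + (\<beta> * Im (v * cnj w)) * Im w"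
      by (simp only: algebra_simps)
    also have "\<dots> = Im (v * cnj w) * Im z" unfolding eq by (simp add: algebra_simps)
    finally show "Im z = Im (of_real \<alpha> * v + of_real \<beta> * w)" using assms by simp
  qed
  define l where "l = of_int \<lfloor>\<alpha>\<rfloor> * v + of_int \<lfloor>\<beta>\<rfloor> * w"
  have "l \<in> lattice_of v w" by (auto simp: l_def lattice_of_def)
  moreover have "norm (z - l) \<le> norm v + norm w"
  proof -
    have "z - l = of_real (frac \<alpha>) * v + of_real (frac \<beta>) * w"
      by (simp add: z l_def frac_def algebra_simps)
    then have "norm (z - l) \<le> norm (of_real (frac \<alpha>) * v) + norm (of_real (frac \<beta>) * w)"
      using norm_triangle_ineq by metis
    also have "\<dots> = frac \<alpha> * norm v + frac \<beta> * norm w"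
      by (simp add: norm_mult)
    also have "\<dots> \<le> 1 * norm v + 1 * norm w"
      by (intro add_mono mult_right_mono) (auto intro: less_imp_le frac_lt_1)
    finally show ?thesis by simp
  qed
  ultimately show ?thesis by blast
qed

lemma lattice_periodic_constant:
  assumes f: "f holomorphic_on UNIV" and lat: "Im (v * cnj w) \<noteq> 0"
    and per: "\<And>z l. l \<in> lattice_of v w \<Longrightarrow> f (z + l) = f z"
  shows "\<exists>c. \<forall>z. f z = c"
proof -
  have "range f \<subseteq> f ` cball 0 (norm v + norm w)"
  proof
    fix y assume "y \<in> range f"
    then obtain z where z: "y = f z" by blast
    obtain l where l: "l \<in> lattice_of v w" "norm (z - l) \<le> norm v + norm w"
      using lattice_reduce[OF lat] by blast
    have "f z = f (z - l)" using per[OF l(1), of "z - l"] by simp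
    moreover have "z - l \<in> cball 0 (norm v + norm w)" using l(2) by simp
    ultimately show "y \<in> f ` cball 0 (norm v + norm w)" using z by blast
  qed
  moreover have "compact (f ` cball 0 (norm v + norm w))"
    by (intro compact_continuous_image holomorphic_on_imp_continuous_on holomorphic_on_subset[OF f]) auto
  ultimately have "bounded (range f)" using compact_imp_bounded bounded_subset by blast
  then show ?thesis using Liouville_theorem[OF f] by (auto simp: constant_on_def)
qed

section \<open>Isomorphisms between quotients lift to affine maps\<close>

lemma uniformized_open_image:
  assumes X: "uniformized \<Lambda> X \<pi>" and U: "open U"
  shows "openin (tops X) (\<pi> ` U)"
proof -
  note X' = uniformizedD[OF X]
  have "{x. \<pi> x \<in> \<pi> ` U} = (\<Union>l\<in>\<Lambda>. (\<lambda>u. l + u) ` U)"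
  proof (intro equalityI subsetI)
    fix x assume "x \<in> {x. \<pi> x \<in> \<pi> ` U}"
    then obtain u where u: "u \<in> U" "\<pi> x = \<pi> u" by blast
    then have "x - u \<in> \<Lambda>" using X'(4) by blast
    moreover have "x = (x - u) + u" by simp
    ultimately show "x \<in> (\<Union>l\<in>\<Lambda>. (\<lambda>u. l + u) ` U)" using u(1) by blast
  next
    fix x assume "x \<in> (\<Union>l\<in>\<Lambda>. (\<lambda>u. l + u) ` U)"
    then obtain l u where "l \<in> \<Lambda>" "u \<in> U" "x = l + u" by blast
    then have "\<pi> x = \<pi> u" using X'(4)[of x u] by simp
    then show "x \<in> {x. \<pi> x \<in> \<pi> ` U}" using \<open>u \<in> U\<close> by blast
  qed
  then have "open {x. \<pi> x \<in> \<pi> ` U}"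
    using U by (auto intro!: open_translation open_UN)
  moreover have "\<pi> ` U \<subseteq> topspace (tops X)" using X'(2) by (auto simp: points_def)
  ultimately show ?thesis using X'(1) by (auto simp: quotient_map_def)
qed

text \<open>The two uniformizations have only the structure sheaf in common, so the lift is made
  from a section of it: the inverse branch \<open>f\<close> of \<open>\<pi>2\<close> on a ball too
  small to contain two congruent points. It is a section because along \<open>\<pi>2\<close> it is
  locally a translation; being a section, it is holomorphic along \<open>\<pi>1\<close> as
  well.\<close>

lemma uniformized_local_lift:
  assumes X: "uniformized \<Lambda>1 X \<pi>1" and Y: "uniformized \<Lambda>2 X \<pi>2"
    and e: "e > 0" "\<And>l. l \<in> \<Lambda>2 \<Longrightarrow> norm l < e \<Longrightarrow> l = 0" and w0: "\<pi>2 w0 = \<pi>1 z0"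
  shows "\<exists>r>0. \<exists>F. F holomorphic_on ball z0 r \<and> F z0 = w0 \<and> (\<forall>z\<in>ball z0 r. \<pi>2 (F z) = \<pi>1 z)"
proof -
  note X' = uniformizedD[OF X] and Y' = uniformizedD[OF Y]
  define B where "B = ball w0 (e/2)"
  define V where "V = \<pi>2 ` B"
  define f where "f = (\<lambda>x. SOME w. w \<in> B \<and> \<pi>2 w = x)"
  have V: "openin (tops X) V" unfolding V_def B_def by (rule uniformized_open_image[OF Y]) simp
  have f: "f (\<pi>2 w) = w" if "w \<in> B" for w
  proof -
    have "f (\<pi>2 w) \<in> B \<and> \<pi>2 (f (\<pi>2 w)) = \<pi>2 w"
      unfolding f_def by (rule someI[of _ w]) (use that in simp)
    then have *: "f (\<pi>2 w) \<in> B" "f (\<pi>2 w) - w \<in> \<Lambda>2" using Y'(4) by auto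
    have "norm (f (\<pi>2 w) - w) < e"
    proof -
      have "dist (f (\<pi>2 w)) w \<le> dist (f (\<pi>2 w)) w0 + dist w w0"
        by (rule dist_triangle2)
      then show ?thesis using *(1) that by (simp add: B_def dist_norm norm_minus_commute)
    qed
    then show ?thesis using e(2)[OF *(2)] by simp
  qed
  have "(f \<circ> \<pi>2) holomorphic_on {z. \<pi>2 z \<in> V}"
    unfolding holomorphic_on_def
  proof
    fix z assume "z \<in> {z. \<pi>2 z \<in> V}"
    then obtain w where w: "w \<in> B" "\<pi>2 z = \<pi>2 w" by (auto simp: V_def)
    define l where "l = z - w"
    have l: "l \<in> \<Lambda>2" using w Y'(4) by (simp add: l_def)
    have o: "open ((\<lambda>u. l + u) ` B)" unfolding B_def by (intro open_translation open_ball)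
    have zin: "z \<in> (\<lambda>u. l + u) ` B" using w(1) by (auto simp: l_def intro!: image_eqI[of _ _ w])
    have "((\<lambda>u. u - l) has_field_derivative 1) (at z)" by (auto intro!: derivative_eq_intros)
    then have "((f \<circ> \<pi>2) has_field_derivative 1) (at z)"
    proof (rule DERIV_cong_ev[THEN iffD1, rotated -1, OF _ refl _ refl])
      have "\<forall>\<^sub>F u in nhds z. u \<in> (\<lambda>u. l + u) ` B"
        using o zin by (simp add: eventually_nhds_in_open)
      then show "\<forall>\<^sub>F u in nhds z. u - l = (f \<circ> \<pi>2) u"
      proof (rule eventually_mono)
        fix u assume "u \<in> (\<lambda>u. l + u) ` B"
        then have *: "u - l \<in> B" by auto
        have "\<pi>2 u = \<pi>2 (u - l)" using Y'(4)[of u "u - l"] l by simp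
        then show "u - l = (f \<circ> \<pi>2) u" using f[OF *] by simp
      qed
    qed
    then show "(f \<circ> \<pi>2) field_differentiable (at z within {z. \<pi>2 z \<in> V})"
      using field_differentiable_at_within field_differentiable_def by blast
  qed
  then have "f \<in> hol X V" using Y'(3)[OF V] by blast
  then have h1: "(f \<circ> \<pi>1) holomorphic_on {z. \<pi>1 z \<in> V}" using X'(3)[OF V] by blast
  have "w0 \<in> B" using e(1) by (simp add: B_def)
  then have z0: "z0 \<in> {z. \<pi>1 z \<in> V}" using w0 by (auto simp: V_def intro!: image_eqI[of _ _ w0])
  have "open {z. \<pi>1 z \<in> V}"
    using openin_continuous_map_preimage[OF quotient_imp_continuous_map[OF X'(1)] V] by simp
  then obtain r where r: "r > 0" "ball z0 r \<subseteq> {z. \<pi>1 z \<in> V}"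
    using z0 open_contains_ball by blast
  have "\<pi>2 (f (\<pi>1 z)) = \<pi>1 z" if "z \<in> ball z0 r" for z
  proof -
    have "\<pi>1 z \<in> V" using that r(2) by blast
    then obtain w where "w \<in> B" "\<pi>1 z = \<pi>2 w" by (auto simp: V_def)
    then show ?thesis using f by simp
  qed
  moreover have "f (\<pi>1 z0) = w0" using f[OF \<open>w0 \<in> B\<close>] w0 by simp
  ultimately show ?thesis using r holomorphic_on_subset[OF h1 r(2)]
    by (intro exI[of _ r] conjI exI[of _ "f \<circ> \<pi>1"]) auto
qed

text \<open>Two lifts differ by a continuous function with values in a discrete set, hence by a
  constant on the ball.\<close>

lemma lifts_same_deriv:
  assumes F: "F holomorphic_on ball z r" and G: "G holomorphic_on ball z r" and r: "r > 0"
    and d: "\<And>u. u \<in> ball z r \<Longrightarrow> F u - G u \<in> lattice_of v w" and lat: "Im (v * cnj w) \<noteq> 0"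
  shows "deriv F z = deriv G z"
proof -
  obtain e where e: "e > 0" "\<And>l. l \<in> lattice_of v w \<Longrightarrow> norm l < e \<Longrightarrow> l = 0"
    using lattice_discrete[OF lat] by blast
  have "(\<lambda>u. F u - G u) constant_on ball z r"
  proof (rule continuous_discrete_range_constant)
    show "continuous_on (ball z r) (\<lambda>u. F u - G u)"
      using F G by (intro continuous_intros holomorphic_on_imp_continuous_on)
    fix x assume x: "x \<in> ball z r"
    show "\<exists>e>0. \<forall>y. y \<in> ball z r \<and> F y - G y \<noteq> F x - G x \<longrightarrow> e \<le> norm (F y - G y - (F x - G x))"
    proof (rule exI[of _ e], intro conjI allI impI e(1))
      fix y assume y: "y \<in> ball z r \<and> F y - G y \<noteq> F x - G x"
      then have "F y - G y - (F x - G x) \<in> lattice_of v w"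
        using lattice_of_diff d x by blast
      then show "e \<le> norm (F y - G y - (F x - G x))"
        using e(2) y by (meson eq_iff_diff_eq_0 not_le)
    qed
  qed simp
  then obtain c where c: "\<And>u. u \<in> ball z r \<Longrightarrow> F u = G u + c"
    by (auto simp: constant_on_def diff_eq_eq add.commute)
  have "z \<in> ball z r" using r by simp
  have dG: "(G has_field_derivative deriv G z) (at z)"
    using holomorphic_derivI[OF G _ \<open>z \<in> ball z r\<close>] by simp
  have "((\<lambda>u. G u + c) has_field_derivative deriv G z) (at z)"
    using dG by (auto intro!: derivative_eq_intros)
  then have "(F has_field_derivative deriv G z) (at z)"
    by (rule has_field_derivative_transform_within_open[OF _ open_ball \<open>z \<in> ball z r\<close>]) (simp add: c)
  then show ?thesis by (rule DERIV_imp_deriv)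
qed

text \<open>Local lifts of \<open>\<pi>1\<close> through \<open>\<pi>2\<close> are unique up to
  translation by \<open>\<Lambda>2\<close>, so their derivatives glue to an entire function; it is
  periodic with respect to \<open>\<Lambda>1\<close> and therefore constant. The derivative is
  globally defined before any global lift is known.\<close>

lemma uniformized_affine:
  assumes X: "uniformized \<Lambda>1 X \<pi>1" and L1: "\<Lambda>1 = lattice_of v1 w1" "Im (v1 * cnj w1) \<noteq> 0"
    and Y: "uniformized \<Lambda>2 X \<pi>2" and L2: "\<Lambda>2 = lattice_of v2 w2" "Im (v2 * cnj w2) \<noteq> 0"
  shows "\<exists>c d. c \<noteq> 0 \<and> (\<forall>z. \<pi>1 z = \<pi>2 (c * z + d)) \<and> \<Lambda>2 = (\<lambda>l. c * l) ` \<Lambda>1"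
proof -
  note X' = uniformizedD[OF X] and Y' = uniformizedD[OF Y]
  obtain e where e: "e > 0" "\<And>l. l \<in> \<Lambda>2 \<Longrightarrow> norm l < e \<Longrightarrow> l = 0"
    using lattice_discrete[OF L2(2)] L2(1) by blast
  define lft where "lft = (\<lambda>z r F. F holomorphic_on ball z r \<and> (\<forall>u\<in>ball z r. \<pi>2 (F u) = \<pi>1 u))"
  have lift: "\<exists>r>0. \<exists>F. lft z r F \<and> F z = w" if "\<pi>2 w = \<pi>1 z" for z w
    using uniformized_local_lift[OF X Y e that] unfolding lft_def by blast
  have surj: "\<exists>w. \<pi>2 w = \<pi>1 z" for z
    using X'(2) Y'(2) by (metis rangeE rangeI)
  \<comment> \<open>The derivative at \<open>z\<close> of any local lift; \<open>G0\<close> shows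
    that it does not depend on the lift.\<close>
  define G where "G = (\<lambda>z. SOME d. \<exists>r>0. \<exists>F. lft z r F \<and> deriv F z = d)"
  have sub: "lft u (r - dist z u) F" if "lft z r F" "u \<in> ball z r" for z u r F
  proof -
    have "ball u (r - dist z u) \<subseteq> ball z r"
    proof
      fix x assume "x \<in> ball u (r - dist z u)"
      then show "x \<in> ball z r" using dist_triangle[of z x u] by simp
    qed
    then show ?thesis using that(1) unfolding lft_def by (meson holomorphic_on_subset subsetD)
  qed
  have G0: "G z = deriv F z" if F: "lft z r F" "r > 0" for z r F
  proof -
    have "\<exists>r>0. \<exists>F. lft z r F \<and> deriv F z = G z"
      unfolding G_def by (rule someI_ex) (use F in blast)
    then obtain r' F' where F': "r' > 0" "lft z r' F'" "deriv F' z = G z" by blast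
    have m: "ball z (min r r') \<subseteq> ball z r" "ball z (min r r') \<subseteq> ball z r'" by auto
    have "deriv F' z = deriv F z"
    proof (rule lifts_same_deriv[of _ _ "min r r'", OF _ _ _ _ L2(2)])
      show "F' holomorphic_on ball z (min r r')" "F holomorphic_on ball z (min r r')"
        using F'(2) F(1) m holomorphic_on_subset unfolding lft_def by metis+
      fix u assume "u \<in> ball z (min r r')"
      then have "\<pi>2 (F' u) = \<pi>2 (F u)" using F'(2) F(1) unfolding lft_def by auto
      then show "F' u - F u \<in> lattice_of v2 w2" using Y'(4) L2(1) by blast
    qed (use F F' in auto)
    then show ?thesis using F'(3) by simp
  qed
  have G1: "G u = deriv F u" if "lft z r F" "u \<in> ball z r" for z r F u
    using G0[OF sub[OF that]] that(2) by simp
  have Ghol: "G holomorphic_on UNIV"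
    unfolding holomorphic_on_def
  proof
    fix z :: complex
    obtain w where "\<pi>2 w = \<pi>1 z" using surj by blast
    then obtain r F where F: "r > 0" "lft z r F" using lift by blast
    have "deriv F holomorphic_on ball z r"
      using F(2) unfolding lft_def by (auto intro: holomorphic_deriv)
    then have "(deriv F has_field_derivative deriv (deriv F) z) (at z)"
      using holomorphic_derivI[of "deriv F" "ball z r" z] F(1) by simp
    then have "(G has_field_derivative deriv (deriv F) z) (at z)"
      by (rule has_field_derivative_transform_within_open[of _ _ _ "ball z r"])
        (use F G1[OF F(2)] in auto)
    then show "G field_differentiable (at z within UNIV)"
      by (auto simp: field_differentiable_def)
  qed
  have Gper: "G (z + l) = G z" if l: "l \<in> lattice_of v1 w1" for z l
  proof -
    obtain w where "\<pi>2 w = \<pi>1 z" using surj by blast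
    then obtain r F where F: "r > 0" "lft z r F" using lift by blast
    have hF: "F holomorphic_on ball z r" using F(2) by (simp add: lft_def)
    have "lft (z + l) r (\<lambda>u. F (u - l))"
      unfolding lft_def
    proof
      have "(F \<circ> (\<lambda>u. u - l)) holomorphic_on ball (z + l) r"
        by (rule holomorphic_on_compose_gen[OF _ hF])
          (auto intro!: holomorphic_intros simp: dist_norm algebra_simps)
      then show "(\<lambda>u. F (u - l)) holomorphic_on ball (z + l) r" by (simp add: o_def)
      show "\<forall>u\<in>ball (z + l) r. \<pi>2 (F (u - l)) = \<pi>1 u"
      proof
        fix u assume "u \<in> ball (z + l) r"
        then have "u - l \<in> ball z r" by (simp add: dist_norm algebra_simps)
        then have "\<pi>2 (F (u - l)) = \<pi>1 (u - l)" using F(2) by (simp add: lft_def)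
        also have "\<dots> = \<pi>1 u" using X'(4)[of "u - l" u] lattice_of_minus[OF l] L1(1) by simp
        finally show "\<pi>2 (F (u - l)) = \<pi>1 u" .
      qed
    qed
    then have "G (z + l) = deriv (\<lambda>u. F (u - l)) (z + l)" using G0 F(1) by blast
    also have "\<dots> = deriv F z"
    proof (rule DERIV_imp_deriv)
      have "(F has_field_derivative deriv F z) (at (z + l - l))"
        using holomorphic_derivI[OF hF, of z] F(1) by simp
      then have "((\<lambda>u. F (u + - l)) has_field_derivative deriv F z) (at (z + l))"
        using DERIV_shift[of F "deriv F z" "z + l" "- l"] by simp
      then show "((\<lambda>u. F (u - l)) has_field_derivative deriv F z) (at (z + l))" by simp
    qed
    also have "\<dots> = G z" using G0[OF F(2,1)] by simp
    finally show ?thesis .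
  qed
  obtain c where c: "\<And>z. G z = c"
    using lattice_periodic_constant[OF Ghol L1(2) Gper] by blast
  have loc: "\<exists>r>0. \<forall>u\<in>ball z r. \<pi>1 u = \<pi>2 (w + c * (u - z))" if zw: "\<pi>2 w = \<pi>1 z" for z w
  proof -
    obtain r F where F: "r > 0" "lft z r F" "F z = w" using lift[OF zw] by blast
    have hF: "F holomorphic_on ball z r" using F(2) by (simp add: lft_def)
    have "\<exists>k. \<forall>u\<in>ball z r. F u - c * u = k"
    proof (rule has_field_derivative_zero_constant)
      fix u assume u: "u \<in> ball z r"
      have "(F has_field_derivative c) (at u)"
        using holomorphic_derivI[OF hF open_ball u] G1[OF F(2) u] c by simp
      then have "((\<lambda>u. F u - c * u) has_field_derivative 0) (at u)"
        by (auto intro!: derivative_eq_intros)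
      then show "((\<lambda>u. F u - c * u) has_field_derivative 0) (at u within ball z r)"
        by (rule has_field_derivative_at_within)
    qed simp
    then obtain k where k: "\<And>u. u \<in> ball z r \<Longrightarrow> F u - c * u = k" by blast
    have "w - c * z = k" using k[of z] F by simp
    then have "F u = w + c * (u - z)" if "u \<in> ball z r" for u
      using k[OF that] \<open>w - c * z = k\<close> by (simp add: algebra_simps)
    moreover have "\<pi>1 u = \<pi>2 (F u)" if "u \<in> ball z r" for u
      using F(2) that by (simp add: lft_def)
    ultimately show ?thesis using F(1) by (intro exI[of _ r]) simp
  qed
  obtain w0 where w0: "\<pi>2 w0 = \<pi>1 0" using surj by blast
  \<comment> \<open>Near any point \<open>\<pi>1\<close> is \<open>\<pi>2\<close> after an affine
    map of slope \<open>c\<close>. So agreement with the one fixed affine map is an open condition,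
    and so is disagreement; connectedness of the plane takes the place of a continuation of
    lifts.\<close>
  define S where "S = {z. \<pi>1 z = \<pi>2 (c * z + w0)}"
  have "open S"
    unfolding open_contains_ball
  proof
    fix z assume "z \<in> S"
    then have "\<pi>2 (c * z + w0) = \<pi>1 z" by (simp add: S_def)
    then obtain r where r: "r > 0" "\<forall>u\<in>ball z r. \<pi>1 u = \<pi>2 (c * z + w0 + c * (u - z))"
      using loc by blast
    then have "ball z r \<subseteq> S" by (auto simp: S_def algebra_simps)
    then show "\<exists>e>0. ball z e \<subseteq> S" using r(1) by blast
  qed
  moreover have "open (- S)"
    unfolding open_contains_ball
  proof
    fix z assume z: "z \<in> - S"
    obtain w where w: "\<pi>2 w = \<pi>1 z" using surj by blast
    then obtain r where r: "r > 0" "\<And>u. u\<in>ball z r \<Longrightarrow> \<pi>1 u = \<pi>2 (w + c * (u - z))"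
      using loc by blast
    have "u \<notin> S" if "u \<in> ball z r" for u
    proof
      assume "u \<in> S"
      then have "\<pi>2 (w + c * (u - z)) = \<pi>2 (c * u + w0)" using r(2)[OF that] by (simp add: S_def)
      then have "\<pi>2 w = \<pi>2 (c * z + w0)" by (simp add: Y'(4) algebra_simps)
      then show False using z w by (simp add: S_def)
    qed
    then show "\<exists>e>0. ball z e \<subseteq> - S" using r(1) by blast
  qed
  moreover have "0 \<in> S" using w0 by (simp add: S_def)
  ultimately have "S = UNIV" using clopen[of S] by (auto simp: closed_def)
  then have eq: "\<pi>1 z = \<pi>2 (c * z + w0)" for z by (auto simp: S_def)
  have lam: "l \<in> \<Lambda>1 \<longleftrightarrow> c * l \<in> \<Lambda>2" for l
  proof -
    have "l \<in> \<Lambda>1 \<longleftrightarrow> \<pi>1 l = \<pi>1 0" by (simp add: X'(4))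
    also have "\<dots> \<longleftrightarrow> c * l \<in> \<Lambda>2" by (simp add: eq Y'(4))
    finally show ?thesis .
  qed
  have "c \<noteq> 0"
  proof
    assume "c = 0"
    then have all: "l \<in> \<Lambda>1" for l using lam L2(1) by simp
    obtain e where "e > 0" "\<And>l. l \<in> \<Lambda>1 \<Longrightarrow> norm l < e \<Longrightarrow> l = 0"
      using lattice_discrete[OF L1(2)] L1(1) by blast
    moreover from this have "norm (of_real (e/2) :: complex) < e" by simp
    ultimately have "of_real (e/2) = (0::complex)" using all by blast
    then show False using \<open>e > 0\<close> by simp
  qed
  moreover have "\<Lambda>2 = (\<lambda>l. c * l) ` \<Lambda>1"
  proof (intro equalityI subsetI)
    fix l assume "l \<in> \<Lambda>2"
    then have "l / c \<in> \<Lambda>1" "l = c * (l / c)" using lam[of "l / c"] \<open>c \<noteq> 0\<close> by auto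
    then show "l \<in> (\<lambda>l. c * l) ` \<Lambda>1" by blast
  qed (use lam in blast)
  ultimately show ?thesis using eq by blast
qed

section \<open>Configuration spaces as quotients of the plane\<close>

lemma cp1_rel_refl_iff: "cp1_rel p p \<longleftrightarrow> p \<noteq> (0, 0)"
  by (cases p) (auto simp: cp1_rel_def)

lemma abs_cp1_eq_iff:
  assumes "p \<noteq> (0, 0)" "q \<noteq> (0, 0)"
  shows "abs_cp1 p = abs_cp1 q \<longleftrightarrow> fst p * snd q = fst q * snd p"
  using Quotient3_rel[OF Quotient3_cp1, of p q] assms by (auto simp: cp1_rel_def)

lemma cp1_cases: obtains x y where "z = abs_cp1 (x, y)" "(x, y) \<noteq> (0, 0)"
proof -
  have "abs_cp1 (rep_cp1 z) = z" by (rule Quotient3_abs_rep[OF Quotient3_cp1])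
  moreover have "cp1_rel (rep_cp1 z) (rep_cp1 z)" by (rule Quotient3_rep_reflp[OF Quotient3_cp1])
  ultimately show ?thesis using that[of "fst (rep_cp1 z)" "snd (rep_cp1 z)"] cp1_rel_refl_iff by auto
qed

lemma cp1_rel_scale:
  assumes "cp1_rel (x, y) (x', y')"
  shows "\<exists>t. t \<noteq> 0 \<and> x' = t * x \<and> y' = t * y"
proof (cases "y = 0")
  case True
  then have "x \<noteq> 0" "y' = 0" "x' \<noteq> 0" using assms by (auto simp: cp1_rel_def)
  then show ?thesis using True by (intro exI[of _ "x' / x"]) auto
next
  case False
  then have "y' \<noteq> 0" using assms by (auto simp: cp1_rel_def)
  then show ?thesis using False assms by (intro exI[of _ "y' / y"]) (auto simp: cp1_rel_def field_simps)
qed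

text \<open>With \<open>z = x / y\<close> this is inverse stereographic projection onto a sphere of
  radius 1/2 in \<open>\<complex> \<times> \<real>\<close>. An injective continuous map into a
  metric space separates the points of the quotient topology.\<close>

lift_definition cp1_chord :: "cp1 \<Rightarrow> complex \<times> real" is
  "\<lambda>(x, y). (x * cnj y / of_real ((norm x)\<^sup>2 + (norm y)\<^sup>2), (norm x)\<^sup>2 / ((norm x)\<^sup>2 + (norm y)\<^sup>2))"
proof -
  fix p q :: "complex \<times> complex"
  assume "cp1_rel p q"
  moreover obtain x y x' y' where pq: "p = (x, y)" "q = (x', y')" by (cases p, cases q) blast
  ultimately obtain t where t: "t \<noteq> 0" "x' = t * x" "y' = t * y" using cp1_rel_scale by blast
  have n: "norm t \<noteq> 0" using t by simp
  have "(norm (t * x))\<^sup>2 + (norm (t * y))\<^sup>2 = (norm t)\<^sup>2 * ((norm x)\<^sup>2 + (norm y)\<^sup>2)"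
    by (simp add: norm_mult power_mult_distrib algebra_simps)
  moreover have "t * x * cnj (t * y) = of_real ((norm t)\<^sup>2) * (x * cnj y)"
    by (simp only: complex_norm_square complex_cnj_mult mult_ac)
  ultimately show "(case p of (x, y) \<Rightarrow> (x * cnj y / of_real ((norm x)\<^sup>2 + (norm y)\<^sup>2), (norm x)\<^sup>2 / ((norm x)\<^sup>2 + (norm y)\<^sup>2)))
     = (case q of (x, y) \<Rightarrow> (x * cnj y / of_real ((norm x)\<^sup>2 + (norm y)\<^sup>2), (norm x)\<^sup>2 / ((norm x)\<^sup>2 + (norm y)\<^sup>2)))"
    unfolding pq t(2,3) prod.case using n
    by (simp only: of_real_mult) (simp add: norm_mult power_mult_distrib)
qed

lemma cp1_chord_abs:
  "(x, y) \<noteq> (0, 0) \<Longrightarrow> cp1_chord (abs_cp1 (x, y)) = (x * cnj y / of_real ((norm x)\<^sup>2 + (norm y)\<^sup>2), (norm x)\<^sup>2 / ((norm x)\<^sup>2 + (norm y)\<^sup>2))"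
  using cp1_chord.abs_eq[of "(x, y)"] by (simp add: eq_onp_def cp1_rel_refl_iff)

lemma norm_sum_pos: "(x, y) \<noteq> (0::complex, 0::complex) \<Longrightarrow> (norm x)\<^sup>2 + (norm y)\<^sup>2 > 0"
  by (auto simp: sum_power2_gt_zero_iff)

lemma cp1_chord_inj: "cp1_chord z = cp1_chord z' \<Longrightarrow> z = z'"
proof -
  assume eq: "cp1_chord z = cp1_chord z'"
  obtain x y where z: "z = abs_cp1 (x, y)" "(x, y) \<noteq> (0, 0)" by (rule cp1_cases)
  obtain x' y' where z': "z' = abs_cp1 (x', y')" "(x', y') \<noteq> (0, 0)" by (rule cp1_cases)
  define N N' where "N = (norm x)\<^sup>2 + (norm y)\<^sup>2" and "N' = (norm x')\<^sup>2 + (norm y')\<^sup>2"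
  have N: "N > 0" "N' > 0" using norm_sum_pos z z' by (auto simp: N_def N'_def)
  have 1: "x * cnj y * of_real N' = x' * cnj y' * of_real N" and 2: "(norm x)\<^sup>2 * N' = (norm x')\<^sup>2 * N"
    using eq N unfolding z(1) z'(1) cp1_chord_abs[OF z(2)] cp1_chord_abs[OF z'(2)]
    unfolding N_def[symmetric] N'_def[symmetric] by (simp_all add: field_simps)
  have 3: "(norm y)\<^sup>2 * N' = (norm y')\<^sup>2 * N" using 2 by (simp add: N_def N'_def algebra_simps)
  have "x * y' = x' * y"
  proof (cases "y = 0")
    case True
    then show ?thesis using 3 N by simp
  next
    case False
    then have "y' \<noteq> 0" using 3 N by auto
    have "(x * y') * (cnj y * cnj y' * of_real N') = (x * cnj y * of_real N') * (y' * cnj y')" by (simp add: mult_ac)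
    also have "\<dots> = x' * cnj y' * of_real N * of_real ((norm y')\<^sup>2)" unfolding 1 complex_norm_square ..
    also have "\<dots> = x' * cnj y' * of_real ((norm y')\<^sup>2 * N)" by (simp add: mult_ac)
    also have "\<dots> = x' * cnj y' * of_real N' * (y * cnj y)" unfolding 3[symmetric] of_real_mult complex_norm_square by (simp add: mult_ac)
    also have "\<dots> = (x' * y) * (cnj y * cnj y' * of_real N')" by (simp add: mult_ac)
    finally show ?thesis using False \<open>y' \<noteq> 0\<close> N by simp
  qed
  then show ?thesis using abs_cp1_eq_iff z z' by simp
qed

lemma hom_coords_iff: "p \<in> hom_coords \<longleftrightarrow> (\<forall>i. (fst p $ i, snd p $ i) \<noteq> (0, 0))"
  by (cases p) (simp add: hom_coords_def)

lemma hom_proj_nth: "hom_proj p $ i = abs_cp1 (fst p $ i, snd p $ i)"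
  by (cases p) (simp add: hom_proj_def)

section \<open>Topology and structure sheaf of the fourth power\<close>

lemma open_hom_coords: "open hom_coords"
proof -
  have eq: "hom_coords = (\<Inter>i. {p :: (complex^4) \<times> (complex^4). fst p $ i \<noteq> 0} \<union> {p. snd p $ i \<noteq> 0})"
    by (auto simp: hom_coords_iff)
  have "open ({p :: (complex^4) \<times> (complex^4). fst p $ i \<noteq> 0} \<union> {p. snd p $ i \<noteq> 0})" for i :: 4
    by (intro open_Un open_Collect_neq continuous_intros)
  then show ?thesis unfolding eq by (intro open_INT) auto
qed

lemma tops_cp1_power4: "tops cp1_power4 = quotient_topology (top_of_set hom_coords) hom_proj"
  by (simp add: cp1_power4_def quotient_space_def hom_space_def)

lemma openin_cp1_power4:
  "openin (tops cp1_power4) V \<longleftrightarrow> V \<subseteq> hom_proj ` hom_coords \<and> open {p \<in> hom_coords. hom_proj p \<in> V}"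
  unfolding tops_cp1_power4 openin_quotient_topology
  using openin_open_eq[OF open_hom_coords] by auto

lemma hol_cp1_power4:
  "g \<in> hol cp1_power4 V \<longleftrightarrow> (\<forall>p\<in>hom_coords. hom_proj p \<in> V \<longrightarrow>
     (\<exists>D. ((g \<circ> hom_proj) has_derivative D) (at p) \<and> (\<forall>c u v. D (c *s u, c *s v) = c * D (u, v))))"
  by (auto simp: cp1_power4_def quotient_space_def hom_space_def points_def)

lemma topspace_Qor: "topspace (tops (Qor b)) = Qor_set b" "points (Qor b) = Qor_set b"
proof -
  have "Qor_set b \<subseteq> hom_proj ` hom_coords" unfolding Qor_set_def by blast
  then show *: "topspace (tops (Qor b)) = Qor_set b"
    by (auto simp: Qor_def subspace_of_def tops_cp1_power4)
  then show "points (Qor b) = Qor_set b" by (simp add: points_def)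
qed

lemma hol_Qor: "f \<in> hol (Qor b) V \<longleftrightarrow>
   (\<forall>x\<in>V. \<exists>V' g. openin (tops cp1_power4) V' \<and> x \<in> V' \<and> g \<in> hol cp1_power4 V' \<and> (\<forall>y\<in>V \<inter> V'. f y = g y))"
  by (simp add: Qor_def subspace_of_def)

lemma continuous_cp1_power4:
  assumes "continuous_on hom_coords (\<lambda>p. f (hom_proj p))"
  shows "continuous_map (tops cp1_power4) euclidean f"
  unfolding tops_cp1_power4
proof (rule continuous_compose_quotient_map[OF quotient_map_quotient_topology])
  show "continuous_map (top_of_set hom_coords) euclidean (f \<circ> hom_proj)"
    using assms by (simp add: o_def)
qed

lemma continuous_chord: "continuous_map (tops cp1_power4) euclidean (\<lambda>P. cp1_chord (P $ i))"
proof (rule continuous_cp1_power4)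
  let ?f = "\<lambda>p::(complex^4) \<times> (complex^4). (fst p $ i * cnj (snd p $ i) / of_real ((norm (fst p $ i))\<^sup>2 + (norm (snd p $ i))\<^sup>2),
       (norm (fst p $ i))\<^sup>2 / ((norm (fst p $ i))\<^sup>2 + (norm (snd p $ i))\<^sup>2))"
  have pos: "(norm (fst p $ i))\<^sup>2 + (norm (snd p $ i))\<^sup>2 \<noteq> 0" if "p \<in> hom_coords" for p
    using norm_sum_pos[of "fst p $ i" "snd p $ i"] that by (auto simp: hom_coords_iff)
  then have pos': "complex_of_real ((norm (fst p $ i))\<^sup>2 + (norm (snd p $ i))\<^sup>2) \<noteq> 0" if "p \<in> hom_coords" for p
    using that by (simp del: of_real_add)
  have "continuous_on hom_coords ?f"
    by (intro continuous_intros) (use pos pos' in auto)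
  moreover have "cp1_chord (hom_proj p $ i) = ?f p" if "p \<in> hom_coords" for p
    unfolding hom_proj_nth by (rule cp1_chord_abs) (use that hom_coords_iff in blast)
  ultimately show "continuous_on hom_coords (\<lambda>p. cp1_chord (hom_proj p $ i))"
    using continuous_on_cong by (metis (no_types, lifting))
qed

lemma continuous_chord_Qor: "continuous_map (tops (Qor b)) euclidean (\<lambda>P. cp1_chord (P $ i))"
  unfolding Qor_def subspace_of_def
  using continuous_map_from_subtopology[OF continuous_chord] by simp

text \<open>Needed so that a continuous map from a compact period domain is closed. Distinct points
  differ in some coordinate, and there \<open>cp1_chord\<close> separates them.\<close>

lemma Hausdorff_Qor: "Hausdorff_space (tops (Qor b))"
proof -
  have "continuous_map (tops (Qor b)) euclidean (\<lambda>P. cp1_chord (P $ i))" for i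
    by (rule continuous_chord_Qor)
  show ?thesis
    unfolding Hausdorff_space_def
  proof (intro allI impI)
    fix P P' assume *: "P \<in> topspace (tops (Qor b)) \<and> P' \<in> topspace (tops (Qor b)) \<and> P \<noteq> P'"
    then obtain i where "P $ i \<noteq> P' $ i" by (auto simp: vec_eq_iff)
    then have "cp1_chord (P $ i) \<noteq> cp1_chord (P' $ i)" using cp1_chord_inj by blast
    then obtain U V where UV: "open U" "open V" "cp1_chord (P $ i) \<in> U" "cp1_chord (P' $ i) \<in> V" "U \<inter> V = {}"
      using separation_t2[of "cp1_chord (P $ i)" "cp1_chord (P' $ i)"] by blast
    let ?T = "tops (Qor b)"
    let ?U = "{x \<in> topspace ?T. cp1_chord (x $ i) \<in> U}" and ?V = "{x \<in> topspace ?T. cp1_chord (x $ i) \<in> V}"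
    have "openin ?T ?U" "openin ?T ?V"
      using openin_continuous_map_preimage[OF continuous_chord_Qor] UV by auto
    then show "\<exists>U V. openin ?T U \<and> openin ?T V \<and> P \<in> U \<and> P' \<in> V \<and> disjnt U V"
      using * UV by (intro exI[of _ ?U] exI[of _ ?V]) (auto simp: disjnt_def)
  qed
qed

text \<open>Homogeneous coordinates are only required near each point, since a single formula for
  them may vanish in both entries elsewhere.\<close>

definition holomorphic_lifts :: "(complex \<Rightarrow> cp1 ^ 4) \<Rightarrow> bool" where
  "holomorphic_lifts \<Phi> \<longleftrightarrow> (\<forall>u0. \<exists>X Y r. r > 0 \<and>
     (\<forall>i. (\<lambda>u. X u $ i) holomorphic_on ball u0 r \<and> (\<lambda>u. Y u $ i) holomorphic_on ball u0 r) \<and>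
     (\<forall>u\<in>ball u0 r. (X u, Y u) \<in> hom_coords \<and> hom_proj (X u, Y u) = \<Phi> u))"

lemma continuous_on_vecI:
  fixes X :: "'a::topological_space \<Rightarrow> complex ^ 'n"
  assumes "\<And>i. continuous_on S (\<lambda>u. X u $ i)"
  shows "continuous_on S X"
  using continuous_on_vec_lambda[of S "\<lambda>i u. X u $ i"] assms by simp

lemma has_derivative_vecI:
  fixes X :: "complex \<Rightarrow> complex ^ 'n"
  assumes "\<And>i. ((\<lambda>u. X u $ i) has_field_derivative x' $ i) (at u0)"
  shows "(X has_derivative (\<lambda>h. h *s x')) (at u0)"
  unfolding has_derivative_def
proof
  have "linear (\<lambda>h. h *s x')"
    by (rule linearI) (simp_all add: vec_eq_iff algebra_simps)
  then show "bounded_linear (\<lambda>h. h *s x')" by (simp add: linear_conv_bounded_linear)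
  show "((\<lambda>y. (X y - X (netlimit (at u0)) - (y - netlimit (at u0)) *s x') /\<^sub>R norm (y - netlimit (at u0))) \<longlongrightarrow> 0) (at u0)"
  proof (rule vec_tendstoI)
    fix i
    have "((\<lambda>u. X u $ i) has_derivative (*) (x' $ i)) (at u0)"
      using assms[of i] by (simp add: has_field_derivative_def)
    then have "((\<lambda>y. (X y $ i - X (netlimit (at u0)) $ i - x' $ i * (y - netlimit (at u0))) /\<^sub>R norm (y - netlimit (at u0))) \<longlongrightarrow> 0) (at u0)"
      by (simp add: has_derivative_def)
    then show "((\<lambda>y. ((X y - X (netlimit (at u0)) - (y - netlimit (at u0)) *s x') /\<^sub>R norm (y - netlimit (at u0))) $ i) \<longlongrightarrow> 0 $ i) (at u0)"
      by (simp add: algebra_simps)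
  qed
qed

lemma holomorphic_lifts_continuous:
  assumes "holomorphic_lifts \<Phi>"
  shows "continuous_map euclidean (tops cp1_power4) \<Phi>"
  unfolding continuous_map_def
proof (intro conjI allI impI)
  have *: "\<Phi> u \<in> hom_proj ` hom_coords" for u
    using assms unfolding holomorphic_lifts_def by (metis centre_in_ball imageI)
  then show "\<Phi> \<in> topspace euclidean \<rightarrow> topspace (tops cp1_power4)"
    by (simp add: tops_cp1_power4)
  fix V assume V: "openin (tops cp1_power4) V"
  let ?W = "{p \<in> hom_coords. hom_proj p \<in> V}"
  have W: "open ?W" using V openin_cp1_power4 by blast
  have "open {u. \<Phi> u \<in> V}"
    unfolding open_contains_ball
  proof
    fix u0 assume u0: "u0 \<in> {u. \<Phi> u \<in> V}"
    obtain X Y r where r: "r > 0"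
      and XY: "\<And>i. (\<lambda>u. X u $ i) holomorphic_on ball u0 r" "\<And>i. (\<lambda>u. Y u $ i) holomorphic_on ball u0 r"
      and P: "\<And>u. u\<in>ball u0 r \<Longrightarrow> (X u, Y u) \<in> hom_coords \<and> hom_proj (X u, Y u) = \<Phi> u"
      using assms unfolding holomorphic_lifts_def by blast
    have "continuous_on (ball u0 r) (\<lambda>u. (X u, Y u))"
      by (intro continuous_on_Pair continuous_on_vecI holomorphic_on_imp_continuous_on XY)
    then have "open (ball u0 r \<inter> (\<lambda>u. (X u, Y u)) -` ?W)"
      using W by (intro continuous_open_preimage) auto
    moreover have "u0 \<in> ball u0 r \<inter> (\<lambda>u. (X u, Y u)) -` ?W" using u0 r P[of u0] by simp
    ultimately obtain e where "e > 0" "ball u0 e \<subseteq> ball u0 r \<inter> (\<lambda>u. (X u, Y u)) -` ?W"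
      by (rule openE)
    then show "\<exists>e>0. ball u0 e \<subseteq> {u. \<Phi> u \<in> V}"
      using P by (intro exI[of _ e]) (auto simp: subset_iff)
  qed
  then show "openin euclidean {x \<in> topspace euclidean. \<Phi> x \<in> V}" by simp
qed

text \<open>A closed disc of radius \<open>norm v + norm w\<close> already covers the image. It is
  compact and the target is Hausdorff, so the restriction is closed and hence a quotient map; a
  continuous map with such a restriction is a quotient map itself.\<close>

lemma quotient_map_Qor:
  assumes lifts: "holomorphic_lifts \<Phi>" and ran: "range \<Phi> = Qor_set b"
    and lat: "Im (v * cnj w) \<noteq> 0" and per: "\<And>u u'. u - u' \<in> lattice_of v w \<Longrightarrow> \<Phi> u = \<Phi> u'"
  shows "quotient_map euclidean (tops (Qor b)) \<Phi>"
proof -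
  define K where "K = cball (0::complex) (norm v + norm w)"
  have cont: "continuous_map euclidean (tops (Qor b)) \<Phi>"
    unfolding Qor_def subspace_of_def
    using holomorphic_lifts_continuous[OF lifts] ran by (auto simp: continuous_map_in_subtopology)
  have sub: "continuous_map (top_of_set K) (tops (Qor b)) \<Phi>"
    by (rule continuous_map_from_subtopology[OF cont])
  have img: "\<Phi> ` K = Qor_set b"
  proof
    show "Qor_set b \<subseteq> \<Phi> ` K"
    proof
      fix P assume "P \<in> Qor_set b"
      then obtain u where u: "P = \<Phi> u" using ran by blast
      obtain l where l: "l \<in> lattice_of v w" "norm (u - l) \<le> norm v + norm w"
        using lattice_reduce[OF lat] by blast
      have "P = \<Phi> (u - l)" using per[of u "u - l"] l(1) u by simp
      then show "P \<in> \<Phi> ` K" using l(2) by (auto simp: K_def)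
    qed
  qed (use ran in blast)
  have "compact_space (top_of_set K)" by (simp add: K_def compact_space_subtopology)
  then have "closed_map (top_of_set K) (tops (Qor b)) \<Phi>"
    using continuous_imp_closed_map[OF sub] Hausdorff_Qor by blast
  then have "quotient_map (top_of_set K) (tops (Qor b)) \<Phi>"
    using continuous_closed_imp_quotient_map[OF sub] img by (simp add: topspace_Qor)
  then show ?thesis
    using quotient_map_from_composition[OF continuous_map_from_subtopology[OF continuous_map_id] cont, of K]
    by (simp add: o_def)
qed

text \<open>Chain rule: complex linearity of the ambient differential \<open>D\<close> turns the
  derivative along the lift into multiplication by the number \<open>D (x', y')\<close>.\<close>

lemma hol_Qor_imp:
  assumes lifts: "holomorphic_lifts \<Phi>" and ran: "range \<Phi> = Qor_set b"
    and f: "f \<in> hol (Qor b) V" and open_V: "open {u. \<Phi> u \<in> V}"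
  shows "(f \<circ> \<Phi>) holomorphic_on {u. \<Phi> u \<in> V}"
  unfolding holomorphic_on_def
proof
  fix u0 assume u0: "u0 \<in> {u. \<Phi> u \<in> V}"
  then have "\<Phi> u0 \<in> V" by simp
  from f[unfolded hol_Qor, rule_format, OF this]
  obtain V' g where g: "openin (tops cp1_power4) V'" "\<Phi> u0 \<in> V'" "g \<in> hol cp1_power4 V'"
    "\<And>y. y \<in> V \<inter> V' \<Longrightarrow> f y = g y"
    by (elim exE conjE) (rule that, blast+)
  obtain X Y r where r: "r > 0"
    and XY: "\<And>i. (\<lambda>u. X u $ i) holomorphic_on ball u0 r" "\<And>i. (\<lambda>u. Y u $ i) holomorphic_on ball u0 r"
    and P: "\<And>u. u\<in>ball u0 r \<Longrightarrow> (X u, Y u) \<in> hom_coords \<and> hom_proj (X u, Y u) = \<Phi> u"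
    using lifts unfolding holomorphic_lifts_def by blast
  have u0r: "u0 \<in> ball u0 r" using r by simp
  define x' y' where "x' = (\<chi> i. deriv (\<lambda>u. X u $ i) u0)" and "y' = (\<chi> i. deriv (\<lambda>u. Y u $ i) u0)"
  have dX: "(X has_derivative (\<lambda>h. h *s x')) (at u0)"
    using holomorphic_derivI[OF XY(1) open_ball u0r] by (intro has_derivative_vecI) (simp add: x'_def)
  have dY: "(Y has_derivative (\<lambda>h. h *s y')) (at u0)"
    using holomorphic_derivI[OF XY(2) open_ball u0r] by (intro has_derivative_vecI) (simp add: y'_def)
  obtain D where D: "((g \<circ> hom_proj) has_derivative D) (at (X u0, Y u0))" "\<And>c u v. D (c *s u, c *s v) = c * D (u, v)"
    using g(2,3) P[OF u0r] unfolding hol_cp1_power4 by metis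
  have "((\<lambda>u. (X u, Y u)) has_derivative (\<lambda>h. (h *s x', h *s y'))) (at u0)"
    by (rule has_derivative_Pair[OF dX dY])
  then have "((\<lambda>u. (g \<circ> hom_proj) (X u, Y u)) has_derivative (\<lambda>h. D (h *s x', h *s y'))) (at u0)"
    by (rule has_derivative_compose) (rule D(1))
  then have d: "((\<lambda>u. (g \<circ> hom_proj) (X u, Y u)) has_field_derivative D (x', y')) (at u0)"
    unfolding has_field_derivative_def D(2) by (simp add: mult_commute_abs)
  let ?S = "ball u0 r \<inter> {u. \<Phi> u \<in> V} \<inter> {u. \<Phi> u \<in> V'}"
  have "open {u. \<Phi> u \<in> V'}"
    using openin_continuous_map_preimage[OF holomorphic_lifts_continuous[OF lifts] g(1)] by simp
  then have "open ?S" using open_V by blast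
  then have "(f \<circ> \<Phi> has_field_derivative D (x', y')) (at u0)"
    by (rule has_field_derivative_transform_within_open[OF d])
      (use u0 u0r g P in auto)
  then show "(f \<circ> \<Phi>) field_differentiable (at u0 within {u. \<Phi> u \<in> V})"
    using field_differentiable_at_within field_differentiable_def by blast
qed

text \<open>\<open>num / den\<close> stands for a coordinate of the fourth power, or its reciprocal,
  written homogeneously. A holomorphic function of it alone is a section on an ambient open set:
  \<open>compat\<close> makes it independent of the representative, and the homogeneity of
  \<open>num\<close> and \<open>den\<close> makes its differential complex linear.\<close>

lemma hol_Qor_local:
  fixes num den :: "(complex ^ 4) \<times> (complex ^ 4) \<Rightarrow> complex"
  assumes lin: "bounded_linear num" "bounded_linear den"
    "\<And>c u v. num (c *s u, c *s v) = c * num (u, v)" "\<And>c u v. den (c *s u, c *s v) = c * den (u, v)"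
    and W: "open W" "k holomorphic_on W" and V1: "openin (tops cp1_power4) V1"
    and compat: "\<And>p q. p \<in> hom_coords \<Longrightarrow> q \<in> hom_coords \<Longrightarrow> hom_proj p = hom_proj q \<Longrightarrow> num p * den q = num q * den p"
      "\<And>p. p \<in> hom_coords \<Longrightarrow> den p = 0 \<Longrightarrow> num p \<noteq> 0"
  shows "\<exists>V' g. openin (tops cp1_power4) V' \<and> g \<in> hol cp1_power4 V' \<and>
     (\<forall>p\<in>hom_coords. hom_proj p \<in> V' \<longleftrightarrow> hom_proj p \<in> V1 \<and> den p \<noteq> 0 \<and> num p / den p \<in> W) \<and>
     (\<forall>p\<in>hom_coords. hom_proj p \<in> V' \<longrightarrow> g (hom_proj p) = k (num p / den p))"
proof -
  define A where "A = {p \<in> hom_coords. hom_proj p \<in> V1 \<and> den p \<noteq> 0 \<and> num p / den p \<in> W}"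
  define V' where "V' = hom_proj ` A"
  define g where "g = (\<lambda>P. k (let p = (SOME p. p \<in> A \<and> hom_proj p = P) in num p / den p))"
  have eq: "q \<in> A \<and> num q / den q = num p / den p"
    if "p \<in> A" "q \<in> hom_coords" "hom_proj q = hom_proj p" for p q
  proof -
    have c: "num p * den q = num q * den p" using compat(1)[of p q] that by (auto simp: A_def)
    have "den q \<noteq> 0"
    proof
      assume "den q = 0"
      then have "num q = 0" using c that(1) by (auto simp: A_def)
      then show False using compat(2)[OF that(2) \<open>den q = 0\<close>] by simp
    qed
    then have "num q / den q = num p / den p" using c that(1) by (simp add: A_def frac_eq_eq)
    then show ?thesis using that \<open>den q \<noteq> 0\<close> by (simp add: A_def)
  qed
  have V': "hom_proj p \<in> V' \<longleftrightarrow> p \<in> A" if "p \<in> hom_coords" for p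
    using eq[OF _ that] unfolding V'_def image_iff by metis
  have gA: "g (hom_proj p) = k (num p / den p)" if "p \<in> A" for p
  proof -
    let ?q = "SOME q. q \<in> A \<and> hom_proj q = hom_proj p"
    have "?q \<in> A \<and> hom_proj ?q = hom_proj p" by (rule someI[of _ p]) (use that in simp)
    then have "num ?q / den ?q = num p / den p" using eq[OF that, of ?q] by (auto simp: A_def)
    then show ?thesis by (simp add: g_def Let_def)
  qed
  have openA: "open A"
  proof -
    have 1: "open {p \<in> hom_coords. hom_proj p \<in> V1}" using V1 openin_cp1_power4 by blast
    have cl: "continuous_on S num" "continuous_on S den" for S
      using lin linear_continuous_on by blast+
    have 2: "open {p. den p \<noteq> 0}" using cl(2) by (intro open_Collect_neq) auto
    have "continuous_on {p. den p \<noteq> 0} (\<lambda>p. num p / den p)"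
      by (intro continuous_intros cl) auto
    then have 3: "open ({p. den p \<noteq> 0} \<inter> (\<lambda>p. num p / den p) -` W)"
      using 2 W(1) by (intro continuous_open_preimage) auto
    have "A = {p \<in> hom_coords. hom_proj p \<in> V1} \<inter> ({p. den p \<noteq> 0} \<inter> (\<lambda>p. num p / den p) -` W)"
      by (auto simp: A_def)
    then show ?thesis using 1 3 by auto
  qed
  have "{p \<in> hom_coords. hom_proj p \<in> V'} = A" using V' by (auto simp: A_def)
  then have o: "openin (tops cp1_power4) V'"
    unfolding openin_cp1_power4 using openA by (auto simp: V'_def A_def)
  moreover have "g \<in> hol cp1_power4 V'"
    unfolding hol_cp1_power4
  proof (intro ballI impI)
    fix p assume p: "p \<in> hom_coords" "hom_proj p \<in> V'"
    then have pA: "p \<in> A" using V' by blast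
    then have den: "den p \<noteq> 0" and pW: "num p / den p \<in> W" by (auto simp: A_def)
    define D where "D = (\<lambda>h. (num h * den p - num p * den h) / (den p * den p) * deriv k (num p / den p))"
    have dn: "(num has_derivative num) (at p)" "(den has_derivative den) (at p)"
      using lin bounded_linear_imp_has_derivative by blast+
    have "((\<lambda>p. num p / den p) has_derivative (\<lambda>h. (num h * den p - num p * den h) / (den p * den p))) (at p)"
      by (rule has_derivative_divide'[OF dn den])
    moreover have "(k has_derivative (\<lambda>h. h * deriv k (num p / den p))) (at (num p / den p))"
      using holomorphic_derivI[OF W(2,1) pW] by (simp add: has_field_derivative_def mult_commute_abs)
    ultimately have "((\<lambda>p. k (num p / den p)) has_derivative D) (at p)"
      unfolding D_def by (rule has_derivative_compose)
    then have "((g \<circ> hom_proj) has_derivative D) (at p)"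
      by (rule has_derivative_transform_within_open[OF _ openA pA]) (simp add: gA)
    moreover have "D (c *s u, c *s v) = c * D (u, v)" for c u v
      unfolding D_def lin(3,4) by (simp add: algebra_simps diff_divide_distrib)
    ultimately show "\<exists>D. ((g \<circ> hom_proj) has_derivative D) (at p) \<and> (\<forall>c u v. D (c *s u, c *s v) = c * D (u, v))"
      by blast
  qed
  ultimately show ?thesis using V' gA unfolding A_def by (intro exI[of _ V'] exI[of _ g]) auto
qed

text \<open>The hard direction extends a function off the curve. One coordinate of
  \<open>\<Phi>\<close> is injective near \<open>u0\<close>, so it has a holomorphic inverse
  \<open>\<psi>\<close>, and \<open>f \<circ> \<Phi> \<circ> \<psi>\<close> applied to that
  coordinate is the required ambient function.\<close>

lemma uniformized_Qor:
  assumes lifts: "holomorphic_lifts \<Phi>" and ran: "range \<Phi> = Qor_set b"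
    and lat: "\<Lambda> = lattice_of v w" "Im (v * cnj w) \<noteq> 0"
    and per: "\<And>u u'. \<Phi> u = \<Phi> u' \<longleftrightarrow> u - u' \<in> \<Lambda>"
    and inj: "\<And>u0. \<exists>i r. r > 0 \<and> inj_on (\<lambda>u. \<Phi> u $ i) (ball u0 r)"
  shows "uniformized \<Lambda> (Qor b) \<Phi>"
proof -
  have q: "quotient_map euclidean (tops (Qor b)) \<Phi>"
    using quotient_map_Qor[OF lifts ran lat(2)] per lat(1) by blast
  have oimg: "openin (tops (Qor b)) (\<Phi> ` U)" if U: "open U" for U
  proof -
    have "{x. \<Phi> x \<in> \<Phi> ` U} = (\<Union>l\<in>\<Lambda>. (\<lambda>u. l + u) ` U)"
    proof (intro equalityI subsetI)
      fix x assume "x \<in> {x. \<Phi> x \<in> \<Phi> ` U}"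
      then obtain u where u: "u \<in> U" "\<Phi> x = \<Phi> u" by blast
      then have "x - u \<in> \<Lambda>" using per by blast
      moreover have "x = (x - u) + u" by simp
      ultimately show "x \<in> (\<Union>l\<in>\<Lambda>. (\<lambda>u. l + u) ` U)" using u(1) by blast
    next
      fix x assume "x \<in> (\<Union>l\<in>\<Lambda>. (\<lambda>u. l + u) ` U)"
      then obtain l u where "l \<in> \<Lambda>" "u \<in> U" "x = l + u" by blast
      then have "\<Phi> x = \<Phi> u" using per[of x u] by simp
      then show "x \<in> {x. \<Phi> x \<in> \<Phi> ` U}" using \<open>u \<in> U\<close> by blast
    qed
    then have "open {x. \<Phi> x \<in> \<Phi> ` U}" using U by (auto intro!: open_translation open_UN)
    moreover have "\<Phi> ` U \<subseteq> topspace (tops (Qor b))" using ran by (auto simp: topspace_Qor)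
    ultimately show ?thesis using q by (auto simp: quotient_map_def)
  qed
  have "f \<in> hol (Qor b) V \<longleftrightarrow> (f \<circ> \<Phi>) holomorphic_on {z. \<Phi> z \<in> V}" if V: "openin (tops (Qor b)) V" for V f
  proof
    have oV: "open {z. \<Phi> z \<in> V}"
      using openin_continuous_map_preimage[OF quotient_imp_continuous_map[OF q] V] by simp
    show "f \<in> hol (Qor b) V \<Longrightarrow> (f \<circ> \<Phi>) holomorphic_on {z. \<Phi> z \<in> V}"
      by (rule hol_Qor_imp[OF lifts ran _ oV])
    assume h: "(f \<circ> \<Phi>) holomorphic_on {z. \<Phi> z \<in> V}"
    have "\<exists>V' g. openin (tops cp1_power4) V' \<and> P \<in> V' \<and> g \<in> hol cp1_power4 V' \<and> (\<forall>y \<in> V \<inter> V'. f y = g y)"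
      if P: "P \<in> V" for P
    proof -
      have VQ: "V \<subseteq> Qor_set b" using openin_subset[OF V] by (simp add: topspace_Qor)
      then obtain u0 where u0: "P = \<Phi> u0" using P ran by blast
      obtain i r1 where r1: "r1 > 0" "inj_on (\<lambda>u. \<Phi> u $ i) (ball u0 r1)" using inj by blast
      obtain X Y r2 where r2: "r2 > 0"
        and XY: "\<And>i. (\<lambda>u. X u $ i) holomorphic_on ball u0 r2" "\<And>i. (\<lambda>u. Y u $ i) holomorphic_on ball u0 r2"
        and XYP: "\<And>u. u\<in>ball u0 r2 \<Longrightarrow> (X u, Y u) \<in> hom_coords \<and> hom_proj (X u, Y u) = \<Phi> u"
        using lifts unfolding holomorphic_lifts_def by blast
      \<comment> \<open>The coordinate itself where it is finite at \<open>u0\<close>, its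
        reciprocal where it is infinite.\<close>
      define num where "num = (\<lambda>p::(complex^4)\<times>(complex^4). if Y u0 $ i \<noteq> 0 then fst p $ i else snd p $ i)"
      define den where "den = (\<lambda>p::(complex^4)\<times>(complex^4). if Y u0 $ i \<noteq> 0 then snd p $ i else fst p $ i)"
      have den0: "den (X u0, Y u0) \<noteq> 0"
        using XYP[of u0] r2 unfolding hom_coords_iff by (auto simp: den_def)
      have "bounded_linear (\<lambda>p::(complex^4)\<times>(complex^4). fst p $ i)" "bounded_linear (\<lambda>p::(complex^4)\<times>(complex^4). snd p $ i)"
        using bounded_linear_compose[OF bounded_linear_vec_nth bounded_linear_fst]
          bounded_linear_compose[OF bounded_linear_vec_nth bounded_linear_snd] by auto
      then have lin: "bounded_linear num" "bounded_linear den"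
        unfolding num_def den_def by (cases "Y u0 $ i = 0"; simp)+
      have lin2: "num (c *s u, c *s v) = c * num (u, v)" "den (c *s u, c *s v) = c * den (u, v)" for c u v
        by (auto simp: num_def den_def)
      have compat1: "num p * den q = num q * den p \<longleftrightarrow> hom_proj p $ i = hom_proj q $ i" if "p \<in> hom_coords" "q \<in> hom_coords" for p q
        using that abs_cp1_eq_iff[of "(fst p $ i, snd p $ i)" "(fst q $ i, snd q $ i)"]
        unfolding hom_coords_iff hom_proj_nth by (auto simp: num_def den_def mult.commute)
      have compat2: "num p \<noteq> 0" if "p \<in> hom_coords" "den p = 0" for p
        using that by (auto simp: num_def den_def hom_coords_iff split: if_splits)
      define \<phi> where "\<phi> = (\<lambda>u. num (X u, Y u) / den (X u, Y u))"
      have hnd: "(\<lambda>u. num (X u, Y u)) holomorphic_on ball u0 r2" "(\<lambda>u. den (X u, Y u)) holomorphic_on ball u0 r2"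
        unfolding num_def den_def using XY by (cases "Y u0 $ i = 0"; simp)+
      have "open (ball u0 r2 \<inter> (\<lambda>u. den (X u, Y u)) -` (- {0}))"
        using holomorphic_on_imp_continuous_on[OF hnd(2)] by (intro continuous_open_preimage) auto
      then have "open (ball u0 r1 \<inter> {z. \<Phi> z \<in> V} \<inter> (ball u0 r2 \<inter> (\<lambda>u. den (X u, Y u)) -` (- {0})))"
        using oV by blast
      moreover have "u0 \<in> ball u0 r1 \<inter> {z. \<Phi> z \<in> V} \<inter> (ball u0 r2 \<inter> (\<lambda>u. den (X u, Y u)) -` (- {0}))"
        using r1 r2 den0 P u0 by simp
      ultimately obtain r where r: "r > 0"
        "ball u0 r \<subseteq> ball u0 r1 \<inter> {z. \<Phi> z \<in> V} \<inter> (ball u0 r2 \<inter> (\<lambda>u. den (X u, Y u)) -` (- {0}))"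
        by (rule openE)
      let ?B = "ball u0 r"
      have h\<phi>: "\<phi> holomorphic_on ?B"
        unfolding \<phi>_def using r(2)
        by (intro holomorphic_on_divide holomorphic_on_subset[OF hnd(1)] holomorphic_on_subset[OF hnd(2)]) auto
      have inj\<phi>: "inj_on \<phi> ?B"
      proof (rule inj_onI)
        fix x y assume xy: "x \<in> ?B" "y \<in> ?B" "\<phi> x = \<phi> y"
        then have d: "den (X x, Y x) \<noteq> 0" "den (X y, Y y) \<noteq> 0" and b: "x \<in> ball u0 r2" "y \<in> ball u0 r2" "x \<in> ball u0 r1" "y \<in> ball u0 r1"
          using r(2) by auto
        have "num (X x, Y x) * den (X y, Y y) = num (X y, Y y) * den (X x, Y x)"
          using xy(3) d by (simp add: \<phi>_def frac_eq_eq)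
        then have "\<Phi> x $ i = \<Phi> y $ i" using compat1[of "(X x, Y x)" "(X y, Y y)"] XYP[of x] XYP[of y] b by simp
        then show "x = y" using r1(2) b unfolding inj_on_def by blast
      qed
      obtain \<psi> where \<psi>h: "\<psi> holomorphic_on (\<phi> ` ?B)"
        and "\<And>z. z \<in> ?B \<Longrightarrow> deriv \<phi> z * deriv \<psi> (\<phi> z) = 1"
        and \<psi>i: "\<And>z. z \<in> ?B \<Longrightarrow> \<psi> (\<phi> z) = z"
        by (rule holomorphic_has_inverse[OF h\<phi> open_ball inj\<phi>]) (rule that; assumption)
      have \<psi>V: "\<psi> ` \<phi> ` ?B \<subseteq> {z. \<Phi> z \<in> V}"
      proof
        fix x assume "x \<in> \<psi> ` \<phi> ` ?B"
        then obtain z where "z \<in> ?B" "x = \<psi> (\<phi> z)" by blast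
        then show "x \<in> {z. \<Phi> z \<in> V}" using \<psi>i r(2) by auto
      qed
      have oW: "open (\<phi> ` ?B)" using open_mapping_thm3[OF h\<phi> open_ball inj\<phi>] .
      have hk: "((f \<circ> \<Phi>) \<circ> \<psi>) holomorphic_on (\<phi> ` ?B)"
        by (rule holomorphic_on_compose_gen[OF \<psi>h h \<psi>V])
      \<comment> \<open>\<open>V1\<close> cuts out the branch through \<open>u0\<close>: elsewhere
        on the curve the same value of the coordinate may occur, and there \<open>g\<close> need not
        agree with \<open>f\<close>.\<close>
      obtain V1 where V1: "openin (tops cp1_power4) V1" "\<Phi> ` ?B = V1 \<inter> Qor_set b"
      proof -
        have "openin (subtopology (tops cp1_power4) (Qor_set b)) (\<Phi> ` ?B)"
          using oimg[OF open_ball] by (simp add: Qor_def subspace_of_def)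
        then show ?thesis unfolding openin_subtopology using that by blast
      qed
      obtain V' g where g: "openin (tops cp1_power4) V'" "g \<in> hol cp1_power4 V'"
         "\<And>p. p\<in>hom_coords \<Longrightarrow> hom_proj p \<in> V' \<longleftrightarrow> hom_proj p \<in> V1 \<and> den p \<noteq> 0 \<and> num p / den p \<in> \<phi> ` ?B"
         "\<And>p. p\<in>hom_coords \<Longrightarrow> hom_proj p \<in> V' \<Longrightarrow> g (hom_proj p) = ((f \<circ> \<Phi>) \<circ> \<psi>) (num p / den p)"
      proof -
        have "num p * den q = num q * den p" if "p \<in> hom_coords" "q \<in> hom_coords" "hom_proj p = hom_proj q" for p q
          using compat1 that by simp
        from hol_Qor_local[OF lin lin2 oW hk V1(1) this compat2] show ?thesis using that by blast
      qed
      have on: "\<Phi> u \<in> V' \<and> g (\<Phi> u) = f (\<Phi> u)" if "u \<in> ?B" for u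
      proof -
        have p: "(X u, Y u) \<in> hom_coords" "hom_proj (X u, Y u) = \<Phi> u" "den (X u, Y u) \<noteq> 0" using XYP r(2) that by auto
        have "\<Phi> u \<in> V1" using V1(2) that by blast
        then have "\<Phi> u \<in> V'" using g(3)[OF p(1)] p that by (auto simp: \<phi>_def)
        moreover have "g (\<Phi> u) = f (\<Phi> (\<psi> (\<phi> u)))" using g(4)[OF p(1)] p \<open>\<Phi> u \<in> V'\<close> by (simp add: \<phi>_def)
        ultimately show ?thesis using \<psi>i[OF that] by simp
      qed
      have "f y = g y" if y: "y \<in> V \<inter> V'" for y
      proof -
        have "y \<in> Qor_set b" using y VQ by blast
        moreover have "y \<in> V1"
        proof -
          obtain p where "p \<in> hom_coords" "y = hom_proj p"
            using \<open>y \<in> Qor_set b\<close> unfolding Qor_set_def by blast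
          then show ?thesis using g(3) y by blast
        qed
        ultimately obtain u where "u \<in> ?B" "y = \<Phi> u" using V1(2) by blast
        then show ?thesis using on by simp
      qed
      moreover have "P \<in> V'" using on[of u0] r(1) u0 by simp
      ultimately show ?thesis using g(1,2) by blast
    qed
    then show "f \<in> hol (Qor b) V" unfolding hol_Qor by blast
  qed
  then show ?thesis using q per by (simp add: uniformized_def)
qed

lemma uniformized_Q:
  assumes U: "uniformized \<Lambda> (Qor b) \<Phi>"
    and per: "\<And>u u'. unoriented (\<Phi> u) = unoriented (\<Phi> u') \<longleftrightarrow> u - u' \<in> M"
  shows "uniformized M (Q b) (\<lambda>u. unoriented (\<Phi> u))"
proof -
  note U' = uniformizedD[OF U]
  let ?T = "quotient_topology (tops (Qor b)) unoriented"
  have q1: "quotient_map (tops (Qor b)) ?T unoriented" by (rule quotient_map_quotient_topology)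
  have q: "quotient_map euclidean ?T (\<lambda>u. unoriented (\<Phi> u))"
    using quotient_map_compose[OF U'(1) q1] by (simp add: o_def)
  have "f \<in> hol (Q b) V \<longleftrightarrow> (f \<circ> (\<lambda>u. unoriented (\<Phi> u))) holomorphic_on {z. unoriented (\<Phi> z) \<in> V}"
    if V: "openin ?T V" for V f
  proof -
    have o: "openin (tops (Qor b)) {x \<in> points (Qor b). unoriented x \<in> V}"
      using openin_continuous_map_preimage[OF quotient_imp_continuous_map[OF q1] V] by (simp add: points_def)
    have e: "{z. \<Phi> z \<in> {x \<in> points (Qor b). unoriented x \<in> V}} = {z. unoriented (\<Phi> z) \<in> V}"
      using U'(2) by auto
    have "f \<in> hol (Q b) V \<longleftrightarrow> (f \<circ> unoriented) \<in> hol (Qor b) {x \<in> points (Qor b). unoriented x \<in> V}"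
      by (simp add: Q_def quotient_space_def)
    also have "\<dots> \<longleftrightarrow> ((f \<circ> unoriented) \<circ> \<Phi>) holomorphic_on {z. unoriented (\<Phi> z) \<in> V}"
      unfolding U'(3)[OF o] e ..
    finally show ?thesis by (simp add: o_def)
  qed
  then show ?thesis using q per by (simp add: uniformized_def Q_def quotient_space_def)
qed

section \<open>Vertex equations\<close>

definition adj_form :: "complex \<Rightarrow> complex \<Rightarrow> complex \<Rightarrow> complex \<Rightarrow> complex \<Rightarrow> complex \<Rightarrow> complex \<Rightarrow> complex \<Rightarrow> complex \<Rightarrow> complex" where
  "adj_form s a1 a2 a3 a4 x y x' y' =
     (s - a1) * (s - a1 - a3) * x\<^sup>2 * x'\<^sup>2 + (s - a4) * (s - a3 - a4) * x\<^sup>2 * y'\<^sup>2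
     + (s - a2) * (s - a2 - a3) * y\<^sup>2 * x'\<^sup>2 - 2 * a2 * a4 * (x * y) * (x' * y') + s * (s - a3) * y\<^sup>2 * y'\<^sup>2"

definition opp_form :: "complex \<Rightarrow> complex \<Rightarrow> complex \<Rightarrow> complex \<Rightarrow> complex \<Rightarrow> complex \<Rightarrow> complex \<Rightarrow> complex \<Rightarrow> complex \<Rightarrow> complex" where
  "opp_form s a1 a2 a3 a4 x y x' y' =
     (s - a3 - a4) * (s - a2 - a4) * x\<^sup>2 * x'\<^sup>2 - (s - a1) * (s - a4) * x\<^sup>2 * y'\<^sup>2
     + (s - a2) * (s - a3) * y\<^sup>2 * x'\<^sup>2 + s * (s - a2 - a3) * y\<^sup>2 * y'\<^sup>2"

text \<open>\<open>cA\<close> and \<open>cC\<close> are the coefficients of \<open>x\<^sup>2\<close>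
  and \<open>y\<^sup>2\<close> in the adjacent equation for \<open>z_1 = x / y\<close> when
  \<open>z_2 = F / G\<close> is fixed.\<close>

definition cA :: "complex \<Rightarrow> complex \<Rightarrow> complex \<Rightarrow> complex \<Rightarrow> complex \<Rightarrow> complex \<Rightarrow> complex" where
  "cA s a1 a3 a4 F G = (s - a1) * (s - a1 - a3) * F\<^sup>2 + (s - a4) * (s - a3 - a4) * G\<^sup>2"

definition cC :: "complex \<Rightarrow> complex \<Rightarrow> complex \<Rightarrow> complex \<Rightarrow> complex \<Rightarrow> complex" where
  "cC s a2 a3 F G = (s - a2) * (s - a2 - a3) * F\<^sup>2 + s * (s - a3) * G\<^sup>2"

text \<open>At fixed \<open>z_2 = F / G\<close> the opposite equation for
  \<open>z_4 = x' / y'\<close> reads \<open>K\<^sup>2 * x'\<^sup>2 = H\<^sup>2 * y'\<^sup>2\<close>.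
  Adjoining the square roots \<open>H\<close> and \<open>K\<close> makes \<open>z_4\<close>
  rational, and \<open>product\<close> shows that they rationalize \<open>z_1\<close> too.
  Everything here is polynomial algebra at one point of the curve.\<close>

locale quad_algebra =
  fixes s a1 a2 a3 a4 F G H K :: complex
  assumes s: "2 * s = a1 + a2 + a3 + a4"
    and H: "H\<^sup>2 = (s - a1) * (s - a2) * F\<^sup>2 - s * (s - a3 - a4) * G\<^sup>2"
    and K: "K\<^sup>2 = (s - a1 - a4) * (s - a1 - a3) * F\<^sup>2 + (s - a3) * (s - a4) * G\<^sup>2"
begin

lemma a4: "a4 = 2 * s - a1 - a2 - a3" using s by (simp add: algebra_simps)

text \<open>Reflection of the labels in the diagonal \<open>BD\<close>: it exchanges the vertices
  \<open>A\<close> and \<open>C\<close> and fixes \<open>B\<close> and \<open>D\<close>, hence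
  \<open>z_2\<close>, \<open>z_4\<close> and both quadrics. Facts about \<open>A\<close> thus yield
  facts about \<open>C\<close>.\<close>

lemma swap: "quad_algebra s a2 a1 a4 a3 F G H K"
proof
  show "2 * s = a2 + a1 + a4 + a3" using s by simp
  show "H\<^sup>2 = (s - a2) * (s - a1) * F\<^sup>2 - s * (s - a4 - a3) * G\<^sup>2" unfolding H by (simp add: algebra_simps)
  show "K\<^sup>2 = (s - a2 - a3) * (s - a2 - a4) * F\<^sup>2 + (s - a4) * (s - a3) * G\<^sup>2"
    unfolding K a4 by (simp add: algebra_simps)
qed

text \<open>A quarter of the discriminant of \<open>adj_near\<close>, as a quadratic in
  \<open>[x : y]\<close>, thereby becomes the square \<open>(H * K)\<^sup>2\<close>; so its roots
  are rational in \<open>F, G, H, K\<close>.\<close>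

lemma product: "(a2 * a4 * F * G)\<^sup>2 - (H * K)\<^sup>2 = cA s a1 a3 a4 F G * cC s a2 a3 F G"
  unfolding power_mult_distrib H K cA_def cC_def a4 by algebra

lemma adj_near: "adj_form s a1 a2 a3 a4 x y F G
    = cA s a1 a3 a4 F G * x\<^sup>2 - 2 * (a2 * a4 * F * G) * x * y + cC s a2 a3 F G * y\<^sup>2"
  unfolding adj_form_def cA_def cC_def by algebra

text \<open>Apart from the constant factor, this differs from \<open>adj_near\<close> by the sign of
  \<open>cA\<close> and by \<open>H * K\<close> in place of \<open>a2 * a4 * F * G\<close>. Sum and
  difference of the two equations split off linear factors, which decides the root of
  \<open>adj_near\<close> that belongs to the given sign of \<open>z_4\<close>.\<close>

lemma adj_far: "adj_form s a4 a1 a2 a3 H K x y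
    = a1 * a3 * (cC s a2 a3 F G * y\<^sup>2 - 2 * (H * K) * x * y - cA s a1 a3 a4 F G * x\<^sup>2)"
  unfolding adj_form_def H K cA_def cC_def a4 by algebra

text \<open>
  \<open>[x : y]\<close> is the half-angle tangent at \<open>A\<close>, the common root of \<open>adj_near\<close> and \<open>adj_far\<close>.
  Either of the two proportional linear equations may degenerate to \<open>0 = 0\<close>, hence both are kept.
\<close>

definition vertex :: "complex \<Rightarrow> complex \<Rightarrow> bool" where
  "vertex x y \<longleftrightarrow> cA s a1 a3 a4 F G * x = (a2 * a4 * F * G - H * K) * y
     \<and> (a2 * a4 * F * G + H * K) * x = cC s a2 a3 F G * y"

lemma vertex_choice:
  "vertex (a2 * a4 * F * G - H * K) (cA s a1 a3 a4 F G)"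
  "vertex (cC s a2 a3 F G) (a2 * a4 * F * G + H * K)"
proof -
  have "(a2 * a4 * F * G + H * K) * (a2 * a4 * F * G - H * K) = cA s a1 a3 a4 F G * cC s a2 a3 F G"
    using product by algebra
  then show "vertex (a2 * a4 * F * G - H * K) (cA s a1 a3 a4 F G)"
    "vertex (cC s a2 a3 F G) (a2 * a4 * F * G + H * K)"
    unfolding vertex_def by (simp_all add: mult.commute)
qed

lemma vertex_forms:
  assumes "vertex x y"
  shows "adj_form s a1 a2 a3 a4 x y F G = 0" "adj_form s a4 a1 a2 a3 H K x y = 0"
proof -
  show "adj_form s a1 a2 a3 a4 x y F G = 0"
    using assms unfolding adj_near vertex_def by algebra
  have "cC s a2 a3 F G * y\<^sup>2 - 2 * (H * K) * x * y - cA s a1 a3 a4 F G * x\<^sup>2 = 0"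
    using assms unfolding vertex_def by algebra
  then show "adj_form s a4 a1 a2 a3 H K x y = 0" unfolding adj_far by simp
qed

text \<open>
  If \<open>t\<close> is the squared length of \<open>AC\<close>, then \<open>sq_den = t (F\<^sup>2 + G\<^sup>2)\<^sup>2\<close>, and \<open>sq_num / (2 sq_den)\<close> is
  the squared length of \<open>BD\<close>, computed from the triangles \<open>ABC\<close> and \<open>CDA\<close>.
\<close>

definition sq_den :: complex where
  "sq_den = (F\<^sup>2 + G\<^sup>2) * ((a1 + a2)\<^sup>2 * G\<^sup>2 + (a1 - a2)\<^sup>2 * F\<^sup>2)"

definition sq_num :: complex where
  "sq_num = (a1\<^sup>2 + a2\<^sup>2 + a3\<^sup>2 + a4\<^sup>2) * sq_den - ((a1 + a2)\<^sup>2 * G\<^sup>2 + (a1 - a2)\<^sup>2 * F\<^sup>2)\<^sup>2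
     + (a1\<^sup>2 - a2\<^sup>2) * (a3\<^sup>2 - a4\<^sup>2) * (F\<^sup>2 + G\<^sup>2)\<^sup>2 + 16 * a1 * a2 * (F * G * H * K)"

text \<open>Squaring the linear equations of \<open>vertex\<close> gives
  \<open>x\<^sup>2 : y\<^sup>2\<close> as a ratio of two quantities that become linear in
  \<open>F * G * H * K\<close> once \<open>(H * K)\<^sup>2\<close> is eliminated. Where
  \<open>sq_den\<close> is nonzero, \<open>D / (4 * a1 * a4 * sq_den)\<close> is the cosine of the
  turning angle at \<open>A\<close>.\<close>

lemma vertex_diagonal:
  assumes "vertex x y" "a4 \<noteq> 0"
  shows "2 * sq_den * ((a1 + a4)\<^sup>2 * y\<^sup>2 + (a1 - a4)\<^sup>2 * x\<^sup>2) = sq_num * (x\<^sup>2 + y\<^sup>2)"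
proof -
  let ?A = "cA s a1 a3 a4 F G" and ?C = "cC s a2 a3 F G" and ?M = "a2 * a4 * F * G - H * K"
    and ?N = "a2 * a4 * F * G + H * K"
  define D where "D = sq_num - 2 * (a1\<^sup>2 + a4\<^sup>2) * sq_den"
  have n2: "(H * K)\<^sup>2 = (a2 * a4 * F * G)\<^sup>2 - ?A * ?C" using product by algebra
  have 1: "8 * a1 * (?A\<^sup>2 + ?N\<^sup>2) = a4 * (4 * a1 * a4 * sq_den + D)"
  proof -
    have "?A\<^sup>2 + ?N\<^sup>2 = ?A\<^sup>2 + 2 * (a2 * a4 * F * G)\<^sup>2 - ?A * ?C + 2 * a2 * a4 * (F * G * H * K)"
      using n2 by algebra
    then show ?thesis unfolding D_def sq_num_def sq_den_def cA_def cC_def unfolding a4 by algebra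
  qed
  have 2: "8 * a1 * (?C\<^sup>2 + ?M\<^sup>2) = a4 * (4 * a1 * a4 * sq_den - D)"
  proof -
    have "?C\<^sup>2 + ?M\<^sup>2 = ?C\<^sup>2 + 2 * (a2 * a4 * F * G)\<^sup>2 - ?A * ?C - 2 * a2 * a4 * (F * G * H * K)"
      using n2 by algebra
    then show ?thesis unfolding D_def sq_num_def sq_den_def cA_def cC_def unfolding a4 by algebra
  qed
  have "(?C * y)\<^sup>2 + (?M * y)\<^sup>2 = (?A * x)\<^sup>2 + (?N * x)\<^sup>2" using assms(1) unfolding vertex_def by algebra
  then have "8 * a1 * (?C\<^sup>2 + ?M\<^sup>2) * y\<^sup>2 = 8 * a1 * (?A\<^sup>2 + ?N\<^sup>2) * x\<^sup>2" by algebra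
  then have "a4 * (4 * a1 * a4 * sq_den - D) * y\<^sup>2 = a4 * (4 * a1 * a4 * sq_den + D) * x\<^sup>2" unfolding 1 2 .
  then have "(4 * a1 * a4 * sq_den - D) * y\<^sup>2 = (4 * a1 * a4 * sq_den + D) * x\<^sup>2" using assms(2) by simp
  then show ?thesis unfolding D_def by algebra
qed

text \<open>The adjacent equations only give \<open>x\<close> times one linear equation and
  \<open>y\<close> times the other. If \<open>z_1\<close> is 0 or infinite, one of them is lost, and
  with it the sign of \<open>H * K\<close>; it is recovered from the vertex \<open>C\<close>, to
  which \<open>z_1\<close> is tied by the opposite equation.\<close>

lemma vertex_converse:
  assumes xy: "(x, y) \<noteq> (0, 0)" and FG: "(F, G) \<noteq> (0, 0)"
    and nd: "s \<noteq> 0" "s - a1 \<noteq> 0" "s - a2 \<noteq> 0" "s - a3 \<noteq> 0" "s - a4 \<noteq> 0"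
      "s - a1 - a3 \<noteq> 0" "s - a3 - a4 \<noteq> 0" "s - a2 - a4 \<noteq> 0" "s - a2 - a3 \<noteq> 0" "a1 \<noteq> 0" "a2 \<noteq> 0" "a3 \<noteq> 0" "a4 \<noteq> 0"
    and v: "(x', y') \<noteq> (0, 0)"
    and adj: "adj_form s a1 a2 a3 a4 x y F G = 0" "adj_form s a4 a1 a2 a3 H K x y = 0"
    and adj': "adj_form s a2 a1 a4 a3 x' y' F G = 0" "adj_form s a3 a2 a1 a4 H K x' y' = 0"
    and opp: "opp_form s a1 a2 a3 a4 x y x' y' = 0"
  shows "vertex x y"
proof -
  let ?A = "cA s a1 a3 a4 F G" and ?C = "cC s a2 a3 F G" and ?M = "a2 * a4 * F * G - H * K"
    and ?N = "a2 * a4 * F * G + H * K"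
  interpret sw: quad_algebra s a2 a1 a4 a3 F G H K by (rule swap)
  let ?A' = "cA s a2 a4 a3 F G" and ?C' = "cC s a1 a4 F G"
  have e1: "?A * x\<^sup>2 - 2 * (a2 * a4 * F * G) * x * y + ?C * y\<^sup>2 = 0" using adj(1) unfolding adj_near .
  have e2: "?C * y\<^sup>2 - 2 * (H * K) * x * y - ?A * x\<^sup>2 = 0"
    using adj(2) nd unfolding adj_far by simp
  have f1: "?A' * x'\<^sup>2 - 2 * (a1 * a3 * F * G) * x' * y' + ?C' * y'\<^sup>2 = 0" using adj'(1) unfolding sw.adj_near .
  have f2: "?C' * y'\<^sup>2 - 2 * (H * K) * x' * y' - ?A' * x'\<^sup>2 = 0"
    using adj'(2) nd unfolding sw.adj_far by simp
  have X: "x * (?A * x - ?M * y) = 0"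
  proof -
    have "2 * (x * (?A * x - ?M * y)) = 0" using e1 e2 by algebra
    then show ?thesis by simp
  qed
  have Y: "y * (?C * y - ?N * x) = 0"
  proof -
    have "2 * (y * (?C * y - ?N * x)) = 0" using e1 e2 by algebra
    then show ?thesis by simp
  qed
  have FG0: "F \<noteq> 0" "G \<noteq> 0" if "p * F\<^sup>2 + q * G\<^sup>2 = 0" "p \<noteq> 0" "q \<noteq> 0" for p q
    using that FG by auto
  consider "x \<noteq> 0" "y \<noteq> 0" | "x \<noteq> 0" "y = 0" | "x = 0" "y \<noteq> 0" using xy by auto
  then show ?thesis
  proof cases
    case 1
    then show ?thesis using X Y by (simp add: vertex_def)
  next
    case 2
    then have A0: "?A = 0" using X by simp
    then have FGn: "F \<noteq> 0" "G \<noteq> 0" using FG0[OF A0[unfolded cA_def]] nd by auto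
    let ?\<alpha> = "(s - a3 - a4) * (s - a2 - a4)" and ?\<beta> = "(s - a1) * (s - a4)"
    have op: "?\<alpha> * x'\<^sup>2 = ?\<beta> * y'\<^sup>2"
    proof -
      have "(?\<alpha> * x'\<^sup>2 - ?\<beta> * y'\<^sup>2) * x\<^sup>2 = 0" using opp 2 by (simp add: opp_form_def algebra_simps)
      then have "?\<alpha> * x'\<^sup>2 - ?\<beta> * y'\<^sup>2 = 0" using 2 by simp
      then show ?thesis by algebra
    qed
    have x'y': "x' \<noteq> 0" "y' \<noteq> 0" using op v nd by auto
    let ?S = "?\<alpha> * ?C' + ?A' * ?\<beta>" and ?D = "?\<alpha> * ?C' - ?A' * ?\<beta>"
    have S: "?S * y'\<^sup>2 = 2 * ?\<alpha> * (a1 * a3 * F * G) * x' * y'" using op f1 by algebra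
    have D: "?D * y'\<^sup>2 = 2 * ?\<alpha> * (H * K) * x' * y'" using op f2 by algebra
    \<comment> \<open>By \<open>S\<close> and \<open>D\<close> the quantities \<open>?S\<close> and
      \<open>?D\<close> carry \<open>F * G\<close> and \<open>H * K\<close> with the same factor, up
      to \<open>a1 * a3\<close>. The combination chosen here is a nonzero multiple of
      \<open>?N\<close>, and it is divisible by \<open>?A\<close>, which vanishes.\<close>
    have "a1 * a3 * ?D + a2 * a4 * ?S = - ((s - a3 - a4) * (s - a1 - a4) * (a1 * a3 + a2 * a4)
        + (s - a2) * (s - a4) * (a2 * a4 - a1 * a3)) * ?A"
      unfolding cA_def cC_def a4 by algebra
    then have k: "a1 * a3 * ?D + a2 * a4 * ?S = 0" using A0 by simp
    have "(2 * ?\<alpha> * (H * K) * x' * y' * (a1 * a3) + 2 * ?\<alpha> * (a1 * a3 * F * G) * x' * y' * (a2 * a4))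
        = (a1 * a3 * ?D + a2 * a4 * ?S) * y'\<^sup>2"
      using S D by algebra
    then have "2 * ?\<alpha> * x' * y' * (a1 * a3) * ?N = 0" unfolding k by algebra
    then have "?N = 0" using nd x'y' by simp
    then show ?thesis using A0 2 by (simp add: vertex_def)
  next
    case 3
    then have C0: "?C = 0" using Y by simp
    then have FGn: "F \<noteq> 0" "G \<noteq> 0" using FG0[OF C0[unfolded cC_def]] nd by auto
    let ?\<gamma> = "(s - a2) * (s - a3)" and ?\<delta> = "s * (s - a2 - a3)"
    have op: "?\<gamma> * x'\<^sup>2 = - ?\<delta> * y'\<^sup>2"
    proof -
      have "(?\<gamma> * x'\<^sup>2 + ?\<delta> * y'\<^sup>2) * y\<^sup>2 = 0" using opp 3 by (simp add: opp_form_def algebra_simps)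
      then have "?\<gamma> * x'\<^sup>2 + ?\<delta> * y'\<^sup>2 = 0" using 3 by simp
      then show ?thesis by algebra
    qed
    have x'y': "x' \<noteq> 0" "y' \<noteq> 0" using op v nd by auto
    let ?S = "?\<gamma> * ?C' - ?A' * ?\<delta>" and ?D = "?\<gamma> * ?C' + ?A' * ?\<delta>"
    have S: "?S * y'\<^sup>2 = 2 * ?\<gamma> * (a1 * a3 * F * G) * x' * y'" using op f1 by algebra
    have D: "?D * y'\<^sup>2 = 2 * ?\<gamma> * (H * K) * x' * y'" using op f2 by algebra
    have "a1 * a3 * ?D - a2 * a4 * ?S = (a1 * a3 * (s * (s - a2 - a4) - (s - a3) * (s - a1))
        + a2 * a4 * ((s - a3) * (s - a1) + s * (s - a2 - a4))) * ?C"
      unfolding cA_def cC_def a4 by algebra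
    then have k: "a1 * a3 * ?D - a2 * a4 * ?S = 0" using C0 by simp
    have "(2 * ?\<gamma> * (H * K) * x' * y' * (a1 * a3) - 2 * ?\<gamma> * (a1 * a3 * F * G) * x' * y' * (a2 * a4))
        = (a1 * a3 * ?D - a2 * a4 * ?S) * y'\<^sup>2"
      using S D by algebra
    then have "2 * ?\<gamma> * x' * y' * (a1 * a3) * ?M = 0" unfolding k by algebra
    then have "?M = 0" using nd x'y' by simp
    then show ?thesis using C0 3 by (simp add: vertex_def)
  qed
qed

text \<open>Two independent solutions would make all four coefficients of the linear system vanish;
  \<open>?M + ?N\<close> then forces \<open>F * G = 0\<close>, which contradicts
  \<open>?A = 0\<close>.\<close>

lemma vertex_unique:
  assumes v: "vertex x y" "vertex x' y'" and FG: "(F, G) \<noteq> (0, 0)"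
    and nd: "s \<noteq> 0" "s - a1 \<noteq> 0" "s - a2 \<noteq> 0" "s - a3 \<noteq> 0" "s - a4 \<noteq> 0"
      "s - a1 - a3 \<noteq> 0" "s - a3 - a4 \<noteq> 0" "s - a2 - a3 \<noteq> 0" "a2 \<noteq> 0" "a4 \<noteq> 0"
  shows "x * y' = x' * y"
proof (rule ccontr)
  assume n: "x * y' \<noteq> x' * y"
  let ?A = "cA s a1 a3 a4 F G" and ?C = "cC s a2 a3 F G" and ?M = "a2 * a4 * F * G - H * K"
    and ?N = "a2 * a4 * F * G + H * K"
  have "?A * (x * y' - x' * y) = 0" "?M * (x * y' - x' * y) = 0" "?N * (x * y' - x' * y) = 0" "?C * (x * y' - x' * y) = 0"
    using v unfolding vertex_def by algebra+
  then have z: "?A = 0" "?M = 0" "?N = 0" "?C = 0" using n by auto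
  have "?M + ?N = 2 * (a2 * a4 * F * G)" by algebra
  then have "F = 0 \<or> G = 0" using z nd by simp
  then show False using z(1) nd FG by (auto simp: cA_def)
qed

lemma vertex_nonzero:
  assumes FG: "(F, G) \<noteq> (0, 0)"
    and nd: "s - a1 \<noteq> 0" "s - a4 \<noteq> 0" "s - a1 - a3 \<noteq> 0" "s - a3 - a4 \<noteq> 0" "a2 \<noteq> 0" "a4 \<noteq> 0"
  shows "(a2 * a4 * F * G - H * K, cA s a1 a3 a4 F G) \<noteq> (0, 0)
    \<or> (cC s a2 a3 F G, a2 * a4 * F * G + H * K) \<noteq> (0, 0)"
proof (rule ccontr)
  assume "\<not> ?thesis"
  then have z: "a2 * a4 * F * G - H * K = 0" "cA s a1 a3 a4 F G = 0" "a2 * a4 * F * G + H * K = 0" by auto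
  have "a2 * a4 * F * G - H * K + (a2 * a4 * F * G + H * K) = 2 * (a2 * a4 * F * G)" by algebra
  then have "F = 0 \<or> G = 0" using z nd by simp
  then show False using z(2) nd FG by (auto simp: cA_def)
qed

end

text \<open>The opposite equation at \<open>A\<close> and \<open>C\<close> expresses that the
  triangles \<open>DAB\<close> and \<open>BCD\<close> give the same squared length of
  \<open>BD\<close>.\<close>

lemma opp_from_diagonals:
  assumes "2 * s = a1 + a2 + a3 + (a4 :: complex)"
  shows "4 * opp_form s a1 a2 a3 a4 x y x' y' =
     ((a1 + a4)\<^sup>2 * y\<^sup>2 + (a1 - a4)\<^sup>2 * x\<^sup>2) * (x'\<^sup>2 + y'\<^sup>2) - ((a2 + a3)\<^sup>2 * y'\<^sup>2 + (a2 - a3)\<^sup>2 * x'\<^sup>2) * (x\<^sup>2 + y\<^sup>2)"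
proof -
  have a4: "a4 = 2 * s - a1 - a2 - a3" using assms by (simp add: algebra_simps)
  show ?thesis unfolding opp_form_def a4 by algebra
qed

context quad_algebra
begin

interpretation sw: quad_algebra s a2 a1 a4 a3 F G H K by (rule swap)

lemma sq_swap: "sw.sq_den = sq_den" "sw.sq_num = sq_num"
  unfolding sw.sq_num_def sq_num_def sw.sq_den_def sq_den_def by algebra+

text \<open>Both triangles at \<open>BD\<close> give \<open>sq_num / (2 * sq_den)\<close>, so the
  opposite equation follows where this quotient makes sense; the zeros of \<open>sq_den\<close> are
  left to analytic continuation.\<close>

lemma vertex_opp:
  assumes "vertex x y" "sw.vertex x' y'" "a3 \<noteq> 0" "a4 \<noteq> 0" "sq_den \<noteq> 0"
  shows "opp_form s a1 a2 a3 a4 x y x' y' = 0"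
proof -
  have 1: "2 * sq_den * ((a1 + a4)\<^sup>2 * y\<^sup>2 + (a1 - a4)\<^sup>2 * x\<^sup>2) = sq_num * (x\<^sup>2 + y\<^sup>2)"
    using vertex_diagonal[OF assms(1,4)] .
  have 2: "2 * sq_den * ((a2 + a3)\<^sup>2 * y'\<^sup>2 + (a2 - a3)\<^sup>2 * x'\<^sup>2) = sq_num * (x'\<^sup>2 + y'\<^sup>2)"
    using sw.vertex_diagonal[OF assms(2,3)] unfolding sq_swap .
  have "2 * sq_den * (4 * opp_form s a1 a2 a3 a4 x y x' y') = 0"
    unfolding opp_from_diagonals[OF s] using 1 2 by algebra
  then show ?thesis using assms(5) by simp
qed

end

section \<open>Theta functions\<close>

text \<open>The infinite q-Pochhammer symbol \<open>(x; p)\<close>; for \<open>0 < p < 1\<close> its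
  zeros are the points \<open>x = p ^ (- n)\<close>.\<close>

definition qprod :: "real \<Rightarrow> 'a::{real_normed_field, banach} \<Rightarrow> 'a" where
  "qprod p x = (\<Prod>n. 1 - of_real (p ^ n) * x)"

context
  fixes p :: real
  assumes p: "0 \<le> p" "p < 1"
begin

lemma has_prod_qprod: "(\<lambda>n. 1 - of_real (p ^ n) * x) has_prod qprod p (x :: 'a :: {real_normed_field, banach})"
proof -
  have "summable (\<lambda>n. norm (1 - of_real (p ^ n) * x - 1))"
    using p by (simp add: norm_mult norm_power summable_mult2 summable_geometric)
  then have "abs_convergent_prod (\<lambda>n. 1 - of_real (p ^ n) * x)"
    by (rule summable_imp_abs_convergent_prod)
  then show ?thesis
    unfolding qprod_def by (intro convergent_prod_has_prod abs_convergent_prod_imp_convergent_prod)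
qed

lemma qprod_eq_0_iff: "qprod p (x :: 'a :: {real_normed_field, banach}) = 0 \<longleftrightarrow> (\<exists>n. of_real (p ^ n) * x = 1)"
  using has_prod_eq_0_iff[OF has_prod_qprod[of x]] by (auto simp: image_iff)

lemma qprod_rec: "qprod p (x :: 'a :: {real_normed_field, banach}) = (1 - x) * qprod p (of_real p * x)"
proof -
  have "(\<lambda>n. 1 - of_real (p ^ Suc n) * x) has_prod qprod p (of_real p * x)"
    using has_prod_qprod[of "of_real p * x"] by (simp add: mult.assoc mult.left_commute)
  then have "(\<lambda>n. 1 - of_real (p ^ n) * x) has_prod (qprod p (of_real p * x) * (1 - of_real (p ^ 0) * x))"
    by (rule has_prod_Suc_imp)
  then show ?thesis using has_prod_unique2[OF has_prod_qprod[of x]] by (simp add: mult.commute)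
qed

lemma qprod_cnj: "qprod p (cnj x) = cnj (qprod p x)"
proof -
  have "(\<lambda>n. \<Prod>k\<le>n. 1 - of_real (p ^ k) * x) \<longlonglongrightarrow> qprod p x"
    by (rule has_prod_imp_tendsto[OF has_prod_qprod])
  then have "(\<lambda>n. cnj (\<Prod>k\<le>n. 1 - of_real (p ^ k) * x)) \<longlonglongrightarrow> cnj (qprod p x)"
    by (rule tendsto_cnj)
  then have "(\<lambda>n. \<Prod>k\<le>n. 1 - of_real (p ^ k) * cnj x) \<longlonglongrightarrow> cnj (qprod p x)" by simp
  then show ?thesis
    using has_prod_imp_tendsto[OF has_prod_qprod[of "cnj x"]] LIMSEQ_unique by blast
qed

lemma qprod_of_real: "qprod p (of_real x :: complex) = of_real (qprod p x)"
proof -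
  have "(\<lambda>n. \<Prod>k\<le>n. 1 - of_real (p ^ k) * x) \<longlonglongrightarrow> qprod p x"
    by (rule has_prod_imp_tendsto[OF has_prod_qprod])
  then have "(\<lambda>n. of_real (\<Prod>k\<le>n. 1 - of_real (p ^ k) * x) :: complex) \<longlonglongrightarrow> of_real (qprod p x)"
    by (rule tendsto_of_real)
  then have "(\<lambda>n. \<Prod>k\<le>n. 1 - of_real (p ^ k) * (of_real x :: complex)) \<longlonglongrightarrow> of_real (qprod p x)" by simp
  then show ?thesis
    using has_prod_imp_tendsto[OF has_prod_qprod[of "of_real x :: complex"]] LIMSEQ_unique by blast
qed

lemma qprod_holomorphic: "(qprod p :: complex \<Rightarrow> complex) holomorphic_on UNIV"
proof (rule holomorphic_uniform_sequence[where f = "\<lambda>N x. \<Prod>n<N. 1 + - (of_real (p ^ n) * x)"])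
  show "(\<lambda>x::complex. \<Prod>n<N. 1 + - (of_real (p ^ n) * x)) holomorphic_on UNIV" for N
    by (intro holomorphic_intros)
  fix x :: complex
  let ?A = "cball x 1"
  have "uniformly_convergent_on ?A (\<lambda>N x. \<Prod>n<N. 1 + - (of_real (p ^ n) * x))"
  proof (rule Infinite_Products.uniformly_convergent_on_prod)
    show "uniformly_convergent_on ?A (\<lambda>N x. \<Sum>n<N. norm (- (of_real (p ^ n) * x)))"
    proof (rule Weierstrass_m_test'_ev[OF always_eventually])
      show "\<forall>n. \<forall>y\<in>?A. norm (norm (- (of_real (p ^ n) * y))) \<le> p ^ n * (norm x + 1)"
      proof (intro allI ballI)
        fix n y assume "y \<in> ?A"
        then have "norm y \<le> norm x + 1"
          by (simp add: dist_norm) (metis norm_minus_commute norm_triangle_sub order_trans add_left_mono)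
        then show "norm (norm (- (of_real (p ^ n) * y))) \<le> p ^ n * (norm x + 1)"
          using p by (simp add: norm_mult norm_power mult_left_mono)
      qed
      show "summable (\<lambda>n. p ^ n * (norm x + 1))" using p by (simp add: summable_mult2 summable_geometric)
    qed
  qed (auto intro!: continuous_intros)
  then obtain g where g: "uniform_limit ?A (\<lambda>N x. \<Prod>n<N. 1 + - (of_real (p ^ n) * x)) g sequentially"
    by (auto simp: uniformly_convergent_on_def)
  have "g y = qprod p y" if "y \<in> ?A" for y
  proof -
    have "(\<lambda>N. \<Prod>n<N. 1 + - (of_real (p ^ n) * y)) \<longlonglongrightarrow> g y"
      using tendsto_uniform_limitI[OF g that] .
    moreover have "(\<lambda>N. \<Prod>n<N. 1 + - (of_real (p ^ n) * y)) \<longlonglongrightarrow> qprod p y"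
      using has_prod_imp_tendsto'[OF has_prod_qprod[of y]] by simp
    ultimately show ?thesis using LIMSEQ_unique by blast
  qed
  then have "uniform_limit ?A (\<lambda>N x. \<Prod>n<N. 1 + - (of_real (p ^ n) * x)) (qprod p) sequentially"
    using g by (auto intro: uniform_limit_cong'[THEN iffD1, rotated -1])
  then show "\<exists>d>0. cball x d \<subseteq> UNIV \<and>
      uniform_limit (cball x d) (\<lambda>N x. \<Prod>n<N. 1 + - (of_real (p ^ n) * x)) (qprod p) sequentially"
    by (intro exI[of _ 1]) simp
qed simp

lemma qprod_bounds: "0 \<le> x \<Longrightarrow> x \<le> 1 \<Longrightarrow> 0 \<le> qprod p x \<and> qprod p x \<le> (1::real)"
  "0 \<le> x \<Longrightarrow> 1 \<le> qprod p (- x :: real)"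
proof -
  have pn: "0 \<le> p ^ n" "p ^ n \<le> 1" for n using p by (auto intro: power_le_one)
  assume x: "0 \<le> x"
  have one: "(\<lambda>n. 1::real) has_prod 1" by (rule has_prod_0) simp
  show "1 \<le> qprod p (- x)"
    by (rule has_prod_le[OF one has_prod_qprod]) (use pn x in simp)
  assume "x \<le> 1"
  then have "0 \<le> 1 - p ^ n * x" for n using mult_mono[OF pn(2) \<open>x \<le> 1\<close>] pn x by simp
  then show "0 \<le> qprod p x \<and> qprod p x \<le> 1"
    using has_prod_le[OF has_prod_qprod[of x] one] has_prod_nonneg[OF has_prod_qprod[of x]] pn x by simp
qed

end

text \<open>Here the nome varies together with the argument. The majorant \<open>\<rho> ^ n\<close>
  does not depend on \<open>r\<close>, which gives uniform convergence and continuity down to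
  \<open>r = 0\<close>.\<close>

lemma continuous_qprod_ratio:
  assumes \<rho>: "0 \<le> \<rho>" "\<rho> < 1" and s: "\<bar>s\<bar> = 1"
  shows "continuous_on {0..\<rho>} (\<lambda>r::real. qprod (r\<^sup>2) (s * r))"
proof -
  let ?A = "{0..\<rho>}" and ?f = "\<lambda>n r::real. - (of_real ((r\<^sup>2) ^ n) * (s * r))"
  have "uniformly_convergent_on ?A (\<lambda>N r. \<Prod>n<N. 1 + ?f n r)"
  proof (rule Infinite_Products.uniformly_convergent_on_prod)
    show "uniformly_convergent_on ?A (\<lambda>N r. \<Sum>n<N. norm (?f n r))"
    proof (rule Weierstrass_m_test'_ev[OF always_eventually])
      show "\<forall>n. \<forall>r\<in>?A. norm (norm (?f n r)) \<le> \<rho> ^ n"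
      proof (intro allI ballI)
        fix n r assume r: "r \<in> ?A"
        then have "\<bar>r\<bar> \<le> 1" using \<rho> by simp
        have "norm (norm (?f n r)) = r ^ n * (r ^ n * r)"
          using r s by (simp add: abs_mult power2_eq_square power_mult_distrib)
        also have "\<dots> \<le> r ^ n * 1"
          using r \<rho> by (intro mult_left_mono) (auto intro!: mult_le_one power_le_one)
        also have "\<dots> \<le> \<rho> ^ n" using r by (simp add: power_mono)
        finally show "norm (norm (?f n r)) \<le> \<rho> ^ n" .
      qed
      show "summable (\<lambda>n. \<rho> ^ n)" using \<rho> by (simp add: summable_geometric)
    qed
  qed (auto intro!: continuous_intros)
  then obtain g where g: "uniform_limit ?A (\<lambda>N r. \<Prod>n<N. 1 + ?f n r) g sequentially"
    by (auto simp: uniformly_convergent_on_def)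
  have gc: "continuous_on ?A g"
    by (rule uniform_limit_theorem[OF _ g]) (auto intro!: always_eventually continuous_intros)
  have "g r = qprod (r\<^sup>2) (s * r)" if "r \<in> ?A" for r
  proof -
    have "r\<^sup>2 < 1" using that \<rho> by (simp add: power_less_one_iff abs_square_less_1)
    have "(\<lambda>N. \<Prod>n<N. 1 + ?f n r) \<longlonglongrightarrow> g r"
      using tendsto_uniform_limitI[OF g that] .
    moreover have "(\<lambda>N. \<Prod>n<N. 1 + ?f n r) \<longlonglongrightarrow> qprod (r\<^sup>2) (s * r)"
      using has_prod_imp_tendsto'[OF has_prod_qprod[of "r\<^sup>2" "s * r"]] \<open>r\<^sup>2 < 1\<close> by simp
    ultimately show ?thesis using LIMSEQ_unique by blast
  qed
  then show ?thesis using gc continuous_on_cong by (metis (no_types, lifting))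
qed

text \<open>Finds the nome that belongs to a prescribed modulus. At \<open>r = 0\<close> the
  quotient of the two products is 1; at \<open>r = \<rho>\<close> the first factors alone contribute
  \<open>(1 - \<rho>) / (1 + \<rho>) = \<kappa>\<close>, and the remaining ones do not increase it.
  The intermediate value theorem applies.\<close>

lemma qprod_ratio_surj:
  assumes \<kappa>: "0 < \<kappa>" "\<kappa> < 1"
  shows "\<exists>r. 0 < r \<and> r < 1 \<and> qprod (r\<^sup>2) r = \<kappa> * qprod (r\<^sup>2) (- r :: real)"
proof -
  define \<rho> where "\<rho> = (1 - \<kappa>) / (1 + \<kappa>)"
  have \<rho>: "0 \<le> \<rho>" "\<rho> < 1" using \<kappa> by (auto simp: \<rho>_def)
  define f where "f = (\<lambda>r::real. qprod (r\<^sup>2) (1 * r) - \<kappa> * qprod (r\<^sup>2) (- 1 * r))"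
  have "continuous_on {0..\<rho>} f"
    unfolding f_def by (intro continuous_intros continuous_qprod_ratio[OF \<rho>]) auto
  moreover have f0: "f 0 > 0"
  proof -
    have "qprod 0 (0::real) = 1" using qprod_def[of 0 "0::real"] by simp
    then show ?thesis using \<kappa> by (simp add: f_def)
  qed
  moreover have "f \<rho> \<le> 0"
  proof -
    have r2: "0 \<le> \<rho>\<^sup>2" "\<rho>\<^sup>2 < 1" using \<rho> by (auto simp: abs_square_less_1)
    have r3: "0 \<le> \<rho>\<^sup>2 * \<rho>" "\<rho>\<^sup>2 * \<rho> \<le> 1" using r2 \<rho> by (auto intro!: mult_le_one)
    have "qprod (\<rho>\<^sup>2) \<rho> = (1 - \<rho>) * qprod (\<rho>\<^sup>2) (\<rho>\<^sup>2 * \<rho>)"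
      using qprod_rec[OF r2, of \<rho>] by simp
    also have "\<dots> \<le> (1 - \<rho>) * 1"
      using qprod_bounds(1)[OF r2 r3] \<rho> by (intro mult_left_mono) auto
    finally have 1: "qprod (\<rho>\<^sup>2) \<rho> \<le> 1 - \<rho>" by simp
    have "1 + \<rho> \<le> (1 + \<rho>) * qprod (\<rho>\<^sup>2) (- (\<rho>\<^sup>2 * \<rho>))"
      using qprod_bounds(2)[OF r2 r3(1)] \<rho> by (simp add: mult_le_cancel_left1)
    also have "\<dots> = qprod (\<rho>\<^sup>2) (- \<rho>)"
      using qprod_rec[OF r2, of "- \<rho>"] by simp
    finally have "\<kappa> * (1 + \<rho>) \<le> \<kappa> * qprod (\<rho>\<^sup>2) (- \<rho>)" using \<kappa> by simp
    moreover have "\<kappa> * (1 + \<rho>) = 1 - \<rho>" using \<kappa> by (simp add: \<rho>_def field_simps)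
    ultimately show ?thesis using 1 by (simp add: f_def)
  qed
  ultimately obtain r where r: "0 \<le> r" "r \<le> \<rho>" "f r = 0"
    using IVT2'[of f \<rho> 0 0] \<rho> by auto
  then have "r \<noteq> 0" using f0 by auto
  then show ?thesis using r \<rho> by (intro exI[of _ r]) (auto simp: f_def)
qed

section \<open>The sigma function of a rectangular lattice\<close>

lemma shift_invariant_int:
  fixes c :: complex
  assumes "\<And>v. P (v + c) \<longleftrightarrow> P v"
  shows "P (v + of_int k * c) \<longleftrightarrow> P v"
proof (induction k rule: int_induct[where k = 0])
  case (step1 i)
  have "P (v + of_int (i + 1) * c) \<longleftrightarrow> P ((v + of_int i * c) + c)" by (simp add: algebra_simps)
  then show ?case using assms step1 by simp
next
  case (step2 i)
  have "P (v + of_int i * c) \<longleftrightarrow> P ((v + of_int (i - 1) * c) + c)" by (simp add: algebra_simps)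
  then show ?case using assms step2 by simp
qed simp

text \<open>At a zero \<open>a\<close> of \<open>h\<close> both functions are divided by
  \<open>z - a\<close>; the difference quotients extend holomorphically, and that of
  \<open>h\<close> is nonzero at \<open>a\<close> because the zero is simple.\<close>

lemma entire_divide:
  assumes f: "f holomorphic_on UNIV" and h: "h holomorphic_on UNIV"
    and z: "\<And>z. h z = 0 \<Longrightarrow> f z = 0 \<and> deriv h z \<noteq> 0"
  shows "\<exists>q. q holomorphic_on UNIV \<and> (\<forall>z. f z = q z * h z)"
proof -
  define q where "q = (\<lambda>z. if h z = 0 then deriv f z / deriv h z else f z / h z)"
  have "q holomorphic_on UNIV"
    unfolding holomorphic_on_def
  proof
    fix a :: complex
    have "\<exists>d. (q has_field_derivative d) (at a)"
    proof (cases "h a = 0")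
      case False
      have "(\<lambda>z. f z / h z) holomorphic_on {z. h z \<noteq> 0}"
        using f h by (intro holomorphic_intros) (auto intro: holomorphic_on_subset)
      moreover have op: "open {z. h z \<noteq> 0}"
        using holomorphic_on_imp_continuous_on[OF h] by (intro open_Collect_neq continuous_intros) auto
      ultimately obtain d where "((\<lambda>z. f z / h z) has_field_derivative d) (at a)"
        using False by (meson holomorphic_on_open mem_Collect_eq)
      then have "(q has_field_derivative d) (at a)"
        by (rule has_field_derivative_transform_within_open[OF _ op]) (use False in \<open>auto simp: q_def\<close>)
      then show ?thesis ..
    next
      case True
      define f1 where "f1 = (\<lambda>z. if z = a then deriv f a else (f z - f a) / (z - a))"
      define h1 where "h1 = (\<lambda>z. if z = a then deriv h a else (h z - h a) / (z - a))"
      have f1: "f1 holomorphic_on UNIV" unfolding f1_def by (rule pole_lemma[OF f]) simp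
      have h1: "h1 holomorphic_on UNIV" unfolding h1_def by (rule pole_lemma[OF h]) simp
      have "f a = 0" "deriv h a \<noteq> 0" using z[OF True] by auto
      have op: "open {z. h1 z \<noteq> 0}"
        using holomorphic_on_imp_continuous_on[OF h1] by (intro open_Collect_neq continuous_intros) auto
      have "(\<lambda>z. f1 z / h1 z) holomorphic_on {z. h1 z \<noteq> 0}"
        using f1 h1 by (intro holomorphic_intros) (auto intro: holomorphic_on_subset)
      moreover have a: "a \<in> {z. h1 z \<noteq> 0}" using \<open>deriv h a \<noteq> 0\<close> by (simp add: h1_def)
      ultimately obtain d where "((\<lambda>z. f1 z / h1 z) has_field_derivative d) (at a)"
        using op by (meson holomorphic_on_open)
      then have "(q has_field_derivative d) (at a)"
      proof (rule has_field_derivative_transform_within_open[OF _ op a])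
        fix u assume "u \<in> {z. h1 z \<noteq> 0}"
        then show "f1 u / h1 u = q u"
          using True \<open>f a = 0\<close> by (cases "u = a") (auto simp: q_def f1_def h1_def)
      qed
      then show ?thesis ..
    qed
    then show "q field_differentiable (at a within UNIV)" by (simp add: field_differentiable_def)
  qed
  moreover have "f z = q z * h z" for z using z[of z] by (auto simp: q_def)
  ultimately show ?thesis by blast
qed

text \<open>
  \<open>sig\<close> is the Weierstrass sigma function of the lattice \<open>plat L\<close> up to a factor
  \<open>exp (p v\<^sup>2 + q)\<close> that makes it antiperiodic with respect to \<open>2\<pi>\<i>\<close>.
\<close>

definition sig :: "real \<Rightarrow> complex \<Rightarrow> complex" where
  "sig L v = - exp (- v / 2) * (qprod (exp (- L)) (exp v) * qprod (exp (- L)) (exp (- of_real L - v)))"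

abbreviation (input) plat :: "real \<Rightarrow> complex set" where
  "plat L \<equiv> lattice_of (of_real L) (of_real (2 * pi) * \<i>)"

context
  fixes L :: real
  assumes L: "L > 0"
begin

lemma nome: "0 \<le> exp (- L)" "exp (- L) < 1" using L by auto

lemmas qrec = qprod_rec[OF nome, where 'a = complex]

lemma qprod_exp:
  fixes v :: complex
  shows "qprod (exp (- L)) (exp v) = (1 - exp v) * qprod (exp (- L)) (exp (v - of_real L))"
  using qrec[of "exp v"] by (simp add: exp_of_real[symmetric] exp_add[symmetric])

lemma sig_holomorphic: "sig L holomorphic_on UNIV"
proof -
  have *: "(\<lambda>v. qprod (exp (- L)) (exp (g v))) holomorphic_on UNIV" if "g holomorphic_on UNIV" for g :: "complex \<Rightarrow> complex"
    using holomorphic_on_compose_gen[of "\<lambda>v. exp (g v)" UNIV "qprod (exp (- L))" UNIV]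
      qprod_holomorphic[OF nome] that by (auto simp: o_def intro!: holomorphic_intros)
  show ?thesis unfolding sig_def[abs_def] by (intro holomorphic_intros *) auto
qed

text \<open>The shift makes one product gain the factor \<open>1 - exp (v + L)\<close> and the other
  lose \<open>1 - exp (- L - v)\<close>; the quotient of the two is
  \<open>- exp (v + L)\<close>.\<close>

lemma sig_shift: "sig L (v + of_real L) = - exp (v + of_real L / 2) * sig L v"
proof -
  have 1: "qprod (exp (- L)) (exp (v + of_real L)) = (1 - exp (v + of_real L)) * qprod (exp (- L)) (exp v)"
    using qprod_exp[of "v + of_real L"] by simp
  have 2: "qprod (exp (- L)) (exp (- of_real L - v))
      = (1 - exp (- of_real L - v)) * qprod (exp (- L)) (exp (- of_real L - (v + of_real L)))"
    using qprod_exp[of "- of_real L - v"] by (simp add: algebra_simps)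
  have 3: "exp (- (v + of_real L) / 2) * (1 - exp (v + of_real L))
      = - exp (v + of_real L / 2) * exp (- v / 2) * (1 - exp (- of_real L - v))"
  proof -
    have e: "- (v + of_real L) / 2 + (v + of_real L) = v + of_real L / 2 + - v / 2"
      "v + of_real L / 2 + - v / 2 + (- of_real L - v) = - (v + of_real L) / 2"
      by (simp_all add: field_simps)
    show ?thesis
      unfolding right_diff_distrib mult_1_right mult_minus_left exp_add[symmetric] e by simp
  qed
  have "sig L (v + of_real L) = - (exp (- (v + of_real L) / 2) * (1 - exp (v + of_real L)))
      * qprod (exp (- L)) (exp v) * qprod (exp (- L)) (exp (- of_real L - (v + of_real L)))"
    unfolding sig_def 1 by (simp add: mult_ac)
  also have "\<dots> = - exp (v + of_real L / 2) * sig L v"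
    unfolding 3 sig_def 2 by (simp add: mult_ac)
  finally show ?thesis .
qed

text \<open>Pulling out the factor of the first product that vanishes at 0 leaves
  \<open>2 sinh (v / 2)\<close> times a product symmetric under \<open>v \<mapsto> - v\<close>. This
  makes oddness visible, and simplicity of the zero at 0.\<close>

lemma sig_factored: "sig L v = (exp (v / 2) - exp (- v / 2))
    * (qprod (exp (- L)) (exp (v - of_real L)) * qprod (exp (- L)) (exp (- of_real L - v)))"
proof -
  have "- exp (- v / 2) * (1 - exp v) = exp (v / 2) - exp (- v / 2)"
    by (simp add: algebra_simps exp_add[symmetric])
  then show ?thesis unfolding sig_def qprod_exp[of v] by (simp only: mult.assoc[symmetric])
qed

lemma sig_odd: "sig L (- v) = - sig L v"
proof -
  have e: "- v - of_real L = - of_real L - v" "- of_real L - - v = v - of_real L" by simp_all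
  show ?thesis unfolding sig_factored e by (simp add: left_diff_distrib mult.commute)
qed

lemma exp_2pii: "exp (v + of_real (2 * pi) * \<i>) = exp v"
  using exp_eq[of "v + of_real (2 * pi) * \<i>" v] by (auto intro!: exI[of _ 1])

lemma exp_pii: "exp (v + of_real pi * \<i>) = - exp v"
  by (simp add: exp_add)

lemma sig_shift2: "sig L (v + of_real (2 * pi) * \<i>) = - sig L v"
proof -
  have "exp (- (v + of_real (2 * pi) * \<i>) / 2) = - exp (- v / 2)"
    using exp_pii[of "- v / 2 - of_real pi * \<i>"] by (simp add: add_divide_distrib diff_divide_distrib)
  moreover have "exp (- of_real L - (v + of_real (2 * pi) * \<i>)) = exp (- of_real L - v)"
  proof -
    have "- of_real L - (v + of_real (2 * pi) * \<i>) + of_real (2 * pi) * \<i> = - of_real L - v" by simp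
    then show ?thesis using exp_2pii[of "- of_real L - (v + of_real (2 * pi) * \<i>)"] by metis
  qed
  ultimately show ?thesis unfolding sig_def exp_2pii by simp
qed

lemma sig_cnj: "sig L (cnj v) = cnj (sig L v)"
proof -
  have "exp (- of_real L - cnj v) = cnj (exp (- of_real L - v))" by (simp add: exp_cnj)
  moreover have "exp (- cnj v / 2) = cnj (exp (- v / 2))" by (simp add: exp_cnj)
  ultimately show ?thesis unfolding sig_def
    by (simp only: exp_cnj[symmetric] qprod_cnj[OF nome] complex_cnj_mult complex_cnj_minus)
qed

text \<open>The first product supplies the zeros whose coefficient of \<open>L\<close> is at least
  0, the second, starting with \<open>exp (- L - v)\<close>, those with coefficient at most -1. No
  lattice point occurs twice.\<close>

lemma sig_eq_0_iff: "sig L v = 0 \<longleftrightarrow> v \<in> plat L"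
proof -
  have pw: "of_real (exp (- L) ^ n) * exp x = 1 \<longleftrightarrow> (\<exists>m::int. x = of_int (int n) * of_real L + of_int m * (of_real (2 * pi) * \<i>))"
    for n :: nat and x :: complex
  proof -
    have "of_real (exp (- L) ^ n) * exp x = exp (x - of_nat n * of_real L)"
      by (simp add: exp_of_real[symmetric] exp_of_nat_mult[symmetric] exp_diff exp_minus field_simps power_inverse)
    then show ?thesis using exp_eq[of "x - of_nat n * of_real L" 0]
      by (simp add: algebra_simps)
  qed
  have "sig L v = 0 \<longleftrightarrow> (\<exists>n::nat. \<exists>m::int. v = of_int (int n) * of_real L + of_int m * (of_real (2 * pi) * \<i>))
     \<or> (\<exists>n::nat. \<exists>m::int. - of_real L - v = of_int (int n) * of_real L + of_int m * (of_real (2 * pi) * \<i>))"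
    unfolding sig_def mult_eq_0_iff qprod_eq_0_iff[OF nome] pw by simp
  also have "\<dots> \<longleftrightarrow> v \<in> plat L"
  proof
    assume "(\<exists>n::nat. \<exists>m::int. v = of_int (int n) * of_real L + of_int m * (of_real (2 * pi) * \<i>))
     \<or> (\<exists>n::nat. \<exists>m::int. - of_real L - v = of_int (int n) * of_real L + of_int m * (of_real (2 * pi) * \<i>))"
    then consider (1) n m where "v = of_int (int n) * of_real L + of_int m * (of_real (2 * pi) * \<i>)"
      | (2) n m where "- of_real L - v = of_int (int n) * of_real L + of_int m * (of_real (2 * pi) * \<i>)" by blast
    then show "v \<in> plat L"
    proof cases
      case 1 then show ?thesis unfolding lattice_of_def by blast
    next
      case 2
      have "v = - of_real L - (- of_real L - v)" by simp
      also have "\<dots> = of_int (- int n - 1) * of_real L + of_int (- m) * (of_real (2 * pi) * \<i>)"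
        unfolding 2 by (simp add: algebra_simps)
      finally have "v = of_int (- int n - 1) * of_real L + of_int (- m) * (of_real (2 * pi) * \<i>)" .
      then show ?thesis unfolding lattice_of_def by blast
    qed
  next
    assume "v \<in> plat L"
    then obtain k m :: int where km: "v = of_int k * of_real L + of_int m * (of_real (2 * pi) * \<i>)"
      unfolding lattice_of_def by blast
    show "(\<exists>n::nat. \<exists>m::int. v = of_int (int n) * of_real L + of_int m * (of_real (2 * pi) * \<i>))
     \<or> (\<exists>n::nat. \<exists>m::int. - of_real L - v = of_int (int n) * of_real L + of_int m * (of_real (2 * pi) * \<i>))"
    proof (cases "k \<ge> 0")
      case True
      then have "v = of_int (int (nat k)) * of_real L + of_int m * (of_real (2 * pi) * \<i>)" using km by simp
      then show ?thesis by blast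
    next
      case False
      then have "- of_real L - v = of_int (int (nat (- k - 1))) * of_real L + of_int (- m) * (of_real (2 * pi) * \<i>)"
        unfolding km using False by (simp add: algebra_simps)
      then show ?thesis by blast
    qed
  qed
  finally show ?thesis .
qed

text \<open>Being a simple zero is invariant under both quasi-periods, so it suffices to look at 0,
  where the derivative is the value \<open>R 0\<close> of the symmetric product in
  \<open>sig_factored\<close>.\<close>

lemma deriv_sig: assumes "sig L v = 0" shows "deriv (sig L) v \<noteq> 0"
proof -
  define P where "P = (\<lambda>v. sig L v = 0 \<and> deriv (sig L) v \<noteq> 0)"
  have D: "(sig L has_field_derivative deriv (sig L) v) (at v)" for v
    using holomorphic_derivI[OF sig_holomorphic open_UNIV] by simp
  have P1: "P (v + of_real L) \<longleftrightarrow> P v" for v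
  proof -
    have "((\<lambda>u. sig L (u + of_real L)) has_field_derivative deriv (sig L) (v + of_real L)) (at v)"
      using D[of "v + of_real L"] DERIV_shift by blast
    moreover have "((\<lambda>u. sig L (u + of_real L)) has_field_derivative
       - exp (v + of_real L / 2) * sig L v - exp (v + of_real L / 2) * deriv (sig L) v) (at v)"
      unfolding sig_shift by (auto intro!: derivative_eq_intros D)
    ultimately have "deriv (sig L) (v + of_real L)
        = - exp (v + of_real L / 2) * sig L v - exp (v + of_real L / 2) * deriv (sig L) v"
      using DERIV_unique by blast
    then show ?thesis by (auto simp: P_def sig_shift)
  qed
  have P2: "P (v + of_real (2 * pi) * \<i>) \<longleftrightarrow> P v" for v
  proof -
    have "((\<lambda>u. sig L (u + of_real (2 * pi) * \<i>)) has_field_derivative deriv (sig L) (v + of_real (2 * pi) * \<i>)) (at v)"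
      using D[of "v + of_real (2 * pi) * \<i>"] DERIV_shift by blast
    moreover have "((\<lambda>u. sig L (u + of_real (2 * pi) * \<i>)) has_field_derivative - deriv (sig L) v) (at v)"
      unfolding sig_shift2 by (auto intro!: derivative_eq_intros D)
    ultimately have "deriv (sig L) (v + of_real (2 * pi) * \<i>) = - deriv (sig L) v"
      using DERIV_unique by blast
    then show ?thesis unfolding P_def sig_shift2 by simp
  qed
  have "P 0"
  proof -
    define R where "R = (\<lambda>v. qprod (exp (- L)) (exp (v - of_real L)) * qprod (exp (- L)) (exp (- of_real L - v)) :: complex)"
    have "R holomorphic_on UNIV"
    proof -
      have *: "(\<lambda>v. qprod (exp (- L)) (exp (g v))) holomorphic_on UNIV" if "g holomorphic_on UNIV" for g :: "complex \<Rightarrow> complex"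
        using holomorphic_on_compose_gen[of "\<lambda>v. exp (g v)" UNIV "qprod (exp (- L))" UNIV]
          qprod_holomorphic[OF nome] that by (auto simp: o_def intro!: holomorphic_intros)
      show ?thesis unfolding R_def by (intro holomorphic_intros *)
    qed
    then have R: "(R has_field_derivative deriv R 0) (at 0)"
      using holomorphic_derivI[OF _ open_UNIV] by blast
    have "((\<lambda>v. (exp (v / 2) - exp (- v / 2)) * R v) has_field_derivative R 0) (at 0)"
      by (auto intro!: derivative_eq_intros R)
    then have "(sig L has_field_derivative R 0) (at 0)"
      unfolding R_def sig_factored[abs_def] .
    then have "deriv (sig L) 0 = R 0" by (rule DERIV_imp_deriv)
    moreover have "R 0 \<noteq> 0"
    proof
      assume "R 0 = 0"
      then have "qprod (exp (- L)) (of_real (exp (- L)) :: complex) = 0"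
        by (simp add: R_def flip: exp_of_real)
      then have "qprod (exp (- L)) (exp (- L)) = (0::real)"
        unfolding qprod_of_real[OF nome] by simp
      then obtain n where "exp (- L) ^ n * exp (- L) = 1" unfolding qprod_eq_0_iff[OF nome] by auto
      moreover have "exp (- L) ^ n * exp (- L) < 1"
      proof -
        have "exp (- L) ^ n * exp (- L) \<le> 1 * exp (- L)"
          by (intro mult_right_mono power_le_one nome less_imp_le)
        then show ?thesis using nome(2) by linarith
      qed
      ultimately show False by simp
    qed
    ultimately show ?thesis using sig_eq_0_iff[of 0] by (simp add: P_def)
  qed
  moreover obtain k m :: int where "v = of_int k * of_real L + of_int m * (of_real (2 * pi) * \<i>)"
    using assms unfolding sig_eq_0_iff lattice_of_def by blast
  ultimately have "P v"
    using shift_invariant_int[of P, OF P1, of 0 k] shift_invariant_int[of P, OF P2, of "of_int k * of_real L" m]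
    by simp
  then show ?thesis by (simp add: P_def)
qed

end

text \<open>Identity theorem on the open set where \<open>h\<close> does not vanish. This device
  turns identities with a denominator into identities everywhere.\<close>

lemma entire_mult_cancel:
  assumes f: "f holomorphic_on UNIV" and h: "h holomorphic_on UNIV"
    and z0: "h z0 \<noteq> (0::complex)" and eq: "\<And>z. h z \<noteq> 0 \<Longrightarrow> f z = 0"
  shows "f z = 0"
proof -
  have op: "open {z. h z \<noteq> 0}"
    using holomorphic_on_imp_continuous_on[OF h] by (intro open_Collect_neq continuous_intros) auto
  show ?thesis
    by (rule analytic_continuation_open[OF op open_UNIV _ connected_UNIV _ f holomorphic_on_const[of 0]])
      (use z0 eq in auto)
qed

lemma entire_shift: "f holomorphic_on UNIV \<Longrightarrow> (\<lambda>u. f (u + a)) holomorphic_on UNIV"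
  by (rule holomorphic_on_compose_gen[of "\<lambda>u. u + a" UNIV f UNIV, unfolded o_def])
    (auto intro!: holomorphic_intros)

lemma entire_reflect: "f holomorphic_on UNIV \<Longrightarrow> (\<lambda>u. f (- u)) holomorphic_on UNIV"
  by (rule holomorphic_on_compose_gen[of "\<lambda>u. - u" UNIV f UNIV, unfolded o_def])
    (auto intro!: holomorphic_intros)

lemma int_double_neq_1: "real_of_int x * 2 \<noteq> 1"
proof
  assume "real_of_int x * 2 = 1"
  then have "real_of_int (x * 2) = real_of_int 1" by simp
  then have "x * 2 = 1" by (simp only: of_int_eq_iff)
  then show False by presburger
qed

lemma plat_iff: "of_real x + \<i> * of_real y \<in> plat L \<longleftrightarrow> (\<exists>(k::int) (m::int). x = k * L \<and> y = 2 * pi * m)"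
  by (auto simp: lattice_of_def complex_eq_iff mult.commute)

text \<open>
  In Jacobi's notation \<open>(s, c, d, n)\<close> is proportional to \<open>(sn, 1, dn, cn)\<close>, and \<open>k2\<close> is the
  complementary parameter \<open>1 - k\<^sup>2\<close>.
\<close>

locale theta_functions =
  fixes L k2 :: real and s c d n :: "complex \<Rightarrow> complex"
  assumes L: "L > 0"
    and hol: "s holomorphic_on UNIV" "c holomorphic_on UNIV" "d holomorphic_on UNIV" "n holomorphic_on UNIV"
    and conj: "s (cnj v) = cnj (s v)" "c (cnj v) = cnj (c v)" "d (cnj v) = cnj (d v)" "n (cnj v) = cnj (n v)"
    and rel: "(c v)\<^sup>2 = (n v)\<^sup>2 + (s v)\<^sup>2" "(d v)\<^sup>2 = (n v)\<^sup>2 + of_real k2 * (s v)\<^sup>2"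
    and parity: "s (- v) = - s v" "c (- v) = c v" "d (- v) = d v" "n (- v) = n v"
    and shift_imag: "s (v + of_real (2 * pi) * \<i>) = - s v" "c (v + of_real (2 * pi) * \<i>) = - c v"
      "d (v + of_real (2 * pi) * \<i>) = d v" "n (v + of_real (2 * pi) * \<i>) = n v"
    and shift_real: "s (v + of_real L) = - exp (v + of_real L / 2) * s v" "c (v + of_real L) = exp (v + of_real L / 2) * c v"
      "d (v + of_real L) = exp (v + of_real L / 2) * d v" "n (v + of_real L) = - exp (v + of_real L / 2) * n v"
    and fibre: "(s u)\<^sup>2 * (n v)\<^sup>2 = (s v)\<^sup>2 * (n u)\<^sup>2 \<Longrightarrow> u - v \<in> plat L \<or> u + v \<in> plat L"
    and zeros: "s v * c v * d v * n v = 0 \<Longrightarrow> 2 * v \<in> plat L"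
    and no_common_zero: "s v \<noteq> 0 \<or> n v \<noteq> 0"
    and surj: "(x, y) \<noteq> (0, 0) \<Longrightarrow> \<exists>u. y * (s u)\<^sup>2 = x * (n u)\<^sup>2"

lemma plat_invariant:
  assumes "\<And>v. f (v + of_real L) = f v" "\<And>v. f (v + of_real (2 * pi) * \<i>) = f v" "l \<in> plat L"
  shows "f (v + l) = (f v :: complex)"
proof -
  obtain k m :: int where l: "l = of_int k * of_real L + of_int m * (of_real (2 * pi) * \<i>)"
    using assms(3) by (auto simp: lattice_of_def)
  let ?P = "\<lambda>u. f u = f v"
  have 1: "?P (u + of_int k * of_real L) \<longleftrightarrow> ?P u" for u
    by (rule shift_invariant_int) (simp only: assms(1))
  have 2: "?P (u + of_int m * (of_real (2 * pi) * \<i>)) \<longleftrightarrow> ?P u" for u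
    by (rule shift_invariant_int) (simp only: assms(2))
  show ?thesis using 1[of v] 2[of "v + of_int k * of_real L"] by (simp only: l add.assoc)
qed

section \<open>The four theta functions and their quadratic relations\<close>

text \<open>\<open>sig\<close>, \<open>thC\<close>, \<open>thD\<close>, \<open>thN\<close>
  correspond to Jacobi's theta functions 1 to 4 with nome \<open>exp (- L / 2)\<close>. They are
  translates of \<open>sig\<close> by half periods; the extra factors make them real, and
  \<open>thN\<close> and \<open>thD\<close> also periodic along the imaginary period.\<close>

definition thN :: "real \<Rightarrow> complex \<Rightarrow> complex" where
  "thN L u = exp (- u / 2) * sig L (u + of_real (L / 2))"

definition thC :: "real \<Rightarrow> complex \<Rightarrow> complex" where
  "thC L u = - \<i> * sig L (u + of_real pi * \<i>)"

definition thD :: "real \<Rightarrow> complex \<Rightarrow> complex" where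
  "thD L u = thN L (u + of_real pi * \<i>)"

context
  fixes L :: real
  assumes L: "L > 0"
begin

lemma sig_pii: "sig L (v - of_real pi * \<i>) = - sig L (v + of_real pi * \<i>)"
proof -
  have e: "v - of_real pi * \<i> + of_real (2 * pi) * \<i> = v + of_real pi * \<i>" by (simp add: algebra_simps)
  have "sig L (v + of_real pi * \<i>) = - sig L (v - of_real pi * \<i>)"
    using sig_shift2[OF L, of "v - of_real pi * \<i>"] unfolding e .
  then show ?thesis by simp
qed

lemma sig_w: "sig L (v + of_real (L / 2)) = - exp v * sig L (v - of_real (L / 2))"
  using sig_shift[OF L, of "v - of_real (L / 2)"] by (simp add: algebra_simps)

text \<open>One of the two equal factors is moved across the real period, which absorbs the
  exponentials and produces the left-hand product of \<open>sig_three_term\<close> at a half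
  period.\<close>

lemma thN_sq: "(thN L u)\<^sup>2 = - (sig L (u - of_real (L / 2)) * sig L (u + of_real (L / 2)))"
proof -
  have "(thN L u)\<^sup>2 = (exp (- u / 2) * exp (- u / 2)) * sig L (u + of_real (L / 2)) * sig L (u + of_real (L / 2))"
    by (simp add: thN_def power2_eq_square)
  also have "exp (- u / 2) * exp (- u / 2) = exp (- u)" by (simp add: exp_add[symmetric])
  also have "exp (- u) * sig L (u + of_real (L / 2)) = - sig L (u - of_real (L / 2))"
    unfolding sig_w[of u] by (simp add: exp_minus)
  finally show ?thesis by simp
qed

lemma thN_holomorphic: "thN L holomorphic_on UNIV"
  unfolding thN_def[abs_def] by (intro holomorphic_intros entire_shift sig_holomorphic[OF L]) auto

lemma thC_holomorphic: "thC L holomorphic_on UNIV"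
  unfolding thC_def[abs_def] by (intro holomorphic_intros entire_shift sig_holomorphic[OF L])

lemma thD_holomorphic: "thD L holomorphic_on UNIV"
  unfolding thD_def[abs_def] by (rule entire_shift[OF thN_holomorphic])

lemma thN_even: "thN L (- u) = thN L u"
proof -
  have "sig L (- u + of_real (L / 2)) = - sig L (u - of_real (L / 2))"
    using sig_odd[OF L, of "u - of_real (L / 2)"] by simp
  then have "thN L (- u) = - exp (u / 2) * sig L (u - of_real (L / 2))" by (simp add: thN_def)
  moreover have "exp (- u / 2) * exp u = exp (u / 2)" by (simp add: exp_add[symmetric] field_simps)
  ultimately show ?thesis unfolding thN_def sig_w[of u] by (simp add: mult.assoc[symmetric])
qed

lemma thN_shift_imag: "thN L (u + of_real (2 * pi) * \<i>) = thN L u"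
proof -
  have "exp (- (u + of_real (2 * pi) * \<i>) / 2) = - exp (- u / 2)"
    using exp_pii[OF L, of "- u / 2 - of_real pi * \<i>"] by (simp add: add_divide_distrib diff_divide_distrib)
  moreover have "sig L (u + of_real (2 * pi) * \<i> + of_real (L / 2)) = - sig L (u + of_real (L / 2))"
    using sig_shift2[OF L, of "u + of_real (L / 2)"] by (simp add: algebra_simps)
  ultimately show ?thesis by (simp add: thN_def)
qed

lemma thN_shift_real: "thN L (u + of_real L) = - exp (u + of_real L / 2) * thN L u"
proof -
  have 1: "sig L (u + of_real L + of_real (L / 2)) = - exp (u + of_real L) * sig L (u + of_real (L / 2))"
    using sig_shift[OF L, of "u + of_real (L / 2)"] by (simp add: algebra_simps)
  have 2: "exp (- (u + of_real L) / 2) * exp (u + of_real L) = exp (u + of_real L / 2) * exp (- u / 2)"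
    unfolding exp_add[symmetric] by (rule arg_cong[of _ _ exp]) (simp add: field_simps)
  have "thN L (u + of_real L) = - (exp (- (u + of_real L) / 2) * exp (u + of_real L)) * sig L (u + of_real (L / 2))"
    unfolding thN_def 1 by simp
  then show ?thesis unfolding 2 thN_def by simp
qed

lemma thN_eq_0: "thN L u = 0 \<longleftrightarrow> u + of_real (L / 2) \<in> plat L"
  by (simp add: thN_def sig_eq_0_iff[OF L])

lemma thN_deriv: assumes "thN L u = 0" shows "deriv (thN L) u \<noteq> 0"
proof -
  have z: "sig L (u + of_real (L / 2)) = 0" using assms by (simp add: thN_def)
  have "(sig L has_field_derivative deriv (sig L) (u + of_real (L / 2))) (at (u + of_real (L / 2)))"
    using holomorphic_derivI[OF sig_holomorphic[OF L] open_UNIV] by simp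
  then have "((\<lambda>u. sig L (u + of_real (L / 2))) has_field_derivative deriv (sig L) (u + of_real (L / 2))) (at u)"
    using DERIV_shift by blast
  then have "(thN L has_field_derivative exp (- u / 2) * deriv (sig L) (u + of_real (L / 2))) (at u)"
    unfolding thN_def[abs_def] by (auto intro!: derivative_eq_intros simp: z[simplified])
  then show ?thesis using deriv_sig[OF L z] by (simp add: DERIV_imp_deriv)
qed

text \<open>Both sides, as functions of \<open>u\<close>, are even sections of the same degree 2 line bundle on the
  torus; their difference vanishes doubly where \<open>thN\<close> vanishes, so it is a multiple of
  \<open>thN\<^sup>2\<close> by Liouville's theorem.\<close>

lemma sig_three_term:
  "(thN L 0)\<^sup>2 * (sig L (u - v) * sig L (u + v)) = (thN L v)\<^sup>2 * (sig L u)\<^sup>2 - (sig L v)\<^sup>2 * (thN L u)\<^sup>2"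
proof -
  let ?\<tau> = "of_real (2 * pi) * \<i>" and ?w = "of_real (L / 2) :: complex"
  define g where "g = (\<lambda>u. (thN L 0)\<^sup>2 * (sig L (u - v) * sig L (u + v)) - (thN L v)\<^sup>2 * (sig L u)\<^sup>2)"
  define N where "N = thN L"
  have Nh: "N holomorphic_on UNIV" unfolding N_def by (rule thN_holomorphic)
  have Nz: "N 0 \<noteq> 0"
    unfolding N_def thN_eq_0 using plat_iff[of "L / 2" 0 L] L int_double_neq_1
    by (auto simp: field_simps)
  note c1 = entire_shift[OF sig_holomorphic[OF L]]
  have gh: "g holomorphic_on UNIV"
    unfolding g_def using c1[of v] c1[of "- v"] sig_holomorphic[OF L] by (intro holomorphic_intros) simp_all
  have g_even: "g (- u) = g u" for u
    using sig_odd[OF L, of "u + v"] sig_odd[OF L, of "u - v"] sig_odd[OF L, of u] by (simp add: g_def)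
  have g_imag: "g (u + ?\<tau>) = g u" for u
  proof -
    have "sig L (u + ?\<tau> - v) = - sig L (u - v)" "sig L (u + ?\<tau> + v) = - sig L (u + v)"
      using sig_shift2[OF L, of "u - v"] sig_shift2[OF L, of "u + v"] by (simp_all add: algebra_simps)
    then show ?thesis by (simp only: g_def sig_shift2[OF L]) simp
  qed
  have g_real: "g (u + of_real L) = (exp (u + of_real L / 2))\<^sup>2 * g u" for u
  proof -
    have "sig L (u + of_real L - v) = - exp (u + of_real L / 2 - v) * sig L (u - v)"
      "sig L (u + of_real L + v) = - exp (u + of_real L / 2 + v) * sig L (u + v)"
      using sig_shift[OF L, of "u - v"] sig_shift[OF L, of "u + v"] by (simp_all add: algebra_simps)
    moreover have "exp (u + of_real L / 2 - v) * exp (u + of_real L / 2 + v) = (exp (u + of_real L / 2))\<^sup>2"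
      by (simp add: power2_eq_square exp_add[symmetric])
    ultimately have "sig L (u + of_real L - v) * sig L (u + of_real L + v)
        = (exp (u + of_real L / 2))\<^sup>2 * (sig L (u - v) * sig L (u + v))" by (simp add: mult_ac)
    then show ?thesis unfolding g_def sig_shift[OF L]
      by (simp only: power_mult_distrib power2_minus right_diff_distrib mult_ac)
  qed
  \<comment> \<open>\<open>g\<close> vanishes at the zero \<open>- ?w\<close> of \<open>N\<close>;
    the automorphy of \<open>g\<close> spreads this to all zeros of \<open>N\<close>.\<close>
  have g_w: "g (- ?w) = 0"
  proof -
    have "sig L (?w - v) = - sig L (v - ?w)" using sig_odd[OF L, of "v - ?w"] by simp
    then have "sig L (?w - v) * sig L (?w + v) = (thN L v)\<^sup>2" by (simp add: thN_sq add.commute)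
    moreover have "thN L 0 = sig L ?w" by (simp add: thN_def)
    ultimately have "g ?w = 0" by (simp add: g_def)
    then show ?thesis using g_even by simp
  qed
  have vanish: "f u = 0" if *: "f (- ?w) = 0" "\<And>u. f (u + ?\<tau>) = 0 \<longleftrightarrow> f u = 0"
    "\<And>u. f (u + of_real L) = 0 \<longleftrightarrow> f u = 0" "N u = 0" for f :: "complex \<Rightarrow> complex" and u
  proof -
    obtain k m :: int where "u + ?w = of_int k * of_real L + of_int m * ?\<tau>"
      using *(4) unfolding N_def thN_eq_0 lattice_of_def by blast
    then have "u = - ?w + of_int k * of_real L + of_int m * ?\<tau>" by (simp add: algebra_simps)
    moreover have "f (- ?w + of_int k * of_real L) = 0"
      using shift_invariant_int[where P = "\<lambda>u. f u = 0" and v = "- ?w" and k = k, OF *(3)] *(1)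
      by (simp only:)
    ultimately show ?thesis
      using shift_invariant_int[where P = "\<lambda>u. f u = 0" and v = "- ?w + of_int k * of_real L" and k = m, OF *(2)]
      by (simp only:)
  qed
  obtain q1 where q1: "q1 holomorphic_on UNIV" "\<And>u. g u = q1 u * N u"
  proof -
    have "\<exists>q. q holomorphic_on UNIV \<and> (\<forall>z. g z = q z * N z)"
    proof (rule entire_divide[OF gh Nh])
      fix z assume z: "N z = 0"
      have "g (u + ?\<tau>) = 0 \<longleftrightarrow> g u = 0" for u by (simp only: g_imag)
      moreover have "g (u + of_real L) = 0 \<longleftrightarrow> g u = 0" for u by (simp only: g_real) simp
      ultimately have "g z = 0" using vanish[of g, OF g_w _ _ z] by blast
      then show "g z = 0 \<and> deriv N z \<noteq> 0" using thN_deriv z by (simp only: N_def) simp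
    qed
    then show ?thesis using that by blast
  qed
  have q1_even: "q1 (- u) = q1 u" for u
  proof -
    have "q1 (- u) - q1 u = 0"
    proof (rule entire_mult_cancel[OF _ Nh Nz, of "\<lambda>u. q1 (- u) - q1 u"])
      fix z assume "N z \<noteq> 0"
      then show "q1 (- z) - q1 z = 0"
        using q1(2)[of z] q1(2)[of "- z"] g_even[of z] thN_even[of z] by (simp add: N_def)
    qed (intro holomorphic_intros q1(1) entire_shift entire_reflect)
    then show ?thesis by simp
  qed
  have q1_imag: "q1 (u + ?\<tau>) = q1 u" for u
  proof -
    have "q1 (u + ?\<tau>) - q1 u = 0"
    proof (rule entire_mult_cancel[OF _ Nh Nz, of "\<lambda>u. q1 (u + ?\<tau>) - q1 u"])
      fix z assume "N z \<noteq> 0"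
      then show "q1 (z + ?\<tau>) - q1 z = 0"
        using q1(2)[of z] q1(2)[of "z + ?\<tau>"] g_imag[of z] thN_shift_imag[of z] by (simp add: N_def)
    qed (intro holomorphic_intros q1(1) entire_shift entire_reflect)
    then show ?thesis by simp
  qed
  have q1_real: "q1 (u + of_real L) = - exp (u + of_real L / 2) * q1 u" for u
  proof -
    have "q1 (u + of_real L) + exp (u + of_real L / 2) * q1 u = 0"
    proof (rule entire_mult_cancel[OF _ Nh Nz, of "\<lambda>u. q1 (u + of_real L) + exp (u + of_real L / 2) * q1 u"])
      fix z assume z: "N z \<noteq> 0"
      define E where "E = exp (z + of_real L / 2)"
      have "q1 (z + of_real L) * (- E * N z) = E\<^sup>2 * (q1 z * N z)"
        using q1(2)[of z] q1(2)[of "z + of_real L"] g_real[of z] thN_shift_real[of z] by (simp add: N_def E_def)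
      then have "(q1 (z + of_real L) + E * q1 z) * (E * N z) = 0"
        by algebra
      then show "q1 (z + of_real L) + exp (z + of_real L / 2) * q1 z = 0"
        using z by (simp add: E_def)
    qed (intro holomorphic_intros q1(1) entire_shift entire_reflect, simp_all)
    then show ?thesis by (simp add: add_eq_0_iff2)
  qed
  \<comment> \<open>The second zero comes from parity: at \<open>- ?w\<close> the automorphy factor
    of \<open>q1\<close> is -1, while \<open>q1\<close> is even.\<close>
  have "q1 (- ?w) = 0"
  proof -
    have "q1 ?w = - q1 (- ?w)" using q1_real[of "- ?w"] by (simp add: field_simps)
    then show ?thesis using q1_even[of ?w] by simp
  qed
  then obtain q2 where q2: "q2 holomorphic_on UNIV" "\<And>u. q1 u = q2 u * N u"
  proof -
    assume 0: "q1 (- ?w) = 0"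
    have "\<exists>q. q holomorphic_on UNIV \<and> (\<forall>z. q1 z = q z * N z)"
    proof (rule entire_divide[OF q1(1) Nh])
      fix z assume z: "N z = 0"
      have "q1 (u + ?\<tau>) = 0 \<longleftrightarrow> q1 u = 0" for u by (simp only: q1_imag)
      moreover have "q1 (u + of_real L) = 0 \<longleftrightarrow> q1 u = 0" for u by (simp only: q1_real) simp
      ultimately have "q1 z = 0" using vanish[of q1, OF 0 _ _ z] by blast
      then show "q1 z = 0 \<and> deriv N z \<noteq> 0" using thN_deriv z by (simp only: N_def) simp
    qed
    then show ?thesis using that by blast
  qed
  have q2_imag: "q2 (u + ?\<tau>) = q2 u" for u
  proof -
    have "q2 (u + ?\<tau>) - q2 u = 0"
    proof (rule entire_mult_cancel[OF _ Nh Nz, of "\<lambda>u. q2 (u + ?\<tau>) - q2 u"])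
      fix z assume "N z \<noteq> 0"
      then show "q2 (z + ?\<tau>) - q2 z = 0"
        using q2(2)[of z] q2(2)[of "z + ?\<tau>"] q1_imag[of z] thN_shift_imag[of z] by (simp add: N_def)
    qed (intro holomorphic_intros q2(1) entire_shift entire_reflect)
    then show ?thesis by simp
  qed
  have q2_real: "q2 (u + of_real L) = q2 u" for u
  proof -
    have "q2 (u + of_real L) - q2 u = 0"
    proof (rule entire_mult_cancel[OF _ Nh Nz, of "\<lambda>u. q2 (u + of_real L) - q2 u"])
      fix z assume "N z \<noteq> 0"
      then show "q2 (z + of_real L) - q2 z = 0"
        using q2(2)[of z] q2(2)[of "z + of_real L"] q1_real[of z] thN_shift_real[of z] by (simp add: N_def)
    qed (intro holomorphic_intros q2(1) entire_shift entire_reflect)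
    then show ?thesis by simp
  qed
  have "\<exists>k. \<forall>z. q2 z = k"
    by (rule lattice_periodic_constant[OF q2(1) _ plat_invariant[of q2 L, OF q2_real q2_imag]]) (use L in auto)
  then obtain k where "\<And>z. q2 z = k" by blast
  then have gk: "g u = k * (N u)\<^sup>2" for u using q1(2) q2(2) by (simp add: power2_eq_square)
  \<comment> \<open>The constant is read off at \<open>u = 0\<close>, where only one term of
    \<open>g\<close> survives.\<close>
  have "sig L 0 = 0" using sig_odd[OF L, of 0] by simp
  then have "- ((N 0)\<^sup>2 * (sig L v)\<^sup>2) = k * (N 0)\<^sup>2"
    using gk[of 0] sig_odd[OF L, of v] by (simp add: g_def N_def power2_eq_square)
  then have "(k + (sig L v)\<^sup>2) * (N 0)\<^sup>2 = 0" by algebra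
  then have "k = - (sig L v)\<^sup>2" using Nz by (simp add: add_eq_0_iff2)
  then show ?thesis using gk[of u] by (simp add: g_def N_def algebra_simps)
qed

lemma half_periods:
  "thN L 0 \<noteq> 0" "thC L 0 \<noteq> 0" "thD L 0 \<noteq> 0"
proof -
  show "thN L 0 \<noteq> 0"
    unfolding thN_eq_0 using plat_iff[of "L / 2" 0 L] L int_double_neq_1 by (auto simp: field_simps)
  show "thC L 0 \<noteq> 0"
    using plat_iff[of 0 pi L] int_double_neq_1
    by (auto simp: thC_def sig_eq_0_iff[OF L] mult.commute field_simps)
  show "thD L 0 \<noteq> 0"
    using plat_iff[of "L / 2" pi L] L int_double_neq_1
    by (auto simp: thD_def thN_eq_0 add.commute mult.commute field_simps)
qed

lemma thC_even: "thC L (- u) = thC L u"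
proof -
  have "sig L (- u + of_real pi * \<i>) = - sig L (u - of_real pi * \<i>)"
    using sig_odd[OF L, of "u - of_real pi * \<i>"] by simp
  then show ?thesis by (simp only: thC_def sig_pii minus_minus)
qed

lemma thC_shift_imag: "thC L (u + of_real (2 * pi) * \<i>) = - thC L u"
proof -
  have e: "u + of_real (2 * pi) * \<i> + of_real pi * \<i> = u + of_real pi * \<i> + of_real (2 * pi) * \<i>"
    by (simp add: algebra_simps)
  show ?thesis unfolding thC_def e sig_shift2[OF L] by simp
qed

lemma thC_shift_real: "thC L (u + of_real L) = exp (u + of_real L / 2) * thC L u"
proof -
  have e: "u + of_real L + of_real pi * \<i> = u + of_real pi * \<i> + of_real L"
    "u + of_real pi * \<i> + of_real L / 2 = u + of_real L / 2 + of_real pi * \<i>"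
    by (simp_all add: algebra_simps)
  show ?thesis unfolding thC_def e(1) sig_shift[OF L] e(2) exp_pii[OF L] by simp
qed

lemma thC_cnj: "thC L (cnj u) = cnj (thC L u)"
proof -
  have "cnj (thC L u) = \<i> * sig L (cnj u - of_real pi * \<i>)"
    using sig_cnj[OF L, of "u + of_real pi * \<i>"] by (simp add: thC_def)
  then show ?thesis by (simp add: thC_def sig_pii)
qed

lemma thN_cnj: "thN L (cnj u) = cnj (thN L u)"
proof -
  have "exp (- cnj u / 2) = cnj (exp (- u / 2))" by (simp add: exp_cnj)
  then show ?thesis using sig_cnj[OF L, of "u + of_real (L / 2)"] by (simp add: thN_def)
qed

lemma thN_pii: "thN L (u - of_real pi * \<i>) = thN L (u + of_real pi * \<i>)"
proof -
  have e: "u - of_real pi * \<i> + of_real (2 * pi) * \<i> = u + of_real pi * \<i>" by (simp add: algebra_simps)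
  show ?thesis using thN_shift_imag[of "u - of_real pi * \<i>"] unfolding e by simp
qed

lemma thD_cnj: "thD L (cnj u) = cnj (thD L u)"
  using thN_cnj[of "u + of_real pi * \<i>"] thN_pii[of "cnj u"] by (simp add: thD_def)

lemma thD_even: "thD L (- u) = thD L u"
  using thN_even[of "u - of_real pi * \<i>"] thN_pii[of u] by (simp add: thD_def)

lemma thD_shift_imag: "thD L (u + of_real (2 * pi) * \<i>) = thD L u"
proof -
  have e: "u + of_real (2 * pi) * \<i> + of_real pi * \<i> = u + of_real pi * \<i> + of_real (2 * pi) * \<i>"
    by (simp add: algebra_simps)
  show ?thesis unfolding thD_def e thN_shift_imag ..
qed

lemma thD_shift_real: "thD L (u + of_real L) = exp (u + of_real L / 2) * thD L u"
proof -
  have e: "u + of_real L + of_real pi * \<i> = u + of_real pi * \<i> + of_real L"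
    "u + of_real pi * \<i> + of_real L / 2 = u + of_real L / 2 + of_real pi * \<i>"
    by (simp_all add: algebra_simps)
  show ?thesis unfolding thD_def e(1) thN_shift_real e(2) exp_pii[OF L] by simp
qed

lemma sig_pii_sq: "(sig L (u + of_real pi * \<i>))\<^sup>2 = - (thC L u)\<^sup>2"
  by (simp add: thC_def power_mult_distrib)

text \<open>The three-term relation with \<open>v\<close> the imaginary half period;
  \<open>thD_rel\<close> takes the sum of both half periods instead.\<close>

lemma thC_rel: "(thN L 0)\<^sup>2 * (thC L u)\<^sup>2 = (thD L 0)\<^sup>2 * (sig L u)\<^sup>2 + (thC L 0)\<^sup>2 * (thN L u)\<^sup>2"
proof -
  have "sig L (u - of_real pi * \<i>) * sig L (u + of_real pi * \<i>) = (thC L u)\<^sup>2"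
    using sig_pii_sq[of u] by (simp add: sig_pii power2_eq_square)
  moreover have "(sig L (of_real pi * \<i>))\<^sup>2 = - (thC L 0)\<^sup>2" using sig_pii_sq[of 0] by simp
  moreover have "thN L (of_real pi * \<i>) = thD L 0" by (simp add: thD_def)
  ultimately show ?thesis using sig_three_term[of u "of_real pi * \<i>"] by simp
qed

lemma thD_0: "thD L 0 = thC L (of_real (L / 2))"
proof -
  have "exp (- (of_real pi * \<i>) / 2) = - \<i>"
    by (simp add: complex_eq_iff Re_exp Im_exp)
  then show ?thesis by (simp add: thD_def thN_def thC_def add.commute)
qed

lemma thD_rel: "(thN L 0)\<^sup>2 * (thD L u)\<^sup>2
   = (thD L (of_real (L / 2)))\<^sup>2 * (sig L u)\<^sup>2 + (thD L 0)\<^sup>2 * (thN L u)\<^sup>2"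
proof -
  let ?w = "of_real (L / 2) :: complex" and ?p = "of_real pi * \<i>"
  have "sig L (u - (?w + ?p)) * sig L (u + (?w + ?p)) = (thD L u)\<^sup>2"
  proof -
    have "sig L (u - (?w + ?p)) = - sig L (u + ?p - ?w)"
      using sig_pii[of "u - ?w"] by (simp add: algebra_simps)
    moreover have "u + (?w + ?p) = u + ?p + ?w" by simp
    ultimately show ?thesis by (simp only: thD_def thN_sq mult_minus_left)
  qed
  moreover have "(sig L (?w + ?p))\<^sup>2 = - (thD L 0)\<^sup>2"
    using sig_pii_sq[of ?w] unfolding thD_0 .
  moreover have "thN L (?w + ?p) = thD L ?w" by (simp add: thD_def)
  ultimately show ?thesis using sig_three_term[of u "?w + ?p"] by simp
qed

text \<open>A form of Jacobi's relation between the fourth powers of the theta constants, obtained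
  from \<open>thD_rel\<close> at the imaginary half period.\<close>

lemma thD_modulus: "(thD L (of_real (L / 2)))\<^sup>2 * (thC L 0)\<^sup>2 = (thD L 0) ^ 4 - (thN L 0) ^ 4"
proof -
  have "thD L (of_real pi * \<i>) = thN L 0"
    using thN_shift_imag[of 0] by (simp add: thD_def algebra_simps)
  moreover have "(sig L (of_real pi * \<i>))\<^sup>2 = - (thC L 0)\<^sup>2" using sig_pii_sq[of 0] by simp
  moreover have "thN L (of_real pi * \<i>) = thD L 0" by (simp add: thD_def)
  ultimately have "(thN L 0)\<^sup>2 * (thN L 0)\<^sup>2
      = - ((thD L (of_real (L / 2)))\<^sup>2 * (thC L 0)\<^sup>2) + (thD L 0)\<^sup>2 * (thD L 0)\<^sup>2"
    using thD_rel[of "of_real pi * \<i>"] by simp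
  then show ?thesis by (simp add: power4_eq_xxxx power2_eq_square algebra_simps)
qed

end

lemma theta_functions_exist:
  assumes k2: "0 < k2" "k2 < 1"
  shows "\<exists>L s c d n. theta_functions L k2 s c d n"
proof -
  \<comment> \<open>The ratio of q-products gives \<open>N 0 / D 0 = \<kappa>\<^sup>2\<close>, and
    \<open>thD_modulus\<close> contains the fourth powers of \<open>N 0\<close> and
    \<open>D 0\<close>: hence the eighth root.\<close>
  define \<kappa> where "\<kappa> = root 8 (1 - k2)"
  have "0 < \<kappa>" "\<kappa> < 1" "\<kappa> ^ 8 = 1 - k2"
    using k2 by (auto simp: \<kappa>_def)
  then obtain r where r: "0 < r" "r < 1" "qprod (r\<^sup>2) r = \<kappa> * qprod (r\<^sup>2) (- r)"
    using qprod_ratio_surj by blast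
  \<comment> \<open>Chosen so that \<open>exp (- L / 2) = r\<close>; the products at
    \<open>r\<close> and \<open>- r\<close> then appear in the theta constants.\<close>
  define L where "L = - 2 * ln r"
  have L: "L > 0" using r by (simp add: L_def)
  have eL: "exp (- L) = r\<^sup>2" and eL2: "exp (- (L / 2)) = r"
  proof -
    show *: "exp (- (L / 2)) = r" using r by (simp add: L_def)
    have "exp (- L) = exp (- (L / 2)) * exp (- (L / 2))" by (simp add: exp_add[symmetric])
    then show "exp (- L) = r\<^sup>2" by (simp add: * power2_eq_square)
  qed
  define Q where "Q = (qprod (exp (- L)) :: complex \<Rightarrow> complex)"
  let ?w = "of_real (L / 2) :: complex" and ?r = "of_real r :: complex"
  have Q: "Q x = (1 - x) * Q (?r\<^sup>2 * x)" for x
    unfolding Q_def by (subst qrec[OF L]) (simp add: eL)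
  have Qr: "Q ?r = of_real \<kappa> * Q (- ?r)"
    using r(3) qprod_of_real[OF nome[OF L], of r] qprod_of_real[OF nome[OF L], of "- r"]
    by (simp add: Q_def eL)
  have ew: "exp ?w = inverse ?r" and ew3: "exp (- of_real L - ?w) = ?r\<^sup>2 * ?r"
  proof -
    have "exp (of_real (- (L / 2))) = ?r" unfolding exp_of_real eL2 ..
    then have *: "exp (- ?w) = ?r" by simp
    then show "exp ?w = inverse ?r" using exp_minus[of "- ?w"] by simp
    have "- of_real L - ?w = - ?w + - ?w + - ?w" by simp
    then show "exp (- of_real L - ?w) = ?r\<^sup>2 * ?r"
      by (simp only: exp_add * power2_eq_square)
  qed
  have r0: "?r \<noteq> 0" "?r \<noteq> 1" "?r \<noteq> - 1" "1 + ?r \<noteq> 0"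
  proof -
    show "?r \<noteq> 0" "?r \<noteq> 1" using r by auto
    have "of_real (1 + r) \<noteq> (0::complex)" using r by (simp del: of_real_add)
    then show "1 + ?r \<noteq> 0" by simp
    then show "?r \<noteq> - 1" by (metis add.right_inverse)
  qed
  have Qinv: "Q (inverse ?r) = (1 - inverse ?r) * Q ?r" "Q (- inverse ?r) = (1 + inverse ?r) * Q (- ?r)"
  proof -
    have "?r\<^sup>2 * inverse ?r = ?r" "?r\<^sup>2 * - inverse ?r = - ?r"
      using r0(1) by (simp_all add: power2_eq_square mult.assoc)
    then show "Q (inverse ?r) = (1 - inverse ?r) * Q ?r" "Q (- inverse ?r) = (1 + inverse ?r) * Q (- ?r)"
      using Q[of "inverse ?r"] Q[of "- inverse ?r"] by simp_all
  qed
  define S C D N where "S = sig L" and "C = thC L" and "D = thD L" and "N = thN L"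
  define e where "e = exp (- ?w / 2)"
  have N0: "N 0 * (1 - ?r) = - e * (1 - inverse ?r) * (Q ?r)\<^sup>2"
  proof -
    have "N 0 = - e * (Q (inverse ?r) * Q (?r\<^sup>2 * ?r))"
    proof -
      have "N 0 = sig L ?w" by (simp add: N_def thN_def)
      also have "\<dots> = - e * (Q (exp ?w) * Q (exp (- of_real L - ?w)))"
        unfolding e_def Q_def by (rule sig_def)
      finally show ?thesis unfolding ew ew3 .
    qed
    then show ?thesis using Q[of ?r] Qinv(1) by (simp add: power2_eq_square mult_ac)
  qed
  have D0: "D 0 * (1 + ?r) = e * (1 + inverse ?r) * (Q (- ?r))\<^sup>2"
  proof -
    have e1: "exp (- (of_real pi * \<i>) / 2) = - \<i>" by (simp add: complex_eq_iff Re_exp Im_exp)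
    have e2: "exp (- (of_real pi * \<i> + ?w) / 2) = - \<i> * e"
    proof -
      have "- (of_real pi * \<i> + ?w) / 2 = - (of_real pi * \<i>) / 2 + - ?w / 2" by (simp add: field_simps)
      then show ?thesis by (simp only: exp_add e1 e_def)
    qed
    have e3: "exp (of_real pi * \<i> + ?w) = - inverse ?r"
      using exp_pii[OF L, of ?w] ew by (simp add: add.commute)
    have e4: "exp (- of_real L - (of_real pi * \<i> + ?w)) = - (?r\<^sup>2 * ?r)"
    proof -
      have "exp (- of_real L - (of_real pi * \<i> + ?w) + of_real pi * \<i>) = ?r\<^sup>2 * ?r"
        using ew3 by (simp add: algebra_simps)
      then show ?thesis unfolding exp_pii[OF L] by (metis minus_minus)
    qed
    have "D 0 = exp (- (of_real pi * \<i>) / 2) * sig L (of_real pi * \<i> + ?w)"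
      by (simp add: D_def thD_def thN_def)
    also have "\<dots> = - \<i> * (- (- \<i> * e) * (Q (- inverse ?r) * Q (- (?r\<^sup>2 * ?r))))"
      unfolding e1 sig_def e2 e3 e4 Q_def ..
    also have "\<dots> = e * (Q (- inverse ?r) * Q (- (?r\<^sup>2 * ?r)))" by (simp flip: mult.assoc)
    finally show ?thesis using Q[of "- ?r"] Qinv(2) by (simp add: power2_eq_square mult_ac)
  qed
  have ND: "N 0 = of_real (\<kappa>\<^sup>2) * D 0"
  proof -
    have "N 0 * ?r = e * (Q ?r)\<^sup>2"
    proof -
      have "(N 0 * ?r) * (1 - ?r) = ?r * (N 0 * (1 - ?r))" by simp
      also have "\<dots> = (e * (Q ?r)\<^sup>2) * (1 - ?r)"
        unfolding N0 using r0(1) by (simp add: algebra_simps)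
      finally show ?thesis using r0(2) by simp
    qed
    moreover have "D 0 * ?r = e * (Q (- ?r))\<^sup>2"
    proof -
      have "(D 0 * ?r) * (1 + ?r) = ?r * (D 0 * (1 + ?r))" by simp
      also have "\<dots> = (e * (Q (- ?r))\<^sup>2) * (1 + ?r)"
        unfolding D0 using r0(1) by (simp add: algebra_simps)
      finally show ?thesis using r0(4) by simp
    qed
    ultimately have "N 0 * ?r = of_real (\<kappa>\<^sup>2) * D 0 * ?r"
      unfolding Qr by (simp add: power_mult_distrib)
    then show ?thesis using r0(1) by simp
  qed
  note hp = half_periods[OF L, folded N_def C_def D_def]
  have "(D ?w)\<^sup>2 * (C 0)\<^sup>2 = of_real k2 * (D 0) ^ 4"
  proof -
    have "(N 0) ^ 4 = of_real (\<kappa> ^ 8) * (D 0) ^ 4"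
      unfolding ND by (simp add: power_mult_distrib power_mult[symmetric])
    then show ?thesis
      using thD_modulus[OF L, folded N_def C_def D_def] \<open>\<kappa> ^ 8 = 1 - k2\<close>
      by (simp add: left_diff_distrib)
  qed
  then have k2D: "(D ?w)\<^sup>2 / (D 0)\<^sup>2 = of_real k2 * (D 0 / C 0)\<^sup>2"
    using hp by (simp add: field_simps power2_eq_square power4_eq_xxxx)
  have real0: "cnj (N 0) = N 0" "cnj (C 0) = C 0" "cnj (D 0) = D 0"
    using thN_cnj[OF L, of 0] thC_cnj[OF L, of 0] thD_cnj[OF L, of 0]
    by (simp_all add: N_def C_def D_def)
  have fib: "u - v \<in> plat L \<or> u + v \<in> plat L" if "(S u)\<^sup>2 * (N v)\<^sup>2 = (S v)\<^sup>2 * (N u)\<^sup>2" for u v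
  proof -
    have "(N 0)\<^sup>2 * (S (u - v) * S (u + v)) = 0"
      using sig_three_term[OF L, of u v] that by (simp add: S_def N_def mult.commute)
    then show ?thesis using hp(1) by (simp add: S_def sig_eq_0_iff[OF L])
  qed
  have two: "2 * v \<in> plat L" if "v + a \<in> plat L" "2 * a \<in> plat L" for v a
    using lattice_of_diff[OF lattice_of_add[OF that(1,1)] that(2)] by (simp add: algebra_simps)
  have half: "2 * (of_real (L / 2)) \<in> plat L" "2 * (of_real pi * \<i>) \<in> plat L"
    "2 * (of_real pi * \<i> + of_real (L / 2)) \<in> plat L"
    using plat_iff[of L 0 L] plat_iff[of 0 "2 * pi" L] plat_iff[of L "2 * pi" L]
    by (auto simp: algebra_simps)
  have zer: "2 * v \<in> plat L" if "S v = 0 \<or> C v = 0 \<or> D v = 0 \<or> N v = 0" for v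
    using that
  proof (elim disjE)
    assume "S v = 0" then show ?thesis using two[of v 0] by (simp add: S_def sig_eq_0_iff[OF L])
  next
    assume "C v = 0" then show ?thesis using two[OF _ half(2), of v] by (simp add: C_def thC_def sig_eq_0_iff[OF L])
  next
    assume "D v = 0"
    then have "v + of_real pi * \<i> + of_real (L / 2) \<in> plat L"
      by (simp only: D_def thD_def thN_eq_0[OF L])
    then show ?thesis using two[OF _ half(3), of v] by (simp only: add.assoc)
  next
    assume "N v = 0" then show ?thesis using two[OF _ half(1), of v] by (simp only: N_def thN_eq_0[OF L])
  qed
  have nc: "S v \<noteq> 0 \<or> N v \<noteq> 0" for v
  proof (rule ccontr)
    assume "\<not> (S v \<noteq> 0 \<or> N v \<noteq> 0)"
    then have "v \<in> plat L" "v + of_real (L / 2) \<in> plat L"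
      by (simp_all only: S_def N_def thN_eq_0[OF L] sig_eq_0_iff[OF L] not_not de_Morgan_disj)
    then have "of_real (L / 2) \<in> plat L" using lattice_of_diff by (metis add_diff_cancel_left')
    then show False using hp(1) by (simp add: N_def thN_eq_0[OF L])
  qed
  have Sh: "S holomorphic_on UNIV" "N holomorphic_on UNIV"
    unfolding S_def N_def by (rule sig_holomorphic[OF L] thN_holomorphic[OF L])+
  have Nw: "N ?w = 0"
    unfolding N_def thN_eq_0[OF L] using plat_iff[of L 0 L] by (auto simp: algebra_simps)
  \<comment> \<open>Without a solution,
    \<open>(N u)\<^sup>2 / (y * (S u)\<^sup>2 - x * (N u)\<^sup>2)\<close> would be entire and
    doubly periodic, hence constant; but it vanishes at \<open>L / 2\<close> and not at 0.\<close>
  have sur: "\<exists>u. y * (S u)\<^sup>2 = x * (N u)\<^sup>2" if xy: "(x, y) \<noteq> (0, 0)" for x y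
  proof (rule ccontr)
    assume "\<nexists>u. y * (S u)\<^sup>2 = x * (N u)\<^sup>2"
    then have nz: "y * (S u)\<^sup>2 - x * (N u)\<^sup>2 \<noteq> 0" for u by auto
    define q where "q = (\<lambda>u. (N u)\<^sup>2 / (y * (S u)\<^sup>2 - x * (N u)\<^sup>2))"
    have "q holomorphic_on UNIV" unfolding q_def using nz by (intro holomorphic_intros Sh) auto
    moreover have "q (u + of_real L) = q u" for u
    proof -
      define E where "E = (exp (u + of_real L / 2))\<^sup>2"
      have "(S (u + of_real L))\<^sup>2 = E * (S u)\<^sup>2" "(N (u + of_real L))\<^sup>2 = E * (N u)\<^sup>2"
        by (simp_all add: E_def S_def N_def sig_shift[OF L] thN_shift_real[OF L] power_mult_distrib)
      then have "q (u + of_real L) = (E * (N u)\<^sup>2) / (E * (y * (S u)\<^sup>2 - x * (N u)\<^sup>2))"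
        unfolding q_def by (simp add: algebra_simps)
      then show ?thesis by (simp add: q_def E_def)
    qed
    moreover have "q (u + of_real (2 * pi) * \<i>) = q u" for u
      unfolding q_def S_def N_def sig_shift2[OF L] thN_shift_imag[OF L] by simp
    ultimately have qh: "q holomorphic_on UNIV" and per: "q (u + l) = q u" if "l \<in> plat L" for u l
      using plat_invariant[of q L l u] that by blast+
    have "\<exists>k. \<forall>u. q u = k"
      by (rule lattice_periodic_constant[OF qh _ per, of "0::complex"]) (use L in auto)
    then obtain k where k: "\<And>u. q u = k" by blast
    have "k = 0" using k[of ?w] unfolding q_def Nw by simp
    moreover have "q 0 \<noteq> 0" using hp(1) nz[of 0] by (simp add: q_def)
    ultimately show False using k by simp
  qed
  \<comment> \<open>The constants by which Jacobi normalizes theta quotients to sn, cn and dn over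
    the denominator \<open>N\<close>. For real \<open>v\<close> the classical argument is imaginary,
    and the imaginary transformation puts \<open>N\<close> in the place of cn and \<open>c\<close>
    in that of 1.\<close>
  define s c d n where "s = (\<lambda>v. D 0 / C 0 * S v)" and "c = (\<lambda>v. N 0 / C 0 * C v)"
    and "d = (\<lambda>v. N 0 / D 0 * D v)" and "n = N"
  have "theta_functions L k2 s c d n"
  proof
    show "L > 0" by (rule L)
    show "s holomorphic_on UNIV" "c holomorphic_on UNIV" "d holomorphic_on UNIV" "n holomorphic_on UNIV"
      unfolding s_def c_def d_def n_def using Sh thC_holomorphic[OF L] thD_holomorphic[OF L]
      by (auto simp: C_def D_def intro!: holomorphic_intros)
    show "s (cnj v) = cnj (s v)" "c (cnj v) = cnj (c v)" "d (cnj v) = cnj (d v)" "n (cnj v) = cnj (n v)" for v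
      using sig_cnj[OF L] thC_cnj[OF L] thD_cnj[OF L] thN_cnj[OF L]
      by (simp_all add: s_def c_def d_def n_def real0) (simp_all add: S_def C_def D_def N_def)
    show "(c v)\<^sup>2 = (n v)\<^sup>2 + (s v)\<^sup>2" for v
      using thC_rel[OF L, of v, folded N_def C_def D_def S_def] hp
      by (simp add: s_def c_def n_def field_simps power_mult_distrib)
    show "(d v)\<^sup>2 = (n v)\<^sup>2 + of_real k2 * (s v)\<^sup>2" for v
    proof -
      have "(d v)\<^sup>2 = ((N 0)\<^sup>2 * (D v)\<^sup>2) / (D 0)\<^sup>2"
        by (simp add: d_def power_mult_distrib power_divide)
      also have "\<dots> = (D ?w)\<^sup>2 / (D 0)\<^sup>2 * (S v)\<^sup>2 + (N v)\<^sup>2"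
        using thD_rel[OF L, of v, folded N_def C_def D_def S_def] hp by (simp add: field_simps)
      finally show ?thesis unfolding k2D by (simp add: s_def n_def power_mult_distrib power_divide)
    qed
    show "s (- v) = - s v" "c (- v) = c v" "d (- v) = d v" "n (- v) = n v" for v
      using sig_odd[OF L] thC_even[OF L] thD_even[OF L] thN_even[OF L]
      by (simp_all add: s_def c_def d_def n_def S_def C_def D_def N_def)
    show "s (v + of_real (2 * pi) * \<i>) = - s v" "c (v + of_real (2 * pi) * \<i>) = - c v"
      "d (v + of_real (2 * pi) * \<i>) = d v" "n (v + of_real (2 * pi) * \<i>) = n v" for v
      using sig_shift2[OF L, of v] thC_shift_imag[OF L, of v] thD_shift_imag[OF L, of v] thN_shift_imag[OF L, of v]
      by (simp_all add: s_def c_def d_def n_def S_def C_def D_def N_def)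
    show "s (v + of_real L) = - exp (v + of_real L / 2) * s v" "c (v + of_real L) = exp (v + of_real L / 2) * c v"
      "d (v + of_real L) = exp (v + of_real L / 2) * d v" "n (v + of_real L) = - exp (v + of_real L / 2) * n v" for v
      using sig_shift[OF L, of v] thC_shift_real[OF L, of v] thD_shift_real[OF L, of v] thN_shift_real[OF L, of v]
      by (simp_all add: s_def c_def d_def n_def S_def C_def D_def N_def)
    show "u - v \<in> plat L \<or> u + v \<in> plat L" if "(s u)\<^sup>2 * (n v)\<^sup>2 = (s v)\<^sup>2 * (n u)\<^sup>2" for u v
      using that hp by (intro fib) (simp add: s_def n_def power_mult_distrib power_divide)
    show "2 * v \<in> plat L" if "s v * c v * d v * n v = 0" for v
      using that hp by (intro zer) (auto simp: s_def c_def d_def n_def)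
    show "s v \<noteq> 0 \<or> n v \<noteq> 0" for v
      using nc[of v] hp by (simp add: s_def n_def)
    show "\<exists>u. y * (s u)\<^sup>2 = x * (n u)\<^sup>2" if "(x, y) \<noteq> (0, 0)" for x y
      using sur[of x "y * (D 0 / C 0)\<^sup>2"] that hp
      by (simp add: s_def n_def power_mult_distrib power_divide mult.assoc)
  qed
  then show ?thesis by blast
qed

section \<open>The elliptic parametrization\<close>

definition vec4 :: "'a \<Rightarrow> 'a \<Rightarrow> 'a \<Rightarrow> 'a \<Rightarrow> 'a ^ 4" where
  "vec4 p q r t = (\<chi> i. if i = 1 then p else if i = 2 then q else if i = 3 then r else t)"

lemma vec4_nth [simp]: "vec4 p q r t $ 1 = p" "vec4 p q r t $ 2 = q" "vec4 p q r t $ 3 = r" "vec4 p q r t $ 4 = t"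
  by (simp_all add: vec4_def)

lemma vec_eq_4: "P = R \<longleftrightarrow> P $ 1 = R $ 1 \<and> P $ 2 = R $ 2 \<and> P $ 3 = R $ 3 \<and> P $ (4::4) = R $ 4"
  by (simp add: vec_eq_iff forall_4)

lemma numerals_4: "(1::4) + 1 = 2" "(1::4) + 2 = 3" "(1::4) + 3 = 4" "(2::4) + 1 = 3" "(2::4) + 2 = 4" "(2::4) + 3 = 1"
    "(3::4) + 1 = 4" "(3::4) + 2 = 1" "(3::4) + 3 = 2" "(4::4) + 1 = 1" "(4::4) + 2 = 2" "(4::4) + 3 = 3"
    "(5::4) = 1" "(6::4) = 2" "(7::4) = 3"
  by simp_all

lemma quad_forms:
  fixes b :: "real^4" and x y :: "complex^4"
  defines "s \<equiv> complex_of_real (half_perimeter b)"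
  shows "adjacent_form b 1 x y = adj_form s (b$1) (b$2) (b$3) (b$4) (x$1) (y$1) (x$2) (y$2)"
   "adjacent_form b 2 x y = adj_form s (b$2) (b$3) (b$4) (b$1) (x$2) (y$2) (x$3) (y$3)"
   "adjacent_form b 3 x y = adj_form s (b$3) (b$4) (b$1) (b$2) (x$3) (y$3) (x$4) (y$4)"
   "adjacent_form b 4 x y = adj_form s (b$4) (b$1) (b$2) (b$3) (x$4) (y$4) (x$1) (y$1)"
   "opposite_form b 1 x y = opp_form s (b$1) (b$2) (b$3) (b$4) (x$1) (y$1) (x$3) (y$3)"
   "opposite_form b 2 x y = opp_form s (b$2) (b$3) (b$4) (b$1) (x$2) (y$2) (x$4) (y$4)"
  by (simp_all add: adjacent_form_def adj_form_def opposite_form_def opp_form_def bar_def Let_def s_def numerals_4)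

lemma Qor_set_iff:
  "P \<in> Qor_set b \<longleftrightarrow> (\<exists>x y. (x, y) \<in> hom_coords \<and> P = hom_proj (x, y) \<and>
     adjacent_form b 1 x y = 0 \<and> adjacent_form b 2 x y = 0 \<and> adjacent_form b 3 x y = 0 \<and> adjacent_form b 4 x y = 0 \<and>
     opposite_form b 1 x y = 0 \<and> opposite_form b 2 x y = 0)"
  unfolding Qor_set_def by (auto simp: forall_4)

text \<open>A signed sum of the sides with two minus signs vanishes exactly when two sides add up to
  the half-perimeter; with one or three minus signs, if a side equals the half-perimeter.\<close>

definition nondegenerate :: "real ^ 4 \<Rightarrow> bool" where
  "nondegenerate b \<longleftrightarrow> (\<forall>i. 0 < b $ i \<and> b $ i < half_perimeter b) \<and>
     (\<forall>i j. i \<noteq> j \<longrightarrow> b $ i + b $ j \<noteq> half_perimeter b)"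

lemma half_perimeter_eq: "half_perimeter b = (b$1 + b$2 + b$3 + b$4) / 2"
  by (simp add: half_perimeter_def sum_4)

lemma nondegenerate_complex:
  assumes "nondegenerate b"
  shows "complex_of_real (half_perimeter b) \<noteq> 0" "complex_of_real (b $ i) \<noteq> 0"
    "complex_of_real (half_perimeter b) - complex_of_real (b $ i) \<noteq> 0"
    "i \<noteq> j \<Longrightarrow> complex_of_real (half_perimeter b) - complex_of_real (b $ i) - complex_of_real (b $ j) \<noteq> 0"
proof -
  note nd = assms[unfolded nondegenerate_def]
  have pos: "0 < b $ i" for i using nd by blast
  show "complex_of_real (half_perimeter b) \<noteq> 0"
    using pos[of 1] pos[of 2] pos[of 3] pos[of 4] by (simp add: half_perimeter_eq del: of_real_add)
  show "complex_of_real (b $ i) \<noteq> 0" using pos[of i] by simp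
  have "b $ i < half_perimeter b" using nd by blast
  then have "half_perimeter b - b $ i \<noteq> 0" by simp
  then show "complex_of_real (half_perimeter b) - complex_of_real (b $ i) \<noteq> 0"
    by (metis of_real_diff of_real_eq_0_iff)
  assume "i \<noteq> j"
  then have "b $ i + b $ j \<noteq> half_perimeter b" using nd by blast
  then have "half_perimeter b - b $ i - b $ j \<noteq> 0" by linarith
  then show "complex_of_real (half_perimeter b) - complex_of_real (b $ i) - complex_of_real (b $ j) \<noteq> 0"
    by (metis of_real_diff of_real_eq_0_iff)
qed

lemma adj_form_swap: "adj_form s a1 a2 a3 a4 x y x' y' = adj_form s a1 a4 a3 a2 x' y' x y"
  unfolding adj_form_def by algebra

lemma adj_form_scale:
  "adj_form s a1 a2 a3 a4 x y (t * x') (t * y') = t\<^sup>2 * adj_form s a1 a2 a3 a4 x y x' y'"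
  "adj_form s a1 a2 a3 a4 (t * x) (t * y) x' y' = t\<^sup>2 * adj_form s a1 a2 a3 a4 x y x' y'"
  unfolding adj_form_def by algebra+

lemma opp_form_swap:
  assumes "2 * s = a1 + a2 + a3 + (a4::complex)"
  shows "opp_form s a2 a1 a4 a3 x' y' x y = - opp_form s a1 a2 a3 a4 x y x' y'"
proof -
  have a4: "a4 = 2 * s - a1 - a2 - a3" using assms by (simp add: algebra_simps)
  show ?thesis unfolding opp_form_def a4 by algebra
qed

lemma abs_cp1_eqD:
  assumes "abs_cp1 (x, y) = abs_cp1 (x', y')" "(x, y) \<noteq> (0, 0)" "(x', y') \<noteq> (0, 0)"
  shows "\<exists>t. t \<noteq> 0 \<and> x' = t * x \<and> y' = t * y"
  using cp1_rel_scale[of x y x' y'] abs_cp1_eq_iff[OF assms(2,3)] assms by (simp add: cp1_rel_def)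

lemma cp1_neg_abs: "(x, y) \<noteq> (0, 0) \<Longrightarrow> cp1_neg (abs_cp1 (x, y)) = abs_cp1 (- x, y)"
  using cp1_neg.abs_eq[of "(x, y)"] by (simp add: eq_onp_def cp1_rel_refl_iff)

lemma cp1_cnj_abs: "(x, y) \<noteq> (0, 0) \<Longrightarrow> cp1_cnj (abs_cp1 (x, y)) = abs_cp1 (cnj x, cnj y)"
  using cp1_cnj.abs_eq[of "(x, y)"] by (simp add: eq_onp_def cp1_rel_refl_iff)

lemma cp1_neg_neg [simp]: "cp1_neg (cp1_neg z) = z"
proof -
  obtain x y where "z = abs_cp1 (x, y)" "(x, y) \<noteq> (0, 0)" by (rule cp1_cases)
  then show ?thesis using cp1_neg_abs[of x y] cp1_neg_abs[of "- x" y] by simp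
qed

lemma neg4_neg4 [simp]: "neg4 (neg4 P) = P"
  by (simp add: neg4_def vec_eq_iff)

lemma unoriented_eq_iff: "unoriented P = unoriented P' \<longleftrightarrow> P = P' \<or> P = neg4 P'"
  unfolding unoriented_def by (auto simp: doubleton_eq_iff)

context quad_algebra
begin

text \<open>The determinant of the two linear expressions in \<open>F\<^sup>2\<close> and
  \<open>G\<^sup>2\<close> that define \<open>H\<^sup>2\<close> and \<open>K\<^sup>2\<close>. Being
  nonzero, it keeps the zeros of \<open>H\<close> and \<open>K\<close> apart; being positive for
  actual side lengths, it will bound the modulus by 1.\<close>

lemma det: "(s - a1) * (s - a2) * ((s - a3) * (s - a4)) + s * (s - a3 - a4) * ((s - a1 - a4) * (s - a1 - a3)) = a1 * a2 * a3 * a4"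
  unfolding a4 by algebra

lemma HK_nonzero:
  assumes FG: "(F, G) \<noteq> (0, 0)" and "a1 \<noteq> 0" "a2 \<noteq> 0" "a3 \<noteq> 0" "a4 \<noteq> 0"
  shows "(H, K) \<noteq> (0, 0)"
proof
  assume "(H, K) = (0, 0)"
  then have h: "(s - a1) * (s - a2) * F\<^sup>2 - s * (s - a3 - a4) * G\<^sup>2 = 0"
     "(s - a1 - a4) * (s - a1 - a3) * F\<^sup>2 + (s - a3) * (s - a4) * G\<^sup>2 = 0"
    using H K by auto
  have "a1 * a2 * a3 * a4 * F\<^sup>2 = 0" "a1 * a2 * a3 * a4 * G\<^sup>2 = 0"
    using h unfolding det[symmetric] by algebra+
  then show False using assms by simp
qed

text \<open>Where \<open>z_2\<close> and \<open>z_4\<close> are both 0 or infinite, the sign change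
  of all tangents could have a fixed point. Excluding this keeps the double cover of the
  non-oriented space unramified.\<close>

lemma FGHK_nonzero:
  assumes FG: "(F, G) \<noteq> (0, 0)"
    and nd: "s \<noteq> 0" "s - a1 \<noteq> 0" "s - a2 \<noteq> 0" "s - a3 \<noteq> 0" "s - a4 \<noteq> 0"
      "s - a1 - a3 \<noteq> 0" "s - a3 - a4 \<noteq> 0" "s - a1 - a4 \<noteq> 0"
  shows "F * G \<noteq> 0 \<or> H * K \<noteq> 0"
  using H K assms by (cases "F = 0"; cases "G = 0"; auto)

text \<open>\<open>H\<^sup>2 / K\<^sup>2\<close> is a Moebius function of
  \<open>F\<^sup>2 / G\<^sup>2\<close> with the determinant of \<open>det\<close>, so the squares of
  \<open>z_2\<close> and \<open>z_4\<close> have the same fibres.\<close>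

lemma cross_ratio:
  assumes "H'\<^sup>2 = (s - a1) * (s - a2) * F'\<^sup>2 - s * (s - a3 - a4) * G'\<^sup>2"
    and "K'\<^sup>2 = (s - a1 - a4) * (s - a1 - a3) * F'\<^sup>2 + (s - a3) * (s - a4) * G'\<^sup>2"
  shows "H\<^sup>2 * K'\<^sup>2 - H'\<^sup>2 * K\<^sup>2 = a1 * a2 * a3 * a4 * (F\<^sup>2 * G'\<^sup>2 - F'\<^sup>2 * G\<^sup>2)"
  unfolding H K assms a4 by algebra

end

section \<open>Parametrization of an oriented configuration space by the plane\<close>

text \<open>Common abstraction for a side vector and its dual. Only the quotients
  \<open>F / G\<close> and \<open>H / K\<close> matter, so periods and parity are stated by cross
  products: a period multiplies both quotients by the same sign \<open>sg m\<close>, the reflection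
  at 0 multiplies them by opposite signs. Translation by \<open>np\<close> will be the sign change
  of all tangents.\<close>

locale quad_param =
  fixes b :: "real ^ 4" and F G H K sg :: "complex \<Rightarrow> complex" and \<eta> np :: complex and L :: real
  assumes L: "L > 0" and nd: "nondegenerate b"
    and hol: "F holomorphic_on UNIV" "G holomorphic_on UNIV" "H holomorphic_on UNIV" "K holomorphic_on UNIV"
    and relH: "(H u)\<^sup>2 = of_real ((half_perimeter b - b$1) * (half_perimeter b - b$2)) * (F u)\<^sup>2
        - of_real (half_perimeter b * (half_perimeter b - b$3 - b$4)) * (G u)\<^sup>2"
    and relK: "(K u)\<^sup>2 = of_real ((half_perimeter b - b$1 - b$4) * (half_perimeter b - b$1 - b$3)) * (F u)\<^sup>2
        + of_real ((half_perimeter b - b$3) * (half_perimeter b - b$4)) * (G u)\<^sup>2"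
    and FG: "(F u, G u) \<noteq> (0, 0)"
    and period: "m \<in> plat L \<Longrightarrow> F (u + m) * G u = sg m * F u * G (u + m)"
      "m \<in> plat L \<Longrightarrow> H (u + m) * K u = sg m * H u * K (u + m)"
    and sg: "sg (m + m') = sg m * sg m'" "m \<in> plat L \<Longrightarrow> sg m = 1 \<or> sg m = - 1"
    and np: "np \<in> plat L" "sg np = - 1"
    and \<eta>: "\<eta> = 1 \<or> \<eta> = - 1"
    and reflect: "F (- u) * G u = \<eta> * F u * G (- u)" "H (- u) * K u = - \<eta> * H u * K (- u)"
    and fibre: "(F u)\<^sup>2 * (G v)\<^sup>2 = (F v)\<^sup>2 * (G u)\<^sup>2 \<Longrightarrow> u - v \<in> plat L \<or> u + v \<in> plat L"
    and zeros: "F u * G u * H u * K u = 0 \<Longrightarrow> 2 * u \<in> plat L"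
    and surj: "(x, y) \<noteq> (0, 0) \<Longrightarrow> \<exists>u. y * (F u)\<^sup>2 = x * (G u)\<^sup>2"
    and conj: "F (cnj u) = cnj (F u)" "G (cnj u) = cnj (G u)" "H (cnj u) = cnj (H u)" "K (cnj u) = cnj (K u)"
begin

abbreviation "s \<equiv> complex_of_real (half_perimeter b)"
abbreviation "b1 \<equiv> complex_of_real (b $ 1)"
abbreviation "b2 \<equiv> complex_of_real (b $ 2)"
abbreviation "b3 \<equiv> complex_of_real (b $ 3)"
abbreviation "b4 \<equiv> complex_of_real (b $ 4)"

lemma qa: "quad_algebra s b1 b2 b3 b4 (F u) (G u) (H u) (K u)"
proof
  have "2 * half_perimeter b = b$1 + b$2 + b$3 + b$4" by (simp add: half_perimeter_eq)
  then have "of_real (2 * half_perimeter b) = complex_of_real (b$1 + b$2 + b$3 + b$4)" by (simp only:)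
  then show "2 * s = b1 + b2 + b3 + b4" by simp
qed (use relH[of u] relK[of u] in simp_all)

lemma qb: "quad_algebra s b2 b1 b4 b3 (F u) (G u) (H u) (K u)"
  by (rule quad_algebra.swap[OF qa])

lemmas s2 = quad_algebra.s[OF qa]

lemma nz: "s \<noteq> 0" "b1 \<noteq> 0" "b2 \<noteq> 0" "b3 \<noteq> 0" "b4 \<noteq> 0" "s - b1 \<noteq> 0" "s - b2 \<noteq> 0" "s - b3 \<noteq> 0" "s - b4 \<noteq> 0"
  "s - b1 - b2 \<noteq> 0" "s - b1 - b3 \<noteq> 0" "s - b1 - b4 \<noteq> 0" "s - b2 - b3 \<noteq> 0" "s - b2 - b4 \<noteq> 0" "s - b3 - b4 \<noteq> 0"
  "s - b2 - b1 \<noteq> 0" "s - b3 - b1 \<noteq> 0" "s - b4 - b1 \<noteq> 0" "s - b3 - b2 \<noteq> 0" "s - b4 - b2 \<noteq> 0" "s - b4 - b3 \<noteq> 0"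
  by (rule nondegenerate_complex[OF nd]; simp)+

abbreviation "vA u x y \<equiv> quad_algebra.vertex s b1 b2 b3 b4 (F u) (G u) (H u) (K u) x y"
abbreviation "vC u x y \<equiv> quad_algebra.vertex s b2 b1 b4 b3 (F u) (G u) (H u) (K u) x y"

text \<open>\<open>k\<close> selects one of the two solutions of \<open>vertex_choice\<close>. At
  every point one of them is nonzero, and near that point the choice can be kept, which gives
  holomorphic homogeneous coordinates.\<close>

definition xA :: "bool \<Rightarrow> complex \<Rightarrow> complex" where
  "xA k u = (if k then b2 * b4 * F u * G u - H u * K u else cC s b2 b3 (F u) (G u))"
definition yA :: "bool \<Rightarrow> complex \<Rightarrow> complex" where
  "yA k u = (if k then cA s b1 b3 b4 (F u) (G u) else b2 * b4 * F u * G u + H u * K u)"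
definition xC :: "bool \<Rightarrow> complex \<Rightarrow> complex" where
  "xC k u = (if k then b1 * b3 * F u * G u - H u * K u else cC s b1 b4 (F u) (G u))"
definition yC :: "bool \<Rightarrow> complex \<Rightarrow> complex" where
  "yC k u = (if k then cA s b2 b4 b3 (F u) (G u) else b1 * b3 * F u * G u + H u * K u)"

lemma vertex_xy: "vA u (xA k u) (yA k u)" "vC u (xC k u) (yC k u)"
  using quad_algebra.vertex_choice[OF qa, of u] quad_algebra.vertex_choice[OF qb, of u]
  by (cases k; simp add: xA_def yA_def xC_def yC_def)+

lemma ex_choice: "\<exists>k. (xA k u, yA k u) \<noteq> (0, 0)" "\<exists>k. (xC k u, yC k u) \<noteq> (0, 0)"
proof -
  have "(xA True u, yA True u) \<noteq> (0, 0) \<or> (xA False u, yA False u) \<noteq> (0, 0)"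
    using quad_algebra.vertex_nonzero[OF qa FG] nz by (simp add: xA_def yA_def)
  then show "\<exists>k. (xA k u, yA k u) \<noteq> (0, 0)" by blast
  have "(xC True u, yC True u) \<noteq> (0, 0) \<or> (xC False u, yC False u) \<noteq> (0, 0)"
    using quad_algebra.vertex_nonzero[OF qb FG] nz by (simp add: xC_def yC_def)
  then show "\<exists>k. (xC k u, yC k u) \<noteq> (0, 0)" by blast
qed

lemma hol_xy: "xA k holomorphic_on UNIV" "yA k holomorphic_on UNIV" "xC k holomorphic_on UNIV" "yC k holomorphic_on UNIV"
  unfolding xA_def[abs_def] yA_def[abs_def] xC_def[abs_def] yC_def[abs_def] cA_def cC_def
  by (cases k; simp; intro holomorphic_intros hol)+

lemma vA_unique: "vA u x y \<Longrightarrow> vA u x' y' \<Longrightarrow> x * y' = x' * y"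
  by (rule quad_algebra.vertex_unique[OF qa _ _ FG]) (use nz in auto)

lemma vC_unique: "vC u x y \<Longrightarrow> vC u x' y' \<Longrightarrow> x * y' = x' * y"
  by (rule quad_algebra.vertex_unique[OF qb _ _ FG]) (use nz in auto)

definition zA :: "complex \<Rightarrow> cp1" where
  "zA u = (let k = (SOME k. (xA k u, yA k u) \<noteq> (0, 0)) in abs_cp1 (xA k u, yA k u))"
definition zC :: "complex \<Rightarrow> cp1" where
  "zC u = (let k = (SOME k. (xC k u, yC k u) \<noteq> (0, 0)) in abs_cp1 (xC k u, yC k u))"

lemma zA_eq: assumes "vA u x y" "(x, y) \<noteq> (0, 0)" shows "zA u = abs_cp1 (x, y)"
proof -
  define k where "k = (SOME k. (xA k u, yA k u) \<noteq> (0, 0))"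
  have "(xA k u, yA k u) \<noteq> (0, 0)" unfolding k_def by (rule someI_ex[OF ex_choice(1)])
  then show ?thesis
    using abs_cp1_eq_iff[of "(xA k u, yA k u)" "(x, y)"] assms vA_unique[OF vertex_xy(1) assms(1), of k]
    unfolding zA_def k_def[symmetric] Let_def by (simp add: mult.commute)
qed

lemma zC_eq: assumes "vC u x y" "(x, y) \<noteq> (0, 0)" shows "zC u = abs_cp1 (x, y)"
proof -
  define k where "k = (SOME k. (xC k u, yC k u) \<noteq> (0, 0))"
  have "(xC k u, yC k u) \<noteq> (0, 0)" unfolding k_def by (rule someI_ex[OF ex_choice(2)])
  then show ?thesis
    using abs_cp1_eq_iff[of "(xC k u, yC k u)" "(x, y)"] assms vC_unique[OF vertex_xy(2) assms(1), of k]
    unfolding zC_def k_def[symmetric] Let_def by (simp add: mult.commute)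
qed

definition \<Phi> :: "complex \<Rightarrow> cp1 ^ 4" where
  "\<Phi> u = vec4 (zA u) (abs_cp1 (F u, G u)) (zC u) (abs_cp1 (H u, K u))"

lemma HK: "(H u, K u) \<noteq> (0, 0)"
  by (rule quad_algebra.HK_nonzero[OF qa FG]) (use nz in auto)

lemma FGHK: "F u * G u \<noteq> 0 \<or> H u * K u \<noteq> 0"
  by (rule quad_algebra.FGHK_nonzero[OF qa FG]) (use nz in auto)

lemma cross_ratio: "(H u)\<^sup>2 * (K v)\<^sup>2 - (H v)\<^sup>2 * (K u)\<^sup>2 = b1 * b2 * b3 * b4 * ((F u)\<^sup>2 * (G v)\<^sup>2 - (F v)\<^sup>2 * (G u)\<^sup>2)"
  by (rule quad_algebra.cross_ratio[OF qa quad_algebra.H[OF qa] quad_algebra.K[OF qa]])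

text \<open>At a zero of \<open>F\<close> the value is \<open>(b1 + b2)\<^sup>2 * (G u) ^ 4\<close>.
  So \<open>sq_den\<close> does not vanish identically along the curve, as the identity theorem
  requires.\<close>

lemma sq_den_generic: "\<exists>u. quad_algebra.sq_den b1 b2 (F u) (G u) \<noteq> 0"
proof -
  obtain u where "1 * (F u)\<^sup>2 = 0 * (G u)\<^sup>2" using surj[of 0 1] by auto
  then have "F u = 0" "G u \<noteq> 0" using FG[of u] by auto
  moreover have "b1 + b2 \<noteq> 0"
  proof -
    have "b $ 1 + b $ 2 > 0" using nd by (simp add: nondegenerate_def add_pos_pos)
    then show ?thesis by (metis of_real_add of_real_eq_0_iff less_irrefl)
  qed
  ultimately show ?thesis
    unfolding quad_algebra.sq_den_def[OF qa] by (intro exI[of _ u]) simp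
qed

end

lemma sq_diagonal_abs:
  assumes "(x, y) \<noteq> (0, 0)" "p \<noteq> 0" "q \<noteq> 0"
  shows "sq_diagonal p q (abs_cp1 (x, y))
     = abs_cp1 (of_real ((p + q)\<^sup>2) * y\<^sup>2 + of_real ((p - q)\<^sup>2) * x\<^sup>2, y\<^sup>2 + x\<^sup>2)"
    and "(of_real ((p + q)\<^sup>2) * y\<^sup>2 + of_real ((p - q)\<^sup>2) * x\<^sup>2, y\<^sup>2 + x\<^sup>2) \<noteq> (0, 0)"
proof -
  define N where "N = (\<lambda>x y::complex. of_real ((p + q)\<^sup>2) * y\<^sup>2 + of_real ((p - q)\<^sup>2) * x\<^sup>2)"
  have N: "of_real (p\<^sup>2 + q\<^sup>2) * (y\<^sup>2 + x\<^sup>2) + of_real (2 * p * q) * (y\<^sup>2 - x\<^sup>2) = N x y" for x y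
    unfolding N_def by (simp add: power2_sum power2_diff algebra_simps)
  have nz: "(N x y, y\<^sup>2 + x\<^sup>2) \<noteq> (0, 0)" if "(x, y) \<noteq> (0, 0)" for x y
  proof
    assume "(N x y, y\<^sup>2 + x\<^sup>2) = (0, 0)"
    then have e: "N x y = 0" and 0: "y\<^sup>2 + x\<^sup>2 = 0" by auto
    have "of_real (2 * p * q) * (y\<^sup>2 - x\<^sup>2) = 0" using N[where x = x and y = y] unfolding e 0 by simp
    then have "y\<^sup>2 - x\<^sup>2 = 0" using assms by simp
    then have "2 * y\<^sup>2 = 0" "2 * x\<^sup>2 = 0" using 0 by algebra+
    then show False using that by simp
  qed
  show "(of_real ((p + q)\<^sup>2) * y\<^sup>2 + of_real ((p - q)\<^sup>2) * x\<^sup>2, y\<^sup>2 + x\<^sup>2) \<noteq> (0, 0)"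
    using nz[OF assms(1)] by (simp add: N_def)
  obtain x' y' where r: "rep_cp1 (abs_cp1 (x, y)) = (x', y')" by fastforce
  have "cp1_rel (x', y') (x', y')"
    using Quotient3_rep_reflp[OF Quotient3_cp1, of "abs_cp1 (x, y)"] unfolding r .
  then have nz': "(x', y') \<noteq> (0, 0)" using cp1_rel_refl_iff by blast
  have "abs_cp1 (x', y') = abs_cp1 (x, y)"
    using Quotient3_abs_rep[OF Quotient3_cp1, of "abs_cp1 (x, y)"] unfolding r .
  then obtain t where t: "t \<noteq> 0" "x' = t * x" "y' = t * y"
    using abs_cp1_eqD[of x y x' y'] nz' assms(1) by metis
  have "sq_diagonal p q (abs_cp1 (x, y)) = abs_cp1 (N x' y', y'\<^sup>2 + x'\<^sup>2)"
    unfolding sq_diagonal_def r prod.case N ..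
  also have "\<dots> = abs_cp1 (N x y, y\<^sup>2 + x\<^sup>2)"
    using abs_cp1_eq_iff[OF nz[OF nz'] nz[OF assms(1)]]
    by (simp add: N_def t power_mult_distrib algebra_simps)
  finally show "sq_diagonal p q (abs_cp1 (x, y))
     = abs_cp1 (of_real ((p + q)\<^sup>2) * y\<^sup>2 + of_real ((p - q)\<^sup>2) * x\<^sup>2, y\<^sup>2 + x\<^sup>2)"
    by (simp add: N_def)
qed

text \<open>A point of the projective line that equals its own negative is 0 or infinity.\<close>

lemma nonproportional_sign:
  fixes x y x' y' :: complex
  assumes "x * y' = x' * y" "x * y' = - (x' * y)" "(x, y) \<noteq> (0, 0)" "(x', y') \<noteq> (0, 0)"
  shows "x * y = 0"
proof -
  have "2 * (x * y') = 0" using assms(1,2) by algebra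
  then have "x * y' = 0" "x' * y = 0" using assms(1) by auto
  then show ?thesis using assms(3,4) by auto
qed

context quad_param
begin

lemma \<Phi>_coords:
  assumes "(xA k u, yA k u) \<noteq> (0, 0)" "(xC k' u, yC k' u) \<noteq> (0, 0)"
  shows "(vec4 (xA k u) (F u) (xC k' u) (H u), vec4 (yA k u) (G u) (yC k' u) (K u)) \<in> hom_coords"
    and "hom_proj (vec4 (xA k u) (F u) (xC k' u) (H u), vec4 (yA k u) (G u) (yC k' u) (K u)) = \<Phi> u"
proof -
  show "(vec4 (xA k u) (F u) (xC k' u) (H u), vec4 (yA k u) (G u) (yC k' u) (K u)) \<in> hom_coords"
    unfolding hom_coords_iff forall_4 using assms FG[of u] HK[of u] by simp
  show "hom_proj (vec4 (xA k u) (F u) (xC k' u) (H u), vec4 (yA k u) (G u) (yC k' u) (K u)) = \<Phi> u"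
    unfolding vec_eq_4 hom_proj_nth \<Phi>_def
    using zA_eq[OF vertex_xy(1) assms(1)] zC_eq[OF vertex_xy(2) assms(2)] by simp
qed

lemma \<Phi>_lifts: "holomorphic_lifts \<Phi>"
  unfolding holomorphic_lifts_def
proof
  fix u0
  obtain k k' where k: "(xA k u0, yA k u0) \<noteq> (0, 0)" "(xC k' u0, yC k' u0) \<noteq> (0, 0)"
    using ex_choice by metis
  have c: "continuous_on UNIV (xA k)" "continuous_on UNIV (yA k)" "continuous_on UNIV (xC k')" "continuous_on UNIV (yC k')"
    by (intro holomorphic_on_imp_continuous_on hol_xy)+
  have "open ({u. xA k u \<noteq> 0} \<union> {u. yA k u \<noteq> 0})" "open ({u. xC k' u \<noteq> 0} \<union> {u. yC k' u \<noteq> 0})"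
    using c by (auto intro!: open_Un open_Collect_neq)
  then have "open (({u. xA k u \<noteq> 0} \<union> {u. yA k u \<noteq> 0}) \<inter> ({u. xC k' u \<noteq> 0} \<union> {u. yC k' u \<noteq> 0}))" (is "open ?S")
    by blast
  moreover have "u0 \<in> ?S" using k by auto
  ultimately obtain r where r: "r > 0" "ball u0 r \<subseteq> ?S" by (rule openE)
  let ?X = "\<lambda>u. vec4 (xA k u) (F u) (xC k' u) (H u)" and ?Y = "\<lambda>u. vec4 (yA k u) (G u) (yC k' u) (K u)"
  have "(?X u, ?Y u) \<in> hom_coords \<and> hom_proj (?X u, ?Y u) = \<Phi> u" if "u \<in> ball u0 r" for u
  proof -
    have "(xA k u, yA k u) \<noteq> (0, 0)" "(xC k' u, yC k' u) \<noteq> (0, 0)" using that r(2) by auto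
    then show ?thesis using \<Phi>_coords by blast
  qed
  moreover have "\<forall>i. (\<lambda>u. ?X u $ i) holomorphic_on ball u0 r \<and> (\<lambda>u. ?Y u $ i) holomorphic_on ball u0 r"
    unfolding forall_4 vec4_nth
    using holomorphic_on_subset[OF hol(1), of "ball u0 r"] holomorphic_on_subset[OF hol(2), of "ball u0 r"]
      holomorphic_on_subset[OF hol(3), of "ball u0 r"] holomorphic_on_subset[OF hol(4), of "ball u0 r"]
      holomorphic_on_subset[OF hol_xy(1), of "ball u0 r" k] holomorphic_on_subset[OF hol_xy(2), of "ball u0 r" k]
      holomorphic_on_subset[OF hol_xy(3), of "ball u0 r" k'] holomorphic_on_subset[OF hol_xy(4), of "ball u0 r" k']
    by simp
  ultimately show "\<exists>X Y r. r > 0 \<and>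
     (\<forall>i. (\<lambda>u. X u $ i) holomorphic_on ball u0 r \<and> (\<lambda>u. Y u $ i) holomorphic_on ball u0 r) \<and>
     (\<forall>u\<in>ball u0 r. (X u, Y u) \<in> hom_coords \<and> hom_proj (X u, Y u) = \<Phi> u)"
    using r(1) by (intro exI[of _ ?X] exI[of _ ?Y] exI[of _ r]) blast
qed

definition den :: "complex \<Rightarrow> complex" where
  "den u = quad_algebra.sq_den b1 b2 (F u) (G u)"

lemma den_eq: "den u = ((F u)\<^sup>2 + (G u)\<^sup>2) * ((b1 + b2)\<^sup>2 * (G u)\<^sup>2 + (b1 - b2)\<^sup>2 * (F u)\<^sup>2)"
  unfolding den_def by (rule quad_algebra.sq_den_def[OF qa])

lemma den_hol: "den holomorphic_on UNIV"
  unfolding den_eq[abs_def] by (intro holomorphic_intros hol)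

lemma den_generic: "\<exists>u. den u \<noteq> 0"
  using sq_den_generic unfolding den_def .

lemma opp_13: "opp_form s b1 b2 b3 b4 (xA k u) (yA k u) (xC k' u) (yC k' u) = 0"
proof -
  obtain u0 where u0: "den u0 \<noteq> 0" using den_generic by blast
  have "(\<lambda>u. opp_form s b1 b2 b3 b4 (xA k u) (yA k u) (xC k' u) (yC k' u)) holomorphic_on UNIV"
    unfolding opp_form_def by (intro holomorphic_intros hol_xy)
  then show ?thesis
  proof (rule entire_mult_cancel[OF _ den_hol u0])
    fix z assume "den z \<noteq> 0"
    then show "opp_form s b1 b2 b3 b4 (xA k z) (yA k z) (xC k' z) (yC k' z) = 0"
      unfolding den_def using quad_algebra.vertex_opp[OF qa vertex_xy] nz by blast
  qed
qed

lemma opp_24: "opp_form s b2 b3 b4 b1 (F u) (G u) (H u) (K u) = 0"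
  unfolding opp_form_def quad_algebra.H[OF qa] quad_algebra.K[OF qa] by (simp add: algebra_simps)

lemma adj_forms:
  assumes "vA u x y" "vC u x' y'"
  shows "adj_form s b1 b2 b3 b4 x y (F u) (G u) = 0" "adj_form s b2 b3 b4 b1 (F u) (G u) x' y' = 0"
    "adj_form s b3 b4 b1 b2 x' y' (H u) (K u) = 0" "adj_form s b4 b1 b2 b3 (H u) (K u) x y = 0"
  using quad_algebra.vertex_forms[OF qa assms(1)] quad_algebra.vertex_forms[OF qb assms(2)]
    adj_form_swap[of s b2 b3 b4 b1 "F u" "G u" x' y'] adj_form_swap[of s b3 b4 b1 b2 x' y' "H u" "K u"] by simp_all

lemma \<Phi>_Qor: "\<Phi> u \<in> Qor_set b"
proof -
  obtain k k' where k: "(xA k u, yA k u) \<noteq> (0, 0)" "(xC k' u, yC k' u) \<noteq> (0, 0)"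
    using ex_choice by metis
  show ?thesis
    unfolding Qor_set_iff quad_forms
    apply (rule exI[of _ "vec4 (xA k u) (F u) (xC k' u) (H u)"], rule exI[of _ "vec4 (yA k u) (G u) (yC k' u) (K u)"])
    unfolding vec4_nth
    using \<Phi>_coords[OF k] adj_forms[OF vertex_xy] opp_13[of k u k'] opp_24 by simp
qed

lemma FG_neg_period: "F (u + np) * G u = - F u * G (u + np)" "H (u + np) * K u = - H u * K (u + np)"
  using period[OF np(1), of u] np(2) by simp_all

text \<open>The reflection \<open>v \<mapsto> m - v\<close> is the reflection at 0 followed by a
  translation, and the signs multiply. \<open>z_2\<close> and \<open>z_4\<close> always receive
  opposite signs, so exactly one of the two is reversed.\<close>

lemma FG_reflect:
  assumes "m \<in> plat L"
  shows "F (m - v) * G v = sg m * \<eta> * F v * G (m - v)" "H (m - v) * K v = - (sg m * \<eta>) * H v * K (m - v)"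
proof -
  have cancel: "f' * gv = e * e' * fv * g'" if "f' * gn = e * fn * g'" "fn * gv = e' * fv * gn"
    "(fn, gn) \<noteq> (0, 0)" "(fv, gv) \<noteq> (0, 0)" "e \<noteq> 0" "e' \<noteq> 0" for f' g' fn gn fv gv e e' :: complex
  proof (cases "gn = 0")
    case True
    then have "g' = 0" "gv = 0" using that by auto
    then show ?thesis by simp
  next
    case False
    have "(f' * gv) * gn = (e * e' * fv * g') * gn" using that(1,2) by algebra
    then show ?thesis using False by simp
  qed
  have e: "sg m \<noteq> 0" "\<eta> \<noteq> 0" using sg(2)[OF assms] \<eta> by auto
  have p: "F (m - v) * G (- v) = sg m * F (- v) * G (m - v)" "H (m - v) * K (- v) = sg m * H (- v) * K (m - v)"
    using period[OF assms, of "- v"] by simp_all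
  show "F (m - v) * G v = sg m * \<eta> * F v * G (m - v)"
    by (rule cancel[OF p(1) reflect(1) FG FG e])
  show "H (m - v) * K v = - (sg m * \<eta>) * H v * K (m - v)"
    using cancel[OF p(2) reflect(2) HK HK e(1)] e(2) by simp
qed

text \<open>\<open>z_2\<close> and \<open>z_4\<close> determine the other two tangents
  equivariantly: if both change by \<open>\<epsilon>\<close>, then \<open>cA\<close> and
  \<open>cC\<close> scale by \<open>t\<^sup>2\<close> while \<open>F * G\<close> and
  \<open>H * K\<close> scale by \<open>\<epsilon> * t\<^sup>2\<close>, so \<open>vertex\<close>
  holds with \<open>x\<close> replaced by \<open>\<epsilon> * x\<close>.\<close>

lemma \<Phi>_sign:
  assumes e: "\<epsilon> = 1 \<or> \<epsilon> = - 1" and FGe: "F v * G u = \<epsilon> * F u * G v" and HKe: "H v * K u = \<epsilon> * H u * K v"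
  shows "\<Phi> v = (if \<epsilon> = 1 then \<Phi> u else neg4 (\<Phi> u))"
proof -
  have e2: "\<epsilon> * \<epsilon> = 1" "\<epsilon> \<noteq> 0" using e by auto
  obtain t where t: "t \<noteq> 0" "F v = t * (\<epsilon> * F u)" "G v = t * G u"
    using cp1_rel_scale[of "\<epsilon> * F u" "G u" "F v" "G v"] FG[of u] FG[of v] FGe e2
    by (auto simp: cp1_rel_def mult_ac)
  obtain t' where t': "t' \<noteq> 0" "H v = t' * (\<epsilon> * H u)" "K v = t' * K u"
    using cp1_rel_scale[of "\<epsilon> * H u" "K u" "H v" "K v"] HK[of u] HK[of v] HKe e2
    by (auto simp: cp1_rel_def mult_ac)
  have "t'\<^sup>2 * (H u)\<^sup>2 = t\<^sup>2 * (H u)\<^sup>2"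
    using relH[of v] relH[of u] e2(1) unfolding t t' by algebra
  moreover have "t'\<^sup>2 * (K u)\<^sup>2 = t\<^sup>2 * (K u)\<^sup>2"
    using relK[of v] relK[of u] e2(1) unfolding t t' by algebra
  ultimately have tt: "t'\<^sup>2 = t\<^sup>2" using HK[of u] by auto
  have v1: "vA v (\<epsilon> * x) y" if "vA u x y" for x y
  proof -
    have "cA s b1 b3 b4 (F v) (G v) = t\<^sup>2 * cA s b1 b3 b4 (F u) (G u)" "cC s b2 b3 (F v) (G v) = t\<^sup>2 * cC s b2 b3 (F u) (G u)"
      unfolding cA_def cC_def t using e2(1) by algebra+
    moreover have "H v * K v = \<epsilon> * t\<^sup>2 * (H u * K u)" unfolding t' using tt by algebra
    moreover have "F v * G v = \<epsilon> * t\<^sup>2 * (F u * G u)" unfolding t by algebra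
    ultimately show ?thesis using that e2(1)
      unfolding quad_algebra.vertex_def[OF qa] mult.assoc by algebra
  qed
  have v3: "vC v (\<epsilon> * x) y" if "vC u x y" for x y
  proof -
    have "cA s b2 b4 b3 (F v) (G v) = t\<^sup>2 * cA s b2 b4 b3 (F u) (G u)" "cC s b1 b4 (F v) (G v) = t\<^sup>2 * cC s b1 b4 (F u) (G u)"
      unfolding cA_def cC_def t using e2(1) by algebra+
    moreover have "H v * K v = \<epsilon> * t\<^sup>2 * (H u * K u)" unfolding t' using tt by algebra
    moreover have "F v * G v = \<epsilon> * t\<^sup>2 * (F u * G u)" unfolding t by algebra
    ultimately show ?thesis using that e2(1)
      unfolding quad_algebra.vertex_def[OF qb] mult.assoc by algebra
  qed
  obtain k k' where k: "(xA k u, yA k u) \<noteq> (0, 0)" "(xC k' u, yC k' u) \<noteq> (0, 0)"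
    using ex_choice by metis
  have zz: "zA v = abs_cp1 (\<epsilon> * xA k u, yA k u)" "zC v = abs_cp1 (\<epsilon> * xC k' u, yC k' u)"
    "zA u = abs_cp1 (xA k u, yA k u)" "zC u = abs_cp1 (xC k' u, yC k' u)"
    using zA_eq[OF v1[OF vertex_xy(1)], of k] zC_eq[OF v3[OF vertex_xy(2)], of k'] k e2(2)
      zA_eq[OF vertex_xy(1) k(1)] zC_eq[OF vertex_xy(2) k(2)] by simp_all
  have "abs_cp1 (F v, G v) = abs_cp1 (\<epsilon> * F u, G u)" "abs_cp1 (H v, K v) = abs_cp1 (\<epsilon> * H u, K u)"
    using abs_cp1_eq_iff[of "(F v, G v)" "(\<epsilon> * F u, G u)"] abs_cp1_eq_iff[of "(H v, K v)" "(\<epsilon> * H u, K u)"]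
      FG[of u] FG[of v] HK[of u] HK[of v] e2(2) FGe HKe by auto
  then show ?thesis
    using e k FG[of u] HK[of u] unfolding \<Phi>_def vec_eq_4 neg4_def zz by (auto simp: cp1_neg_abs)
qed

text \<open>\<open>surj\<close> provides \<open>u0\<close> with the right square of
  \<open>z_2\<close>, and the opposite equation then gives the right square of \<open>z_4\<close>.
  The four sign combinations are realized by \<open>u0\<close>, \<open>u0 + np\<close>,
  \<open>- u0\<close> and \<open>np - u0\<close>.\<close>

lemma \<Phi>_surj: assumes "P \<in> Qor_set b" shows "\<exists>u. P = \<Phi> u"
proof -
  obtain x y where xy: "(x, y) \<in> hom_coords" "P = hom_proj (x, y)"
    and forms: "adj_form s b1 b2 b3 b4 (x$1) (y$1) (x$2) (y$2) = 0" "adj_form s b2 b3 b4 b1 (x$2) (y$2) (x$3) (y$3) = 0"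
      "adj_form s b3 b4 b1 b2 (x$3) (y$3) (x$4) (y$4) = 0" "adj_form s b4 b1 b2 b3 (x$4) (y$4) (x$1) (y$1) = 0"
      "opp_form s b1 b2 b3 b4 (x$1) (y$1) (x$3) (y$3) = 0" "opp_form s b2 b3 b4 b1 (x$2) (y$2) (x$4) (y$4) = 0"
    using assms unfolding Qor_set_iff quad_forms by blast
  have n: "(x $ i, y $ i) \<noteq> (0, 0)" for i using xy(1) by (simp add: hom_coords_iff)
  obtain u0 where u0: "(y$2)\<^sup>2 * (F u0)\<^sup>2 = (x$2)\<^sup>2 * (G u0)\<^sup>2"
    using surj[of "(x$2)\<^sup>2" "(y$2)\<^sup>2"] n[of 2] by auto
  have "\<exists>u. F u * y$2 = x$2 * G u \<and> H u * y$4 = x$4 * K u"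
  proof -
    have pm: "F u0 * y$2 = x$2 * G u0 \<or> F u0 * y$2 = - (x$2 * G u0)"
    proof -
      have "(F u0 * y$2)\<^sup>2 = (x$2 * G u0)\<^sup>2" using u0 by (simp add: power_mult_distrib mult.commute)
      then show ?thesis by (simp add: power2_eq_iff)
    qed
    have pm': "H u0 * y$4 = x$4 * K u0 \<or> H u0 * y$4 = - (x$4 * K u0)"
    proof -
      obtain t where t: "t \<noteq> 0" "(x$2)\<^sup>2 = t * (F u0)\<^sup>2" "(y$2)\<^sup>2 = t * (G u0)\<^sup>2"
        using cp1_rel_scale[of "(F u0)\<^sup>2" "(G u0)\<^sup>2" "(x$2)\<^sup>2" "(y$2)\<^sup>2"] u0 FG[of u0] n[of 2]
        by (auto simp: cp1_rel_def mult_ac)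
      have "opp_form s b2 b3 b4 b1 (x$2) (y$2) (x$4) (y$4)
          = (K u0)\<^sup>2 * t * (x$4)\<^sup>2 - (H u0)\<^sup>2 * t * (y$4)\<^sup>2"
        unfolding opp_form_def t quad_algebra.H[OF qa] quad_algebra.K[OF qa] by (simp add: algebra_simps)
      then have "t * ((H u0 * y$4)\<^sup>2 - (x$4 * K u0)\<^sup>2) = 0" using forms(6) by algebra
      then have "(H u0 * y$4)\<^sup>2 = (x$4 * K u0)\<^sup>2" using t(1) by simp
      then show ?thesis by (simp add: power2_eq_iff)
    qed
    \<comment> \<open>\<open>e\<close> and \<open>e'\<close> are the prescribed sign changes of
      \<open>z_2\<close> and \<open>z_4\<close>. Equal signs are reached by a translation, opposite
      ones by a reflection; which of the two reflections serves depends on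
      \<open>\<eta>\<close>.\<close>
    have move: "\<exists>u. (\<forall>p q. F u0 * q = d * (p * G u0) \<longrightarrow> F u * q = e * d * (p * G u))
        \<and> (\<forall>p q. H u0 * q = d' * (p * K u0) \<longrightarrow> H u * q = e' * d' * (p * K u))"
      if ee: "e = 1 \<or> e = - 1" "e' = 1 \<or> e' = - 1" for e e' d d' :: complex
    proof -
      have key: "f' * q = e * d * (p * g')" if "f' * g = e * f * g'" "f * q = d * (p * g)" "(f, g) \<noteq> (0, 0)" "(f', g') \<noteq> (0, 0)" "e \<noteq> 0"
        for f g f' g' e d p q :: complex
      proof (cases "g = 0")
        case True
        then have "g' = 0" "q = 0" using that by auto
        then show ?thesis by simp
      next
        case False
        have "(f' * q) * g = (e * d * (p * g')) * g" using that(1,2) by algebra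
        then show ?thesis using False by simp
      qed
      have "\<exists>u. F u * G u0 = e * F u0 * G u \<and> H u * K u0 = e' * H u0 * K u"
      proof (cases "e = e'")
        case True
        show ?thesis
        proof (cases "e = 1")
          case True
          then show ?thesis using \<open>e = e'\<close> by (intro exI[of _ u0]) simp
        next
          case False
          then show ?thesis using True ee FG_neg_period[of u0] by (intro exI[of _ "u0 + np"]) simp
        qed
      next
        case False
        then have e': "e' = - e" using ee by auto
        show ?thesis
        proof (cases "e = \<eta>")
          case True
          then show ?thesis using e' reflect[of u0] by (intro exI[of _ "- u0"]) simp
        next
          case False
          then have "e = sg np * \<eta>" "e' = - (sg np * \<eta>)" using e' ee \<eta> np by auto
          then show ?thesis using FG_reflect[OF np(1), of u0] by (intro exI[of _ "np - u0"]) simp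
        qed
      qed
      then obtain u where u: "F u * G u0 = e * F u0 * G u" "H u * K u0 = e' * H u0 * K u" by blast
      have e0: "e \<noteq> 0" "e' \<noteq> 0" using ee by auto
      show ?thesis
      proof (intro exI[of _ u] conjI allI impI)
        fix p q assume "F u0 * q = d * (p * G u0)"
        then show "F u * q = e * d * (p * G u)" by (rule key[OF u(1) _ FG FG e0(1)])
      next
        fix p q assume "H u0 * q = d' * (p * K u0)"
        then show "H u * q = e' * d' * (p * K u)" by (rule key[OF u(2) _ HK HK e0(2)])
      qed
    qed
    obtain d where d: "d = 1 \<or> d = - 1" "F u0 * y$2 = d * (x$2 * G u0)"
      using pm by (metis mult_1 mult_minus1)
    obtain d' where d': "d' = 1 \<or> d' = - 1" "H u0 * y$4 = d' * (x$4 * K u0)"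
      using pm' by (metis mult_1 mult_minus1)
    have dd: "d * d = 1" "d' * d' = 1" using d d' by auto
    from move[OF d(1) d'(1), of d d'] obtain u where "F u * y$2 = d * d * (x$2 * G u)" "H u * y$4 = d' * d' * (x$4 * K u)"
      using d d' by blast
    then show ?thesis unfolding dd by auto
  qed
  then obtain u where u: "F u * y$2 = x$2 * G u" "H u * y$4 = x$4 * K u" by blast
  obtain t where t: "t \<noteq> 0" "F u = t * x$2" "G u = t * y$2"
    using cp1_rel_scale[of "x$2" "y$2" "F u" "G u"] u(1) FG[of u] n[of 2] by (auto simp: cp1_rel_def mult_ac)
  obtain t' where t': "t' \<noteq> 0" "H u = t' * x$4" "K u = t' * y$4"
    using cp1_rel_scale[of "x$4" "y$4" "H u" "K u"] u(2) HK[of u] n[of 4] by (auto simp: cp1_rel_def mult_ac)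
  have f: "adj_form s b1 b2 b3 b4 (x$1) (y$1) (F u) (G u) = 0" "adj_form s b4 b1 b2 b3 (H u) (K u) (x$1) (y$1) = 0"
    "adj_form s b2 b1 b4 b3 (x$3) (y$3) (F u) (G u) = 0" "adj_form s b3 b2 b1 b4 (H u) (K u) (x$3) (y$3) = 0"
    unfolding t t' adj_form_scale adj_form_swap[of s b2 b1 b4 b3] adj_form_swap[of s b3 b2 b1 b4] using forms by simp_all
  have "vA u (x$1) (y$1)"
    by (rule quad_algebra.vertex_converse[OF qa n FG _ _ _ _ _ _ _ _ _ _ _ _ _ n f forms(5)]) (use nz in auto)
  moreover have "vC u (x$3) (y$3)"
  proof -
    have "opp_form s b2 b1 b4 b3 (x$3) (y$3) (x$1) (y$1) = 0"
      unfolding opp_form_swap[OF s2] forms(5) by simp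
    from quad_algebra.vertex_converse[OF qb n FG _ _ _ _ _ _ _ _ _ _ _ _ _ n f(3,4,1,2) this]
    show ?thesis using nz by simp
  qed
  ultimately have "P = \<Phi> u"
    unfolding xy(2) vec_eq_4 hom_proj_nth \<Phi>_def
    using zA_eq[OF _ n] zC_eq[OF _ n] abs_cp1_eq_iff[of "(x$2, y$2)" "(F u, G u)"] abs_cp1_eq_iff[of "(x$4, y$4)" "(H u, K u)"]
      n[of 2] n[of 4] FG[of u] HK[of u] u by (simp add: mult.commute)
  then show ?thesis by blast
qed

lemma range_\<Phi>: "range \<Phi> = Qor_set b"
  using \<Phi>_Qor \<Phi>_surj by blast

end

section \<open>Fibres and local injectivity of the parametrization\<close>

context quad_param
begin

lemma \<Phi>_eqD:
  assumes "\<Phi> u = \<Phi> v"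
  shows "F u * G v = F v * G u" "H u * K v = H v * K u"
proof -
  have "abs_cp1 (F u, G u) = abs_cp1 (F v, G v)" "abs_cp1 (H u, K u) = abs_cp1 (H v, K v)"
    using assms unfolding \<Phi>_def vec_eq_4 by simp_all
  then show "F u * G v = F v * G u" "H u * K v = H v * K u"
    using abs_cp1_eq_iff FG HK by simp_all
qed

lemma \<Phi>_period:
  assumes "m \<in> plat L"
  shows "\<Phi> (u + m) = (if sg m = 1 then \<Phi> u else neg4 (\<Phi> u))"
  by (rule \<Phi>_sign[OF sg(2)[OF assms] period(1)[OF assms] period(2)[OF assms]])

lemma plat_diff2:
  assumes "u + v \<in> plat L" "2 * u \<in> plat L"
  shows "u - v \<in> plat L"
proof -
  have "2 * u - (u + v) \<in> plat L" using lattice_of_diff[OF assms(2,1)] .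
  then show ?thesis by (simp add: algebra_simps)
qed

text \<open>A reflection reverses one of \<open>z_2\<close> and \<open>z_4\<close>. If both agree at
  \<open>u\<close> and \<open>v\<close>, the reversed one is 0 or infinity there, and
  \<open>zeros\<close> applies.\<close>

lemma reflection_zero:
  assumes m: "u + v \<in> plat L" and eq: "F u * G v = F v * G u" "H u * K v = H v * K u"
  shows "2 * u \<in> plat L"
proof -
  have u: "u = u + v - v" by simp
  have 1: "F u * G v = sg (u + v) * \<eta> * F v * G u" "H u * K v = - (sg (u + v) * \<eta>) * H v * K u"
    using FG_reflect[OF m, of v] by simp_all
  have "sg (u + v) * \<eta> = 1 \<or> sg (u + v) * \<eta> = - 1" using sg(2)[OF m] \<eta> by auto
  then have "F u * G u = 0 \<or> H u * K u = 0"
  proof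
    assume "sg (u + v) * \<eta> = 1"
    then have "H u * K v = - (H v * K u)" using 1(2) by simp
    then show ?thesis using nonproportional_sign[OF eq(2) _ HK HK] by blast
  next
    assume "sg (u + v) * \<eta> = - 1"
    then have "F u * G v = - (F v * G u)" using 1(1) by simp
    then show ?thesis using nonproportional_sign[OF eq(1) _ FG FG] by blast
  qed
  then show ?thesis using zeros[of u] by auto
qed

text \<open>\<open>fibre\<close> leaves translations and reflections; a reflection that preserves
  the point fixes \<open>u\<close> modulo the lattice, so it is a translation as well. Sign -1 would
  make \<open>z_2\<close> and \<open>z_4\<close> both 0 or infinite.\<close>

lemma \<Phi>_eq_iff: "\<Phi> u = \<Phi> v \<longleftrightarrow> u - v \<in> {m \<in> plat L. sg m = 1}"
proof
  assume "u - v \<in> {m \<in> plat L. sg m = 1}"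
  then show "\<Phi> u = \<Phi> v" using \<Phi>_period[of "u - v" v] by simp
next
  assume eq: "\<Phi> u = \<Phi> v"
  note e = \<Phi>_eqD[OF eq]
  have "(F u)\<^sup>2 * (G v)\<^sup>2 = (F v)\<^sup>2 * (G u)\<^sup>2" using e(1) by algebra
  then have "u - v \<in> plat L \<or> u + v \<in> plat L" by (rule fibre)
  then have m: "u - v \<in> plat L"
    using plat_diff2 reflection_zero[OF _ e] by blast
  have "sg (u - v) \<noteq> - 1"
  proof
    assume n: "sg (u - v) = - 1"
    have "F u * G v = - (F v * G u)" "H u * K v = - (H v * K u)"
      using period[OF m, of v] n by simp_all
    then have "F u * G u = 0" "H u * K u = 0"
      using nonproportional_sign[OF e(1) _ FG FG] nonproportional_sign[OF e(2) _ HK HK] by blast+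
    then show False using FGHK by blast
  qed
  then show "u - v \<in> {m \<in> plat L. sg m = 1}" using m sg(2) by blast
qed

lemma unoriented_\<Phi>_iff: "unoriented (\<Phi> u) = unoriented (\<Phi> v) \<longleftrightarrow> u - v \<in> plat L"
proof
  assume "unoriented (\<Phi> u) = unoriented (\<Phi> v)"
  then consider "\<Phi> u = \<Phi> v" | "\<Phi> u = \<Phi> (v + np)"
    using \<Phi>_period[OF np(1), of v] np(2) by (auto simp: unoriented_eq_iff)
  then show "u - v \<in> plat L"
  proof cases
    case 1 then show ?thesis using \<Phi>_eq_iff by blast
  next
    case 2
    then have "u - (v + np) \<in> plat L" using \<Phi>_eq_iff by blast
    then have "u - (v + np) + np \<in> plat L" using lattice_of_add np(1) by blast
    then show ?thesis by simp
  qed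
next
  assume m: "u - v \<in> plat L"
  show "unoriented (\<Phi> u) = unoriented (\<Phi> v)"
    using \<Phi>_period[OF m, of v] by (auto simp: unoriented_eq_iff split: if_splits)
qed

lemma \<Phi>_cnj: "\<Phi> (cnj u) = cnj4 (\<Phi> u)"
proof -
  obtain k k' where k: "(xA k u, yA k u) \<noteq> (0, 0)" "(xC k' u, yC k' u) \<noteq> (0, 0)"
    using ex_choice by metis
  have c: "xA k (cnj u) = cnj (xA k u)" "yA k (cnj u) = cnj (yA k u)" "xC k' (cnj u) = cnj (xC k' u)" "yC k' (cnj u) = cnj (yC k' u)"
    by (simp_all add: xA_def yA_def xC_def yC_def cA_def cC_def conj)
  have "zA (cnj u) = abs_cp1 (cnj (xA k u), cnj (yA k u))"
    using zA_eq[OF vertex_xy(1)[where k = k and u = "cnj u"]] k(1) unfolding c by auto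
  moreover have "zC (cnj u) = abs_cp1 (cnj (xC k' u), cnj (yC k' u))"
    using zC_eq[OF vertex_xy(2)[where k = k' and u = "cnj u"]] k(2) unfolding c by auto
  ultimately show ?thesis
    using zA_eq[OF vertex_xy(1) k(1)] zC_eq[OF vertex_xy(2) k(2)] k FG[of u] HK[of u]
    by (simp add: \<Phi>_def vec_eq_4 cnj4_def cp1_cnj_abs conj)
qed

lemma cross_fibre: "(H u)\<^sup>2 * (K v)\<^sup>2 = (H v)\<^sup>2 * (K u)\<^sup>2 \<longleftrightarrow> (F u)\<^sup>2 * (G v)\<^sup>2 = (F v)\<^sup>2 * (G u)\<^sup>2"
  using cross_ratio[of u v] nz by auto

text \<open>The square of \<open>z_2\<close> separates the points near \<open>u0\<close> unless
  \<open>2 * u0\<close> is a lattice point, where it is even about \<open>u0\<close>. There one of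
  \<open>z_2\<close> and \<open>z_4\<close> is odd about \<open>u0\<close>, and this one is
  injective.\<close>

lemma \<Phi>_inj_local: "\<exists>i r. r > 0 \<and> inj_on (\<lambda>u. \<Phi> u $ i) (ball u0 r)"
proof -
  obtain e where e: "e > 0" "\<And>l. l \<in> plat L \<Longrightarrow> norm l < e \<Longrightarrow> l = 0"
    using lattice_discrete[of "of_real L" "of_real (2 * pi) * \<i>"] L by auto
  have sq2: "(F u)\<^sup>2 * (G v)\<^sup>2 = (F v)\<^sup>2 * (G u)\<^sup>2" "F u * G v = F v * G u" if "\<Phi> u $ 2 = \<Phi> v $ 2" for u v
  proof -
    show *: "F u * G v = F v * G u"
      using that abs_cp1_eq_iff[OF FG FG, of u v] by (simp add: \<Phi>_def)
    show "(F u)\<^sup>2 * (G v)\<^sup>2 = (F v)\<^sup>2 * (G u)\<^sup>2" using * by algebra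
  qed
  have sq4: "(F u)\<^sup>2 * (G v)\<^sup>2 = (F v)\<^sup>2 * (G u)\<^sup>2" "H u * K v = H v * K u" if "\<Phi> u $ 4 = \<Phi> v $ 4" for u v
  proof -
    show *: "H u * K v = H v * K u"
      using that abs_cp1_eq_iff[OF HK HK, of u v] by (simp add: \<Phi>_def)
    show "(F u)\<^sup>2 * (G v)\<^sup>2 = (F v)\<^sup>2 * (G u)\<^sup>2" unfolding cross_fibre[symmetric] using * by algebra
  qed
  have near: "dist u v < 2 * r" "norm (u + v - 2 * u0) < 2 * r" if "u \<in> ball u0 r" "v \<in> ball u0 r" for u v r
  proof -
    have uv: "norm (u - u0) < r" "norm (v - u0) < r" using that by (simp_all add: dist_norm norm_minus_commute)
    show "norm (u + v - 2 * u0) < 2 * r"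
      using norm_triangle_ineq[of "u - u0" "v - u0"] uv by (simp add: algebra_simps)
    show "dist u v < 2 * r"
      using norm_triangle_ineq4[of "u - u0" "v - u0"] uv by (simp add: dist_norm)
  qed
  show ?thesis
  \<comment> \<open>The question is whether a lattice point lies within \<open>e / 2\<close> of
    \<open>2 * u0\<close>; by the choice of \<open>e\<close> there is at most one.\<close>
  proof (cases "\<exists>m\<in>plat L. norm (m - 2 * u0) < e / 2 \<and> m \<noteq> 2 * u0 \<or> m = 2 * u0")
    case False
    have "inj_on (\<lambda>u. \<Phi> u $ 2) (ball u0 (e / 4))"
    proof (rule inj_onI)
      fix u v assume uv: "u \<in> ball u0 (e / 4)" "v \<in> ball u0 (e / 4)" "\<Phi> u $ 2 = \<Phi> v $ 2"
      from fibre[OF sq2(1)[OF uv(3)]] show "u = v"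
      proof
        assume "u - v \<in> plat L"
        then show ?thesis using e(2)[of "u - v"] near(1)[OF uv(1,2)] e(1) by (simp add: dist_norm)
      next
        assume "u + v \<in> plat L"
        then show ?thesis using False near(2)[OF uv(1,2)] by auto
      qed
    qed
    then show ?thesis using e(1) by (intro exI[of _ 2] exI[of _ "e / 4"]) simp
  next
    case True
    then obtain m where m: "m \<in> plat L" "norm (m - 2 * u0) < e / 2" using e(1) by auto
    have only: "m' = m" if "m' \<in> plat L" "norm (m' - 2 * u0) < e / 2" for m'
    proof -
      have "norm (m' - m) < e"
        using norm_triangle_ineq4[of "m' - 2 * u0" "m - 2 * u0"] that(2) m(2) by simp
      then show ?thesis using e(2)[OF lattice_of_diff[OF that(1) m(1)]] by simp
    qed
    show ?thesis
    proof (cases "m = 2 * u0")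
      case False
      define r where "r = min (e / 4) (norm (m - 2 * u0) / 2)"
      have r: "r > 0" "2 * r \<le> e / 2" "2 * r \<le> norm (m - 2 * u0)" using e(1) False by (auto simp: r_def)
      have "inj_on (\<lambda>u. \<Phi> u $ 2) (ball u0 r)"
      proof (rule inj_onI)
        fix u v assume uv: "u \<in> ball u0 r" "v \<in> ball u0 r" "\<Phi> u $ 2 = \<Phi> v $ 2"
        from fibre[OF sq2(1)[OF uv(3)]] show "u = v"
        proof
          assume "u - v \<in> plat L"
          then show ?thesis using e(2)[of "u - v"] near(1)[OF uv(1,2)] r e(1) by (simp add: dist_norm)
        next
          assume "u + v \<in> plat L"
          then have "u + v = m" using only[of "u + v"] near(2)[OF uv(1,2)] r by simp
          then show ?thesis using near(2)[OF uv(1,2)] r by simp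
        qed
      qed
      then show ?thesis using r(1) by blast
    next
      case True
      have half: "u = u0" if "2 * u \<in> plat L" "u \<in> ball u0 (e / 4)" for u
      proof -
        have "norm (2 * u - 2 * u0) < e / 2" using near(2)[OF that(2) that(2)] by simp
        then have "2 * u = 2 * u0" using only[OF that(1)] True by simp
        then show ?thesis by simp
      qed
      \<comment> \<open>The coordinate that is reversed by \<open>v \<mapsto> m - v\<close>.\<close>
      define i :: 4 where "i = (if sg m * \<eta> = - 1 then 2 else 4)"
      have sgm: "sg m * \<eta> = 1 \<or> sg m * \<eta> = - 1" using sg(2)[OF m(1)] \<eta> by auto
      have "inj_on (\<lambda>u. \<Phi> u $ i) (ball u0 (e / 4))"
      proof (rule inj_onI)
        fix u v assume uv: "u \<in> ball u0 (e / 4)" "v \<in> ball u0 (e / 4)" "\<Phi> u $ i = \<Phi> v $ i"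
        have "(F u)\<^sup>2 * (G v)\<^sup>2 = (F v)\<^sup>2 * (G u)\<^sup>2"
          using sq2(1)[of u v] sq4(1)[of u v] uv(3) by (auto simp: i_def split: if_splits)
        from fibre[OF this] show "u = v"
        proof
          assume "u - v \<in> plat L"
          then show ?thesis using e(2)[of "u - v"] near(1)[OF uv(1,2)] e(1) by (simp add: dist_norm)
        next
          assume "u + v \<in> plat L"
          then have uvm: "u + v = m" using only[of "u + v"] near(2)[OF uv(1,2)] by simp
          then have u: "u = m - v" by (simp add: algebra_simps)
          have "F u * G u * H u * K u = 0"
          proof (cases "sg m * \<eta> = - 1")
            case True
            then have "F u * G v = - (F v * G u)" using FG_reflect(1)[OF m(1), of v] u by simp
            moreover have "F u * G v = F v * G u" using sq2(2) uv(3) True by (simp add: i_def)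
            ultimately have "F u * G u = 0" using nonproportional_sign[OF _ _ FG FG] by blast
            then show ?thesis by simp
          next
            case False
            then have "H u * K v = - (H v * K u)" using FG_reflect(2)[OF m(1), of v] u sgm by simp
            moreover have "H u * K v = H v * K u" using sq4(2) uv(3) False by (simp add: i_def)
            ultimately have "H u * K u = 0" using nonproportional_sign[OF _ _ HK HK] by blast
            then show ?thesis by simp
          qed
          then have "2 * u \<in> plat L" by (rule zeros)
          then have "u = u0" using half uv(1) by blast
          then show ?thesis using uvm True by simp
        qed
      qed
      then show ?thesis using e(1) by (intro exI[of _ i] exI[of _ "e / 4"]) simp
    qed
  qed
qed

lemma uniformized_\<Phi>:
  assumes "{m \<in> plat L. sg m = 1} = lattice_of v w" "Im (v * cnj w) \<noteq> 0"
  shows "uniformized (lattice_of v w) (Qor b) \<Phi>" "uniformized (plat L) (Q b) (\<lambda>u. unoriented (\<Phi> u))"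
proof -
  show *: "uniformized (lattice_of v w) (Qor b) \<Phi>"
    by (rule uniformized_Qor[OF \<Phi>_lifts range_\<Phi> refl assms(2) \<Phi>_eq_iff[unfolded assms(1)] \<Phi>_inj_local])
  show "uniformized (plat L) (Q b) (\<lambda>u. unoriented (\<Phi> u))"
    by (rule uniformized_Q[OF * unoriented_\<Phi>_iff])
qed

lemma sq_AC_\<Phi>:
  "sq_AC b (\<Phi> u) = abs_cp1 (of_real ((b$1 + b$2)\<^sup>2) * (G u)\<^sup>2 + of_real ((b$1 - b$2)\<^sup>2) * (F u)\<^sup>2, (G u)\<^sup>2 + (F u)\<^sup>2)"
  using sq_diagonal_abs(1)[OF FG, of "b$1" "b$2" u] nz by (simp add: sq_AC_def \<Phi>_def)

lemma sq_BD_\<Phi>: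
  assumes "(xA k u, yA k u) \<noteq> (0, 0)"
  shows "sq_BD b (\<Phi> u) = abs_cp1 (of_real ((b$1 + b$4)\<^sup>2) * (yA k u)\<^sup>2 + of_real ((b$1 - b$4)\<^sup>2) * (xA k u)\<^sup>2, (yA k u)\<^sup>2 + (xA k u)\<^sup>2)"
  using sq_diagonal_abs(1)[OF assms, of "b$1" "b$4"] nz zA_eq[OF vertex_xy(1) assms] by (simp add: sq_BD_def \<Phi>_def)

end

section \<open>The dual quadrilateral\<close>

context quad_algebra
begin

text \<open>The equation of \<open>H\<close> read backwards expresses \<open>F\<^sup>2\<close> by
  \<open>H\<^sup>2\<close> and \<open>G\<^sup>2\<close> with the sign of \<open>G\<^sup>2\<close>
  reversed, and \<open>s - (s - a3) - (s - a4) = - (s - a3 - a4)\<close> supplies just this sign.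
  The constants \<open>c2\<close> and \<open>c4\<close> adjust the remaining coefficients.\<close>

lemma bar_quad_algebra:
  assumes c: "c2\<^sup>2 = a1 * a2" "c4\<^sup>2 = (s - a1) * (s - a2)"
  shows "quad_algebra s (s - a1) (s - a2) (s - a3) (s - a4) H (c2 * G) (c2 * c4 * F) (c4 * K)"
proof
  show "2 * s = s - a1 + (s - a2) + (s - a3) + (s - a4)" using s by algebra
  show "(c2 * c4 * F)\<^sup>2 = (s - (s - a1)) * (s - (s - a2)) * H\<^sup>2 - s * (s - (s - a3) - (s - a4)) * (c2 * G)\<^sup>2"
    unfolding power_mult_distrib c H by algebra
  show "(c4 * K)\<^sup>2 = (s - (s - a1) - (s - a4)) * (s - (s - a1) - (s - a3)) * H\<^sup>2 + (s - (s - a3)) * (s - (s - a4)) * (c2 * G)\<^sup>2"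
    unfolding power_mult_distrib c H K unfolding a4 by algebra
qed

text \<open>Everything that enters the diagonals is multiplied by a power of the same
  \<open>\<beta>\<close>, so the quotients do not change. The product \<open>F * G * H * K\<close>
  is insensitive to exchanging \<open>F\<close> and \<open>H\<close>, which is why the last term of
  \<open>sq_num\<close> survives.\<close>

lemma bar_diagonals:
  assumes c: "c2\<^sup>2 = a1 * a2" "c4\<^sup>2 = (s - a1) * (s - a2)"
  defines "\<beta> \<equiv> (s - a1) * (s - a2)"
  shows "(c2 * G)\<^sup>2 + H\<^sup>2 = \<beta> * (G\<^sup>2 + F\<^sup>2)"
    "(s - a1 + (s - a2))\<^sup>2 * (c2 * G)\<^sup>2 + (s - a1 - (s - a2))\<^sup>2 * H\<^sup>2 = \<beta> * ((a1 + a2)\<^sup>2 * G\<^sup>2 + (a1 - a2)\<^sup>2 * F\<^sup>2)"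
    "quad_algebra.sq_den (s - a1) (s - a2) H (c2 * G) = \<beta>\<^sup>2 * sq_den"
    "quad_algebra.sq_num (s - a1) (s - a2) (s - a3) (s - a4) H (c2 * G) (c2 * c4 * F) (c4 * K) = \<beta>\<^sup>2 * sq_num"
proof -
  note b = bar_quad_algebra[OF c]
  show 1: "(c2 * G)\<^sup>2 + H\<^sup>2 = \<beta> * (G\<^sup>2 + F\<^sup>2)"
    unfolding \<beta>_def power_mult_distrib c H unfolding a4 by algebra
  show 2: "(s - a1 + (s - a2))\<^sup>2 * (c2 * G)\<^sup>2 + (s - a1 - (s - a2))\<^sup>2 * H\<^sup>2 = \<beta> * ((a1 + a2)\<^sup>2 * G\<^sup>2 + (a1 - a2)\<^sup>2 * F\<^sup>2)"
    unfolding \<beta>_def power_mult_distrib c H unfolding a4 by algebra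
  show 3: "quad_algebra.sq_den (s - a1) (s - a2) H (c2 * G) = \<beta>\<^sup>2 * sq_den"
    unfolding quad_algebra.sq_den_def[OF b] sq_den_def 2 using 1 by algebra
  have "H * (c2 * G) * (c2 * c4 * F) * (c4 * K) = c2\<^sup>2 * c4\<^sup>2 * (F * G * H * K)" by algebra
  then have 4: "H * (c2 * G) * (c2 * c4 * F) * (c4 * K) = a1 * a2 * \<beta> * (F * G * H * K)" unfolding c \<beta>_def .
  have 5: "(H\<^sup>2 + (c2 * G)\<^sup>2) = \<beta> * (F\<^sup>2 + G\<^sup>2)" using 1 by algebra
  have 6: "(s - a1)\<^sup>2 + (s - a2)\<^sup>2 + (s - a3)\<^sup>2 + (s - a4)\<^sup>2 = a1\<^sup>2 + a2\<^sup>2 + a3\<^sup>2 + a4\<^sup>2"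
    unfolding a4 by algebra
  have 7: "((s - a1)\<^sup>2 - (s - a2)\<^sup>2) * ((s - a3)\<^sup>2 - (s - a4)\<^sup>2) = (a1\<^sup>2 - a2\<^sup>2) * (a3\<^sup>2 - a4\<^sup>2)"
    unfolding a4 by algebra
  have 8: "16 * (s - a1) * (s - a2) * (a1 * a2 * \<beta> * (F * G * H * K)) = \<beta>\<^sup>2 * (16 * a1 * a2 * (F * G * H * K))"
    unfolding \<beta>_def by algebra
  show "quad_algebra.sq_num (s - a1) (s - a2) (s - a3) (s - a4) H (c2 * G) (c2 * c4 * F) (c4 * K) = \<beta>\<^sup>2 * sq_num"
    unfolding quad_algebra.sq_num_def[OF b] sq_num_def 2 3 4 5 6 7 8 by algebra
qed

end

lemma half_perimeter_bar [simp]: "half_perimeter (bar b) = half_perimeter b"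
  by (simp add: half_perimeter_eq bar_def) (simp add: field_simps)

lemma bar_nth: "bar b $ i = half_perimeter b - b $ i"
  by (simp add: bar_def)

lemma bar_bar: "bar (bar b) = b"
  by (simp add: vec_eq_iff bar_nth)

lemma nondegenerate_bar: "nondegenerate b \<Longrightarrow> nondegenerate (bar b)"
  unfolding nondegenerate_def half_perimeter_bar bar_nth by (auto simp: algebra_simps) (metis add_diff_cancel_right')

text \<open>Up to sign both functions share the automorphy factor \<open>E\<close>, so in their
  quotient only a character of the lattice remains; two generators suffice to check it.\<close>

lemma period_sign:
  fixes f g sg :: "complex \<Rightarrow> complex"
  assumes f: "\<And>x. f (x + of_real L) = \<sigma> * E x * f x" "\<And>x. f (x + of_real (2 * pi) * \<i>) = - f x"
    and g: "\<And>x. g (x + of_real L) = \<sigma>' * E x * g x" "\<And>x. g (x + of_real (2 * pi) * \<i>) = g x"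
    and \<sigma>: "\<sigma> = 1 \<or> \<sigma> = - 1" "\<sigma>' = 1 \<or> \<sigma>' = - 1" and E: "\<And>x. E x \<noteq> 0"
    and sg: "\<And>x y. sg (x + y) = sg x * sg y" "sg (of_real L) = \<sigma> * \<sigma>'" "sg (of_real (2 * pi) * \<i>) = - 1" "sg 0 = 1"
    and m: "m \<in> plat L"
  shows "f (u + m) * g u = sg m * f u * g (u + m)"
proof -
  obtain k l :: int where m': "m = of_int k * of_real L + of_int l * (of_real (2 * pi) * \<i>)"
    using m unfolding lattice_of_def by blast
  let ?P = "\<lambda>x. f x * g u = sg (x - u) * f u * g x"
  have ss: "\<sigma> * \<sigma> = 1" "\<sigma>' * \<sigma>' = 1" "\<sigma> \<noteq> 0" using \<sigma> by auto
  have ss': "\<sigma>' * (\<sigma>' * z) = z" for z using ss(2) by (simp flip: mult.assoc)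
  have 1: "?P (x + of_real L) \<longleftrightarrow> ?P x" for x
  proof -
    have "x + of_real L - u = (x - u) + of_real L" by simp
    then have e: "sg (x + of_real L - u) = sg (x - u) * (\<sigma> * \<sigma>')" by (simp only: sg)
    have "?P (x + of_real L) \<longleftrightarrow> (\<sigma> * E x) * (f x * g u) = (\<sigma> * E x) * (sg (x - u) * f u * g x)"
      unfolding f g e using ss(3) by (simp add: mult_ac ss')
    then show ?thesis using ss(3) E[of x] by simp
  qed
  have 2: "?P (x + of_real (2 * pi) * \<i>) \<longleftrightarrow> ?P x" for x
  proof -
    have "x + of_real (2 * pi) * \<i> - u = (x - u) + of_real (2 * pi) * \<i>" by simp
    then have e: "sg (x + of_real (2 * pi) * \<i> - u) = sg (x - u) * (- 1)" by (simp only: sg)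
    show ?thesis unfolding f g e by simp
  qed
  have "?P u" by (simp add: sg)
  then have "?P (u + of_int k * of_real L)"
    using shift_invariant_int[where P = ?P and v = u and k = k, OF 1] by (simp only:)
  then have "?P (u + of_int k * of_real L + of_int l * (of_real (2 * pi) * \<i>))"
    using shift_invariant_int[where P = ?P and v = "u + of_int k * of_real L" and k = l, OF 2] by (simp only:)
  then show ?thesis unfolding m' by (simp add: add.assoc)
qed

text \<open>For \<open>\<eta> = - 1\<close> the function \<open>F\<close> is odd and
  \<open>H\<close> even, for \<open>\<eta> = 1\<close> the reverse. The signs in
  \<open>shift_real\<close> are arranged so that \<open>F / G\<close> and \<open>H / K\<close>
  behave alike under translations in both cases.\<close>

locale theta_quad =
  fixes b :: "real ^ 4" and F G H K :: "complex \<Rightarrow> complex" and \<eta> :: complex and L :: real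
  assumes L: "L > 0" and nd: "nondegenerate b"
    and hol: "F holomorphic_on UNIV" "G holomorphic_on UNIV" "H holomorphic_on UNIV" "K holomorphic_on UNIV"
    and relH: "(H u)\<^sup>2 = of_real ((half_perimeter b - b$1) * (half_perimeter b - b$2)) * (F u)\<^sup>2
        - of_real (half_perimeter b * (half_perimeter b - b$3 - b$4)) * (G u)\<^sup>2"
    and relK: "(K u)\<^sup>2 = of_real ((half_perimeter b - b$1 - b$4) * (half_perimeter b - b$1 - b$3)) * (F u)\<^sup>2
        + of_real ((half_perimeter b - b$3) * (half_perimeter b - b$4)) * (G u)\<^sup>2"
    and FG: "(F u, G u) \<noteq> (0, 0)"
    and \<eta>: "\<eta> = 1 \<or> \<eta> = - 1"
    and parity: "F (- u) = \<eta> * F u" "G (- u) = G u" "H (- u) = - \<eta> * H u" "K (- u) = K u"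
    and shift_imag: "F (u + of_real (2 * pi) * \<i>) = - F u" "G (u + of_real (2 * pi) * \<i>) = G u"
      "H (u + of_real (2 * pi) * \<i>) = - H u" "K (u + of_real (2 * pi) * \<i>) = K u"
    and shift_real: "F (u + of_real L) = \<eta> * exp (u + of_real L / 2) * F u" "G (u + of_real L) = \<eta> * exp (u + of_real L / 2) * G u"
      "H (u + of_real L) = - \<eta> * exp (u + of_real L / 2) * H u" "K (u + of_real L) = - \<eta> * exp (u + of_real L / 2) * K u"
    and fibre: "(F u)\<^sup>2 * (G v)\<^sup>2 = (F v)\<^sup>2 * (G u)\<^sup>2 \<Longrightarrow> u - v \<in> plat L \<or> u + v \<in> plat L"
    and zeros: "F u * G u * H u * K u = 0 \<Longrightarrow> 2 * u \<in> plat L"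
    and surj: "(x, y) \<noteq> (0, 0) \<Longrightarrow> \<exists>u. y * (F u)\<^sup>2 = x * (G u)\<^sup>2"
    and conj: "F (cnj u) = cnj (F u)" "G (cnj u) = cnj (G u)" "H (cnj u) = cnj (H u)" "K (cnj u) = cnj (K u)"
begin

text \<open>Signs of \<open>F / G\<close> and \<open>H / K\<close> under translation, and in
  \<open>sgB\<close> those of \<open>H / G\<close> and \<open>F / K\<close>. With \<open>k\<close>
  real and \<open>l\<close> imaginary periods they are \<open>(-1)^l\<close> and
  \<open>(-1)^(k + l)\<close>; written with \<open>cis\<close>, they are multiplicative on the whole
  plane.\<close>

definition sgA :: "complex \<Rightarrow> complex" where "sgA m = cis (Im m / 2)"
definition sgB :: "complex \<Rightarrow> complex" where "sgB m = cis (Im m / 2 + pi * Re m / L)"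

lemma sg_add: "sgA (m + m') = sgA m * sgA m'" "sgB (m + m') = sgB m * sgB m'"
  unfolding sgA_def sgB_def cis_mult by (simp_all add: add_divide_distrib algebra_simps)

lemma sg_basis: "sgA (of_real L) = 1" "sgA (of_real (2 * pi) * \<i>) = - 1" "sgA 0 = 1"
  "sgB (of_real L) = - 1" "sgB (of_real (2 * pi) * \<i>) = - 1" "sgB 0 = 1"
  using L by (simp_all add: sgA_def sgB_def)

lemma cis_int_pi: "cis (pi * of_int k) = (if even k then 1 else - 1)"
proof (cases "even k")
  case True
  then obtain j where "k = 2 * j" by blast
  then have "cis (pi * of_int k) = cis (2 * pi * of_int j)" by (simp add: mult_ac)
  then show ?thesis using True cis_multiple_2pi[of "of_int j"] by simp
next
  case False
  then obtain j where "k = 2 * j + 1" using oddE by blast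
  then have "pi * of_int k = 2 * pi * of_int j + pi" by (simp add: algebra_simps)
  then have "cis (pi * of_int k) = cis (2 * pi * of_int j) * cis pi" by (simp only: cis_mult)
  then show ?thesis using False cis_multiple_2pi[of "of_int j"] by simp
qed

lemma sg_lattice:
  "sgA (of_int k * of_real L + of_int l * (of_real (2 * pi) * \<i>)) = (if even l then 1 else - 1)"
  "sgB (of_int k * of_real L + of_int l * (of_real (2 * pi) * \<i>)) = (if even (k + l) then 1 else - 1)"
proof -
  have "sgA (of_int k * of_real L + of_int l * (of_real (2 * pi) * \<i>)) = cis (pi * of_int l)"
    by (simp add: sgA_def mult_ac)
  then show "sgA (of_int k * of_real L + of_int l * (of_real (2 * pi) * \<i>)) = (if even l then 1 else - 1)"
    unfolding cis_int_pi .
  have "sgB (of_int k * of_real L + of_int l * (of_real (2 * pi) * \<i>)) = cis (pi * of_int (k + l))"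
    using L by (simp add: sgB_def field_simps)
  then show "sgB (of_int k * of_real L + of_int l * (of_real (2 * pi) * \<i>)) = (if even (k + l) then 1 else - 1)"
    unfolding cis_int_pi .
qed

lemma sg_values: "m \<in> plat L \<Longrightarrow> sgA m = 1 \<or> sgA m = - 1" "m \<in> plat L \<Longrightarrow> sgB m = 1 \<or> sgB m = - 1"
  using sg_lattice by (auto simp: lattice_of_def split: if_splits)

lemma imag_period: "of_real (2 * pi) * \<i> \<in> plat L"
  unfolding lattice_of_def by (rule CollectI, rule exI[of _ 0], rule exI[of _ 1]) simp

lemma param_A: "quad_param b F G H K sgA \<eta> (of_real (2 * pi) * \<i>) L"
proof
  show "F (u + m) * G u = sgA m * F u * G (u + m)" if m: "m \<in> plat L" for m u
    by (rule period_sign[where E = "\<lambda>u. exp (u + of_real L / 2)", OF shift_real(1) shift_imag(1) shift_real(2) shift_imag(2) \<eta> \<eta> _ sg_add(1) _ _ _ m])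
      (use sg_basis \<eta> in auto)
  show "H (u + m) * K u = sgA m * H u * K (u + m)" if m: "m \<in> plat L" for m u
    by (rule period_sign[where E = "\<lambda>u. exp (u + of_real L / 2)", OF shift_real(3) shift_imag(3) shift_real(4) shift_imag(4) _ _ _ sg_add(1) _ _ _ m])
      (use sg_basis \<eta> in auto)
  show "F (- u) * G u = \<eta> * F u * G (- u)" "H (- u) * K u = - \<eta> * H u * K (- u)" for u
    unfolding parity by simp_all
qed (fact L nd hol relH relK FG sg_add sg_values imag_period sg_basis \<eta> fibre zeros surj conj)+

definition c2 :: complex where "c2 = of_real (sqrt (b$1 * b$2))"
definition c4 :: complex where "c4 = of_real (sqrt ((half_perimeter b - b$1) * (half_perimeter b - b$2)))"

lemma c_sq: "c2\<^sup>2 = of_real (b$1) * of_real (b$2)"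
  "c4\<^sup>2 = (of_real (half_perimeter b) - of_real (b$1)) * (of_real (half_perimeter b) - of_real (b$2))"
proof -
  have "0 \<le> b$1 * b$2" "0 \<le> (half_perimeter b - b$1) * (half_perimeter b - b$2)"
    using nd by (auto simp: nondegenerate_def intro!: mult_nonneg_nonneg less_imp_le)
  then show "c2\<^sup>2 = of_real (b$1) * of_real (b$2)"
    "c4\<^sup>2 = (of_real (half_perimeter b) - of_real (b$1)) * (of_real (half_perimeter b) - of_real (b$2))"
    unfolding c2_def c4_def of_real_power[symmetric] by simp_all
qed

lemma c_nz: "c2 \<noteq> 0" "c4 \<noteq> 0"
proof -
  have "c2\<^sup>2 \<noteq> 0" "c4\<^sup>2 \<noteq> 0" unfolding c_sq using nondegenerate_complex[OF nd] by simp_all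
  then show "c2 \<noteq> 0" "c4 \<noteq> 0" by auto
qed

lemma bar_algebra: "quad_algebra (of_real (half_perimeter (bar b))) (of_real (bar b $ 1)) (of_real (bar b $ 2)) (of_real (bar b $ 3)) (of_real (bar b $ 4))
    (H u) (c2 * G u) (c2 * c4 * F u) (c4 * K u)"
  using quad_algebra.bar_quad_algebra[OF quad_param.qa[OF param_A] c_sq] by (simp add: bar_nth)

lemma FG_bar: "(H u, c2 * G u) \<noteq> (0, 0)"
  using relH[of u] FG[of u] c_nz nondegenerate_complex[OF nd] by auto

lemma H_cross: "(H u)\<^sup>2 * (G v)\<^sup>2 - (H v)\<^sup>2 * (G u)\<^sup>2
   = of_real ((half_perimeter b - b$1) * (half_perimeter b - b$2)) * ((F u)\<^sup>2 * (G v)\<^sup>2 - (F v)\<^sup>2 * (G u)\<^sup>2)"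
  unfolding relH by (simp only: left_diff_distrib right_diff_distrib mult_ac) simp

text \<open>\<open>H\<close> takes over the role of \<open>F\<close> and has the opposite parity,
  hence \<open>- \<eta>\<close>. The imaginary period still reverses both quotients, so it serves
  again as \<open>np\<close>.\<close>

lemma param_B: "quad_param (bar b) H (\<lambda>u. c2 * G u) (\<lambda>u. c2 * c4 * F u) (\<lambda>u. c4 * K u) sgB (- \<eta>) (of_real (2 * pi) * \<i>) L"
proof
  have \<eta>': "- \<eta> = 1 \<or> - \<eta> = - 1" using \<eta> by auto
  show "nondegenerate (bar b)" by (rule nondegenerate_bar[OF nd])
  show "(\<lambda>u. c2 * G u) holomorphic_on UNIV" "(\<lambda>u. c2 * c4 * F u) holomorphic_on UNIV" "(\<lambda>u. c4 * K u) holomorphic_on UNIV"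
    by (intro holomorphic_intros hol)+
  show "(c2 * c4 * F u)\<^sup>2 = of_real ((half_perimeter (bar b) - bar b$1) * (half_perimeter (bar b) - bar b$2)) * (H u)\<^sup>2
        - of_real (half_perimeter (bar b) * (half_perimeter (bar b) - bar b$3 - bar b$4)) * (c2 * G u)\<^sup>2" for u
    using quad_algebra.H[OF bar_algebra, of u] by simp
  show "(c4 * K u)\<^sup>2 = of_real ((half_perimeter (bar b) - bar b$1 - bar b$4) * (half_perimeter (bar b) - bar b$1 - bar b$3)) * (H u)\<^sup>2
        + of_real ((half_perimeter (bar b) - bar b$3) * (half_perimeter (bar b) - bar b$4)) * (c2 * G u)\<^sup>2" for u
    using quad_algebra.K[OF bar_algebra, of u] by simp
  let ?E = "\<lambda>u. exp (u + complex_of_real L / 2)"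
  have G': "c2 * G (x + of_real L) = \<eta> * ?E x * (c2 * G x)" "c2 * G (x + of_real (2 * pi) * \<i>) = c2 * G x" for x
    unfolding shift_real shift_imag by simp_all
  have F': "c2 * c4 * F (x + of_real L) = \<eta> * ?E x * (c2 * c4 * F x)" "c2 * c4 * F (x + of_real (2 * pi) * \<i>) = - (c2 * c4 * F x)" for x
    unfolding shift_real shift_imag by simp_all
  have K': "c4 * K (x + of_real L) = - \<eta> * ?E x * (c4 * K x)" "c4 * K (x + of_real (2 * pi) * \<i>) = c4 * K x" for x
    unfolding shift_real shift_imag by simp_all
  show "H (u + m) * (c2 * G u) = sgB m * H u * (c2 * G (u + m))" if m: "m \<in> plat L" for m u
    by (rule period_sign[where E = ?E and g = "\<lambda>u. c2 * G u", OF shift_real(3) shift_imag(3) G' \<eta>' \<eta> _ sg_add(2) _ _ _ m])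
      (use sg_basis \<eta> in auto)
  show "c2 * c4 * F (u + m) * (c4 * K u) = sgB m * (c2 * c4 * F u) * (c4 * K (u + m))" if m: "m \<in> plat L" for m u
    by (rule period_sign[where E = ?E and f = "\<lambda>u. c2 * c4 * F u" and g = "\<lambda>u. c4 * K u",
        OF F' K' \<eta> \<eta>' _ sg_add(2) _ _ _ m])
      (use sg_basis \<eta> in auto)
  show "- \<eta> = 1 \<or> - \<eta> = - 1" by (rule \<eta>')
  show "H (- u) * (c2 * G u) = - \<eta> * H u * (c2 * G (- u))"
    "c2 * c4 * F (- u) * (c4 * K u) = - (- \<eta>) * (c2 * c4 * F u) * (c4 * K (- u))" for u
    unfolding parity by simp_all
  show "u - v \<in> plat L \<or> u + v \<in> plat L" if "(H u)\<^sup>2 * (c2 * G v)\<^sup>2 = (H v)\<^sup>2 * (c2 * G u)\<^sup>2" for u v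
  proof (rule fibre)
    have "c2\<^sup>2 * ((H u)\<^sup>2 * (G v)\<^sup>2 - (H v)\<^sup>2 * (G u)\<^sup>2) = 0"
      using that by (simp add: power_mult_distrib algebra_simps)
    then show "(F u)\<^sup>2 * (G v)\<^sup>2 = (F v)\<^sup>2 * (G u)\<^sup>2"
      unfolding H_cross using c_nz nondegenerate_complex(3)[OF nd] by simp
  qed
  show "2 * u \<in> plat L" if "H u * (c2 * G u) * (c2 * c4 * F u) * (c4 * K u) = 0" for u
    using that c_nz by (intro zeros) auto
  show "\<exists>u. y * (H u)\<^sup>2 = x * (c2 * G u)\<^sup>2" if xy: "(x, y) \<noteq> (0, 0)" for x y
  proof -
    let ?\<beta> = "complex_of_real ((half_perimeter b - b$1) * (half_perimeter b - b$2))"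
    let ?\<delta> = "complex_of_real (half_perimeter b * (half_perimeter b - b$3 - b$4))"
    have "(x * c2\<^sup>2 + y * ?\<delta>, y * ?\<beta>) \<noteq> (0, 0)"
      using xy c_nz nondegenerate_complex(3)[OF nd] by auto
    then obtain u where "y * ?\<beta> * (F u)\<^sup>2 = (x * c2\<^sup>2 + y * ?\<delta>) * (G u)\<^sup>2" using surj by blast
    then show ?thesis unfolding relH by (intro exI[of _ u]) (simp add: power_mult_distrib algebra_simps)
  qed
  show "c2 * G (cnj u) = cnj (c2 * G u)" "c2 * c4 * F (cnj u) = cnj (c2 * c4 * F u)" "c4 * K (cnj u) = cnj (c4 * K u)" for u
    by (simp_all add: conj c2_def c4_def)
qed (fact L hol FG_bar sg_add sg_values imag_period sg_basis conj)+

abbreviation "\<Phi>A \<equiv> quad_param.\<Phi> b F G H K"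
abbreviation "\<Phi>B \<equiv> quad_param.\<Phi> (bar b) H (\<lambda>u. c2 * G u) (\<lambda>u. c2 * c4 * F u) (\<lambda>u. c4 * K u)"

lemma same_AC: "sq_AC b (\<Phi>A u) = sq_AC (bar b) (\<Phi>B u)"
proof -
  let ?\<beta> = "(of_real (half_perimeter b) - of_real (b$1)) * (of_real (half_perimeter b) - of_real (b$2)) :: complex"
  have \<beta>: "?\<beta> \<noteq> 0" using nondegenerate_complex[OF nd] by simp
  note d = quad_algebra.bar_diagonals(1,2)[OF quad_param.qa[OF param_A] c_sq, of u]
  define P S where "P = of_real ((b$1 + b$2)\<^sup>2) * (G u)\<^sup>2 + of_real ((b$1 - b$2)\<^sup>2) * (F u)\<^sup>2" and "S = (G u)\<^sup>2 + (F u)\<^sup>2"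
  have nz: "(P, S) \<noteq> (0, 0)"
    unfolding P_def S_def using sq_diagonal_abs(2)[OF FG, of "b$1" "b$2" u] nondegenerate_complex(2)[OF nd] by simp
  have 1: "of_real ((bar b$1 + bar b$2)\<^sup>2) * (c2 * G u)\<^sup>2 + of_real ((bar b$1 - bar b$2)\<^sup>2) * (H u)\<^sup>2 = ?\<beta> * P"
    using d(2) by (simp add: bar_nth P_def)
  have 2: "(c2 * G u)\<^sup>2 + (H u)\<^sup>2 = ?\<beta> * S" using d(1) by (simp add: S_def)
  have "sq_AC (bar b) (\<Phi>B u) = abs_cp1 (?\<beta> * P, ?\<beta> * S)"
    unfolding quad_param.sq_AC_\<Phi>[OF param_B] 1 2 ..
  also have "\<dots> = abs_cp1 (P, S)"
    using abs_cp1_eq_iff[of "(?\<beta> * P, ?\<beta> * S)" "(P, S)"] nz \<beta> by (simp add: mult_ac)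
  also have "\<dots> = sq_AC b (\<Phi>A u)" unfolding quad_param.sq_AC_\<Phi>[OF param_A] P_def S_def ..
  finally show ?thesis ..
qed

lemma same_BD: "sq_BD b (\<Phi>A u) = sq_BD (bar b) (\<Phi>B u)"
proof -
  let ?\<beta> = "(of_real (half_perimeter b) - of_real (b$1)) * (of_real (half_perimeter b) - of_real (b$2)) :: complex"
  have \<beta>: "?\<beta> \<noteq> 0" using nondegenerate_complex[OF nd] by simp
  interpret A: quad_param b F G H K sgA \<eta> "of_real (2 * pi) * \<i>" L by (rule param_A)
  interpret B: quad_param "bar b" H "\<lambda>u. c2 * G u" "\<lambda>u. c2 * c4 * F u" "\<lambda>u. c4 * K u" sgB "- \<eta>" "of_real (2 * pi) * \<i>" L
    by (rule param_B)
  obtain k k' where k: "(A.xA k u, A.yA k u) \<noteq> (0, 0)" "(B.xA k' u, B.yA k' u) \<noteq> (0, 0)"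
    using A.ex_choice(1) B.ex_choice(1) by blast
  define nA where "nA = (\<lambda>u. of_real ((b$1 + b$4)\<^sup>2) * (A.yA k u)\<^sup>2 + of_real ((b$1 - b$4)\<^sup>2) * (A.xA k u)\<^sup>2)"
  define dA where "dA = (\<lambda>u. (A.yA k u)\<^sup>2 + (A.xA k u)\<^sup>2)"
  define nB where "nB = (\<lambda>u. of_real ((bar b$1 + bar b$4)\<^sup>2) * (B.yA k' u)\<^sup>2 + of_real ((bar b$1 - bar b$4)\<^sup>2) * (B.xA k' u)\<^sup>2)"
  define dB where "dB = (\<lambda>u. (B.yA k' u)\<^sup>2 + (B.xA k' u)\<^sup>2)"
  have "nA u * dB u - nB u * dA u = 0"
  proof -
    obtain u0 where u0: "A.den u0 \<noteq> 0" using A.den_generic by blast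
    have "(\<lambda>u. nA u * dB u - nB u * dA u) holomorphic_on UNIV"
      unfolding nA_def dA_def nB_def dB_def by (intro holomorphic_intros A.hol_xy B.hol_xy)
    then show ?thesis
    proof (rule entire_mult_cancel[OF _ A.den_hol u0])
      fix z assume z: "A.den z \<noteq> 0"
      define N where "N = quad_algebra.sq_num (of_real (b$1)) (of_real (b$2)) (of_real (b$3)) (of_real (b$4)) (F z) (G z) (H z) (K z)"
      have 1: "2 * A.den z * nA z = N * dA z"
        using quad_algebra.vertex_diagonal[OF A.qa A.vertex_xy(1), of z k] A.nz
        by (simp add: N_def nA_def dA_def A.den_def add.commute)
      have "2 * B.den z * nB z = ?\<beta>\<^sup>2 * N * dB z"
        using quad_algebra.vertex_diagonal[OF B.qa B.vertex_xy(1), of z k'] B.nz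
          quad_algebra.bar_diagonals(4)[OF A.qa c_sq, of z]
        by (simp add: N_def nB_def dB_def B.den_def add.commute bar_nth)
      moreover have "B.den z = ?\<beta>\<^sup>2 * A.den z"
        using quad_algebra.bar_diagonals(3)[OF A.qa c_sq, of z] by (simp add: A.den_def B.den_def bar_nth)
      ultimately have "?\<beta>\<^sup>2 * (2 * A.den z * nB z) = ?\<beta>\<^sup>2 * (N * dB z)" by (simp add: mult_ac)
      then have 2: "2 * A.den z * nB z = N * dB z" using \<beta> by simp
      have "2 * A.den z * (nA z * dB z - nB z * dA z) = 0" using 1 2 by algebra
      then show "nA z * dB z - nB z * dA z = 0" using z by simp
    qed
  qed
  moreover have "(nA u, dA u) \<noteq> (0, 0)" "(nB u, dB u) \<noteq> (0, 0)"
    unfolding nA_def dA_def nB_def dB_def using sq_diagonal_abs(2)[OF k(1), of "b$1" "b$4"] A.nz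
      sq_diagonal_abs(2)[OF k(2), of "bar b$1" "bar b$4"] B.nz by simp_all
  ultimately have "abs_cp1 (nA u, dA u) = abs_cp1 (nB u, dB u)"
    by (simp add: abs_cp1_eq_iff)
  then show ?thesis
    unfolding A.sq_BD_\<Phi>[OF k(1)] B.sq_BD_\<Phi>[OF k(2)] nA_def dA_def nB_def dB_def .
qed

end

text \<open>
  The values of \<open>F / G\<close> at the zeros of \<open>H\<close> and of \<open>K\<close> are then all real or all imaginary, so that
  theta functions with real coefficients parametrize the curve.
\<close>

definition nested :: "real ^ 4 \<Rightarrow> bool" where
  "nested b \<longleftrightarrow> (half_perimeter b - b$1 - b$4) * (half_perimeter b - b$1 - b$3) * (half_perimeter b * (half_perimeter b - b$3 - b$4)) < 0"

lemma nested_or_bar: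
  assumes "nondegenerate b"
  shows "nested b \<or> nested (bar b)"
proof -
  let ?s = "half_perimeter b"
  have nz: "?s - b$1 - b$4 \<noteq> 0" "?s - b$1 - b$3 \<noteq> 0" "?s - b$3 - b$4 \<noteq> 0" "?s \<noteq> 0"
    using nondegenerate_complex(4)[OF assms, of 1 4] nondegenerate_complex(4)[OF assms, of 1 3]
      nondegenerate_complex(4)[OF assms, of 3 4] nondegenerate_complex(1)[OF assms]
    by (simp_all flip: of_real_diff)
  define x where "x = (?s - b$1 - b$4) * (?s - b$1 - b$3) * (?s * (?s - b$3 - b$4))"
  have "x \<noteq> 0" using nz by (simp add: x_def)
  moreover have "nested b \<longleftrightarrow> x < 0" by (simp add: nested_def x_def)
  moreover have "nested (bar b) \<longleftrightarrow> - x < 0"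
    unfolding nested_def half_perimeter_bar bar_nth x_def by (simp add: algebra_simps)
  ultimately show ?thesis by linarith
qed

lemma of_real_sqrt_power2: "0 \<le> x \<Longrightarrow> (complex_of_real (sqrt x))\<^sup>2 = of_real x"
  unfolding of_real_power[symmetric] by simp

text \<open>If \<open>\<delta> < 0\<close>, both quadratic forms in \<open>F\<close> and
  \<open>G\<close> are positive definite, like \<open>c\<^sup>2\<close> and \<open>d\<^sup>2\<close>
  as forms in \<open>s\<close> and \<open>n\<close>. If \<open>\<delta> > 0\<close>, both are
  indefinite, like \<open>s\<^sup>2\<close> and \<open>n\<^sup>2\<close> as forms in
  \<open>c\<close> and \<open>d\<close>. The constants \<open>p\<close>, \<open>q\<close>,
  \<open>r\<close> come from comparing coefficients.\<close>

lemma theta_quad_exists: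
  assumes nd: "nondegenerate b" and nest: "nested b"
  obtains F G H K \<eta> L where "theta_quad b F G H K \<eta> L"
proof -
  define s where "s = half_perimeter b"
  define \<alpha> \<beta> \<gamma> \<delta> where "\<alpha> = (s - b$1 - b$4) * (s - b$1 - b$3)" and "\<beta> = (s - b$1) * (s - b$2)"
    and "\<gamma> = (s - b$3) * (s - b$4)" and "\<delta> = s * (s - b$3 - b$4)"
  note defs = \<alpha>_def \<beta>_def \<gamma>_def \<delta>_def
  have pos: "b$i > 0" "b$i < s" for i using nd by (simp_all add: nondegenerate_def s_def)
  have \<beta>\<gamma>: "\<beta> > 0" "\<gamma> > 0" using pos by (simp_all add: defs)
  have det: "\<beta> * \<gamma> + \<alpha> * \<delta> = b$1 * b$2 * b$3 * b$4"
  proof -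
    have b4: "b$4 = 2 * s - b$1 - b$2 - b$3" by (simp add: s_def half_perimeter_eq field_simps)
    show ?thesis unfolding defs b4 by algebra
  qed
  have neg: "\<alpha> * \<delta> < 0" using nest by (simp add: nested_def defs s_def)
  \<comment> \<open>The quotient of the values of \<open>(F / G)\<^sup>2\<close> at the zeros of
    \<open>H\<close> and of \<open>K\<close>, which are \<open>\<delta> / \<beta>\<close> and
    \<open>- \<gamma> / \<alpha>\<close>.\<close>
  define k2 where "k2 = - (\<alpha> * \<delta>) / (\<beta> * \<gamma>)"
  have "0 < b$1 * b$2 * b$3 * b$4" using pos by simp
  then have "- (\<alpha> * \<delta>) < \<beta> * \<gamma>" "0 < - (\<alpha> * \<delta>)" "0 < \<beta> * \<gamma>" using det neg \<beta>\<gamma> by simp_all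
  then have k2: "0 < k2" "k2 < 1"
    unfolding k2_def by (simp_all only: divide_pos_pos divide_less_eq_1_pos)
  obtain L S C D N where "theta_functions L k2 S C D N" using theta_functions_exist[OF k2] by blast
  then interpret t: theta_functions L k2 S C D N .
  have cr: "of_real ((s - b$1) * (s - b$2)) = complex_of_real \<beta>" "of_real (s * (s - b$3 - b$4)) = complex_of_real \<delta>"
    "of_real ((s - b$1 - b$4) * (s - b$1 - b$3)) = complex_of_real \<alpha>" "of_real ((s - b$3) * (s - b$4)) = complex_of_real \<gamma>"
    by (simp_all only: defs)
  have \<beta>c: "complex_of_real \<beta> \<noteq> 0" "complex_of_real \<gamma> \<noteq> 0" using \<beta>\<gamma> by simp_all
  have k2c: "complex_of_real \<beta> * of_real \<gamma> * of_real k2 = - (of_real \<alpha> * of_real \<delta>)"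
    unfolding of_real_mult[symmetric] of_real_minus[symmetric] k2_def using \<beta>\<gamma> by simp
  consider "\<delta> < 0" | "\<delta> > 0" using neg by (cases \<delta> "0::real" rule: linorder_cases) auto
  then show ?thesis
  proof cases
    case 1
    define p q r where "p = complex_of_real (sqrt (- \<delta> / \<beta>))" and "q = complex_of_real (sqrt (- \<delta>))" and "r = complex_of_real (sqrt \<gamma>)"
    have nz: "p \<noteq> 0" "q \<noteq> 0" "r \<noteq> 0" using 1 \<beta>\<gamma> by (simp_all add: p_def q_def r_def)
    have p0: "0 \<le> - \<delta> / \<beta>" using 1 \<beta>\<gamma> by (simp add: divide_le_0_iff)
    have "of_real \<beta> * p\<^sup>2 = complex_of_real (\<beta> * (- \<delta> / \<beta>))"
      unfolding p_def of_real_sqrt_power2[OF p0] of_real_mult ..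
    also have "\<beta> * (- \<delta> / \<beta>) = - \<delta>" using \<beta>\<gamma> by simp
    finally have sq: "of_real \<beta> * p\<^sup>2 = - of_real \<delta>" "q\<^sup>2 = - of_real \<delta>" "r\<^sup>2 = of_real \<gamma>"
      using of_real_sqrt_power2[of "- \<delta>"] of_real_sqrt_power2[of \<gamma>] 1 \<beta>\<gamma> by (simp_all add: q_def r_def)
    have "theta_quad b (\<lambda>u. p * S u) N (\<lambda>u. q * C u) (\<lambda>u. r * D u) (- 1) L"
    proof
      fix u v
      show "(\<lambda>u. p * S u) holomorphic_on UNIV" "N holomorphic_on UNIV" "(\<lambda>u. q * C u) holomorphic_on UNIV" "(\<lambda>u. r * D u) holomorphic_on UNIV"
        by (intro holomorphic_intros t.hol)+
      show "(q * C u)\<^sup>2 = of_real ((half_perimeter b - b$1) * (half_perimeter b - b$2)) * (p * S u)\<^sup>2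
          - of_real (half_perimeter b * (half_perimeter b - b$3 - b$4)) * (N u)\<^sup>2"
        unfolding s_def[symmetric] cr power_mult_distrib t.rel sq mult.assoc[symmetric] by (simp add: algebra_simps)
      have "of_real \<alpha> * p\<^sup>2 = of_real \<gamma> * of_real k2"
        using k2c sq(1) \<beta>c by algebra
      then show "(r * D u)\<^sup>2 = of_real ((half_perimeter b - b$1 - b$4) * (half_perimeter b - b$1 - b$3)) * (p * S u)\<^sup>2
          + of_real ((half_perimeter b - b$3) * (half_perimeter b - b$4)) * (N u)\<^sup>2"
        unfolding s_def[symmetric] cr power_mult_distrib t.rel sq mult.assoc[symmetric] by (simp add: algebra_simps)
      show "(p * S u, N u) \<noteq> (0, 0)" using t.no_common_zero[of u] nz by simp
      show "u - v \<in> plat L \<or> u + v \<in> plat L" if "(p * S u)\<^sup>2 * (N v)\<^sup>2 = (p * S v)\<^sup>2 * (N u)\<^sup>2"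
        using that nz by (intro t.fibre) (simp add: power_mult_distrib)
      show "2 * u \<in> plat L" if "p * S u * N u * (q * C u) * (r * D u) = 0"
        using that nz by (intro t.zeros) auto
      show "\<exists>u. y * (p * S u)\<^sup>2 = x * (N u)\<^sup>2" if "(x, y) \<noteq> (0, 0)" for x y
        using t.surj[of x "y * p\<^sup>2"] that nz by (auto simp: power_mult_distrib mult_ac)
    qed (use t.L nd in \<open>simp_all add: t.parity t.shift_imag[simplified] t.shift_real t.conj p_def q_def r_def\<close>)
    then show ?thesis by (rule that)
  next
    case 2
    define p q r where "p = complex_of_real (sqrt (\<delta> / \<beta>))" and "q = complex_of_real (sqrt (\<delta> * (1 - k2)))" and "r = complex_of_real (sqrt (\<gamma> * (1 - k2)))"
    have nz: "p \<noteq> 0" "q \<noteq> 0" "r \<noteq> 0" using 2 \<beta>\<gamma> k2 by (simp_all add: p_def q_def r_def)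
    have p0: "0 \<le> \<delta> / \<beta>" using 2 \<beta>\<gamma> by (simp add: divide_le_0_iff)
    have "of_real \<beta> * p\<^sup>2 = complex_of_real (\<beta> * (\<delta> / \<beta>))"
      unfolding p_def of_real_sqrt_power2[OF p0] of_real_mult ..
    also have "\<beta> * (\<delta> / \<beta>) = \<delta>" using \<beta>\<gamma> by simp
    finally have sq: "of_real \<beta> * p\<^sup>2 = of_real \<delta>" "q\<^sup>2 = of_real \<delta> * (1 - of_real k2)" "r\<^sup>2 = of_real \<gamma> * (1 - of_real k2)"
      using of_real_sqrt_power2[of "\<delta> * (1 - k2)"] of_real_sqrt_power2[of "\<gamma> * (1 - k2)"] 2 \<beta>\<gamma> k2 by (simp_all add: q_def r_def)
    have "theta_quad b (\<lambda>u. p * C u) D (\<lambda>u. q * S u) (\<lambda>u. r * N u) 1 L"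
    proof
      fix u v
      show "(\<lambda>u. p * C u) holomorphic_on UNIV" "D holomorphic_on UNIV" "(\<lambda>u. q * S u) holomorphic_on UNIV" "(\<lambda>u. r * N u) holomorphic_on UNIV"
        by (intro holomorphic_intros t.hol)+
      show "(q * S u)\<^sup>2 = of_real ((half_perimeter b - b$1) * (half_perimeter b - b$2)) * (p * C u)\<^sup>2
          - of_real (half_perimeter b * (half_perimeter b - b$3 - b$4)) * (D u)\<^sup>2"
        unfolding s_def[symmetric] cr power_mult_distrib t.rel sq mult.assoc[symmetric] by (simp add: algebra_simps)
      have "of_real \<alpha> * p\<^sup>2 = - of_real \<gamma> * of_real k2"
        using k2c sq(1) \<beta>c by algebra
      then show "(r * N u)\<^sup>2 = of_real ((half_perimeter b - b$1 - b$4) * (half_perimeter b - b$1 - b$3)) * (p * C u)\<^sup>2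
          + of_real ((half_perimeter b - b$3) * (half_perimeter b - b$4)) * (D u)\<^sup>2"
        unfolding s_def[symmetric] cr power_mult_distrib t.rel sq mult.assoc[symmetric] by (simp add: algebra_simps)
      have "complex_of_real (1 - k2) \<noteq> 0" using k2 unfolding of_real_eq_0_iff by simp
      then have k1: "1 - complex_of_real k2 \<noteq> 0" by simp
      show "(p * C u, D u) \<noteq> (0, 0)"
      proof
        assume "(p * C u, D u) = (0, 0)"
        then have "(N u)\<^sup>2 + (S u)\<^sup>2 = 0" "(N u)\<^sup>2 + of_real k2 * (S u)\<^sup>2 = 0" using nz t.rel[of u] by auto
        then have "(1 - complex_of_real k2) * (S u)\<^sup>2 = 0" "(1 - complex_of_real k2) * (N u)\<^sup>2 = 0" by algebra+
        then show False using k1 t.no_common_zero[of u] by simp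
      qed
      show "u - v \<in> plat L \<or> u + v \<in> plat L" if "(p * C u)\<^sup>2 * (D v)\<^sup>2 = (p * C v)\<^sup>2 * (D u)\<^sup>2"
      proof (rule t.fibre)
        have "(C u)\<^sup>2 * (D v)\<^sup>2 = (C v)\<^sup>2 * (D u)\<^sup>2" using that nz by (simp add: power_mult_distrib)
        then have "(1 - complex_of_real k2) * ((S u)\<^sup>2 * (N v)\<^sup>2) = (1 - complex_of_real k2) * ((S v)\<^sup>2 * (N u)\<^sup>2)"
          unfolding t.rel by algebra
        then show "(S u)\<^sup>2 * (N v)\<^sup>2 = (S v)\<^sup>2 * (N u)\<^sup>2" using k1 by simp
      qed
      show "2 * u \<in> plat L" if "p * C u * D u * (q * S u) * (r * N u) = 0"
        using that nz by (intro t.zeros) auto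
      show "\<exists>u. y * (p * C u)\<^sup>2 = x * (D u)\<^sup>2" if xy: "(x, y) \<noteq> (0, 0)" for x y
      proof -
        let ?y = "y * p\<^sup>2"
        have "(x - ?y, ?y - of_real k2 * x) \<noteq> (0, 0)"
        proof
          assume "(x - ?y, ?y - of_real k2 * x) = (0, 0)"
          then have e: "x - ?y = 0" "?y - of_real k2 * x = 0" unfolding prod.inject by blast+
          then have "(1 - complex_of_real k2) * x = 0" by algebra
          then have x: "x = 0" using k1 by simp
          show False using e(1) xy nz unfolding x by simp
        qed
        then obtain u where "(?y - of_real k2 * x) * (S u)\<^sup>2 = (x - ?y) * (N u)\<^sup>2" using t.surj by blast
        then have "y * (p * C u)\<^sup>2 = x * (D u)\<^sup>2" unfolding power_mult_distrib t.rel by algebra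
        then show ?thesis ..
      qed
    qed (use t.L nd in \<open>simp_all add: t.parity t.shift_imag[simplified] t.shift_real t.conj p_def q_def r_def\<close>)
    then show ?thesis by (rule that)
  qed
qed

section \<open>Lattices, diagonals and lifts\<close>

lemma lattice_of_scale: "lattice_of (c * v) (c * w) = (\<lambda>l. c * l) ` lattice_of v w"
proof -
  have "of_int m * (c * v) + of_int n * (c * w) = c * (of_int m * v + of_int n * w)" for m n :: int
    by (simp add: algebra_simps)
  then show ?thesis unfolding lattice_of_def by (auto simp: image_iff)
qed

lemma countable_lattice_of: "countable (lattice_of v w)"
proof -
  have "lattice_of v w = (\<lambda>(m, n). of_int m * v + of_int n * w) ` (UNIV :: (int \<times> int) set)"
    by (auto simp: lattice_of_def)
  then show ?thesis by simp
qed

text \<open>As the plane is uncountable, an affine map with all values in a lattice must be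
  constant.\<close>

lemma countable_affine_preimage:
  fixes c d :: complex
  assumes "countable \<Lambda>" "c \<noteq> 0"
  shows "countable {z. c * z + d \<in> \<Lambda>}"
proof (rule countable_subset)
  show "{z. c * z + d \<in> \<Lambda>} \<subseteq> (\<lambda>l. (l - d) / c) ` \<Lambda>"
  proof
    fix z assume "z \<in> {z. c * z + d \<in> \<Lambda>}"
    then show "z \<in> (\<lambda>l. (l - d) / c) ` \<Lambda>" using assms(2) by (intro image_eqI[of _ _ "c * z + d"]) auto
  qed
  show "countable ((\<lambda>l. (l - d) / c) ` \<Lambda>)" using assms(1) by simp
qed

lemma real_torus_uniformized:
  assumes "\<Lambda> = lattice_of v w" "uniformized \<Lambda> X \<pi>" "\<And>z. \<pi> (cnj z) = \<tau> (\<pi> z)"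
  shows "real_torus \<Lambda> X \<tau>"
proof -
  obtain h where "biholomorphic (torus \<Lambda>) X h" "\<And>z. h (lattice_coset \<Lambda> z) = \<pi> z"
    using uniformized_biholomorphic[OF uniformized_torus[OF assms(1)] assms(2)] by blast
  then show ?thesis unfolding real_torus_def using assms(3) by auto
qed

lemma lattice_of_left: "v \<in> lattice_of v w"
  unfolding lattice_of_def by (rule CollectI, rule exI[of _ 1], rule exI[of _ 0]) simp

text \<open>A real element of the rhombic lattice is an even multiple of \<open>Re w\<close>, while
  membership of \<open>w\<close> in the rectangular one makes \<open>Re w\<close> an integer
  multiple of \<open>x\<close>. Together they give \<open>2 * (j * m) = 1\<close>.\<close>

lemma not_real_rectangular_rhombic:
  assumes x: "x \<noteq> 0" and eq: "lattice_of (of_real x) (\<i> * of_real y) = lattice_of w (cnj w)"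
    and w: "Re w \<noteq> 0" "Im w \<noteq> 0"
  shows False
proof -
  have "of_real x \<in> lattice_of w (cnj w)" using lattice_of_left[of "of_real x" "\<i> * of_real y"] unfolding eq .
  then obtain j k :: int where jk: "of_real x = of_int j * w + of_int k * cnj w"
    unfolding lattice_of_def by blast
  have "w \<in> lattice_of (of_real x) (\<i> * of_real y)" using lattice_of_left[of w "cnj w"] unfolding eq .
  then obtain m n :: int where mn: "w = of_int m * of_real x + of_int n * (\<i> * of_real y)"
    unfolding lattice_of_def by blast
  have "Im (of_real x) = (real_of_int j - of_int k) * Im w" unfolding jk by (simp add: algebra_simps)
  then have "j = k" using w(2) by simp
  then have "x = 2 * of_int j * Re w" using arg_cong[OF jk, of Re] by simp
  moreover have "Re w = of_int m * x" using arg_cong[OF mn, of Re] by simp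
  ultimately have "real_of_int (2 * (j * m)) * Re w = 1 * Re w" by simp
  then have "real_of_int (2 * (j * m)) = 1" unfolding mult_right_cancel[OF w(1)] .
  then have "2 * (j * m) = 1" by (simp only: of_int_eq_1_iff)
  then show False by presburger
qed

text \<open>An isomorphism that respects conjugation lifts to an affine map with real slope
  \<open>c\<close>, since otherwise a nonconstant affine map would take all its values in the
  lattice. A real factor keeps the rectangle parallel to the axes.\<close>

lemma not_rectangular_if_rhombic:
  assumes w: "Re w \<noteq> 0" "Im w \<noteq> 0" and \<phi>: "uniformized (lattice_of w (cnj w)) X \<phi>"
    and cnj: "\<And>z. \<phi> (cnj z) = \<tau> (\<phi> z)"
  shows "\<not> has_rectangular_lattice X \<tau>"
proof
  assume "has_rectangular_lattice X \<tau>"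
  then obtain x y h where xy: "x \<noteq> 0" "y \<noteq> 0"
    and h: "biholomorphic (torus (lattice_of (of_real x) (\<i> * of_real y))) X h"
      "\<And>z. h (lattice_coset (lattice_of (of_real x) (\<i> * of_real y)) (cnj z)) = \<tau> (h (lattice_coset (lattice_of (of_real x) (\<i> * of_real y)) z))"
    unfolding has_rectangular_lattice_def real_rectangular_def real_torus_def by blast
  let ?\<Lambda> = "lattice_of (of_real x) (\<i> * of_real y)"
  have "uniformized ?\<Lambda> X (h \<circ> lattice_coset ?\<Lambda>)"
    by (rule uniformized_compose[OF uniformized_torus[OF refl] h(1)])
  moreover have "Im (of_real x * cnj (\<i> * of_real y)) \<noteq> 0" "Im (w * cnj (cnj w)) \<noteq> 0" using xy w by simp_all
  ultimately obtain c d where c: "c \<noteq> 0" "\<And>z. h (lattice_coset ?\<Lambda> z) = \<phi> (c * z + d)" "lattice_of w (cnj w) = (\<lambda>l. c * l) ` ?\<Lambda>"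
    using uniformized_affine[OF _ refl _ \<phi> refl] unfolding o_def by metis
  have "(c - cnj c) * z + (d - cnj d) \<in> lattice_of w (cnj w)" for z
  proof -
    have "\<phi> (c * z + d) = h (lattice_coset ?\<Lambda> z)" using c(2) by simp
    also have "\<dots> = \<tau> (\<phi> (c * cnj z + d))" using h(2)[of "cnj z"] c(2) by simp
    also have "\<dots> = \<phi> (cnj c * z + cnj d)" using cnj[of "c * cnj z + d"] by simp
    finally have "(c * z + d) - (cnj c * z + cnj d) \<in> lattice_of w (cnj w)"
      using uniformizedD(4)[OF \<phi>] by blast
    then show ?thesis by (simp add: algebra_simps)
  qed
  then have "{z. (c - cnj c) * z + (d - cnj d) \<in> lattice_of w (cnj w)} = UNIV" by blast
  then have "c - cnj c = 0"
    using countable_affine_preimage[OF countable_lattice_of, of "c - cnj c" "d - cnj d" w "cnj w"] uncountable_UNIV_complex by auto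
  then have "c = of_real (Re c)" by (simp add: complex_eq_iff)
  then obtain r where r: "c = of_real r" by blast
  have "lattice_of w (cnj w) = lattice_of (of_real (r * x)) (\<i> * of_real (r * y))"
    unfolding c(3) lattice_of_scale[symmetric] by (simp add: r mult_ac)
  then show False using not_real_rectangular_rhombic[of "r * x" "r * y" w] w xy c(1) r by simp
qed

text \<open>Conjugation need not be respected here, so the slope is an arbitrary nonzero number; a
  similarity still takes a rhombus to a rhombus.\<close>

lemma rhombic_if_isomorphic:
  assumes L1: "rectangular \<Lambda>" and h: "biholomorphic (torus \<Lambda>) X h"
    and L2: "\<Lambda>' = lattice_of v w" "Im (v * cnj w) \<noteq> 0" "norm v = norm w" and \<phi>: "uniformized \<Lambda>' X \<phi>"
  shows "rhombic \<Lambda>"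
proof -
  obtain v1 w1 where 1: "v1 \<noteq> 0" "w1 \<noteq> 0" "v1 \<bullet> w1 = 0" "\<Lambda> = lattice_of v1 w1"
    using L1 unfolding rectangular_def by blast
  have Im1: "Im (v1 * cnj w1) \<noteq> 0"
  proof
    assume "Im (v1 * cnj w1) = 0"
    moreover have "Re (v1 * cnj w1) = 0" using 1(3) by (simp add: inner_complex_def)
    ultimately have "v1 * cnj w1 = 0" by (simp add: complex_eq_iff)
    then show False using 1 by simp
  qed
  have "uniformized \<Lambda> X (h \<circ> lattice_coset \<Lambda>)"
    by (rule uniformized_compose[OF uniformized_torus[OF 1(4)] h])
  then obtain c where c: "c \<noteq> 0" "\<Lambda>' = (\<lambda>l. c * l) ` \<Lambda>"
    using uniformized_affine[OF _ 1(4) Im1 \<phi> L2(1,2)] by blast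
  have "inverse c * (c * l) = l" for l using c(1) by (simp flip: mult.assoc)
  then have "\<Lambda> = (\<lambda>l. inverse c * l) ` \<Lambda>'" unfolding c(2) image_image by (simp only: image_ident)
  then have "\<Lambda> = lattice_of (inverse c * v) (inverse c * w)" unfolding L2(1) lattice_of_scale .
  moreover have "Im (inverse c * v * cnj (inverse c * w)) \<noteq> 0"
  proof -
    have "inverse c * v * cnj (inverse c * w) = of_real ((norm (inverse c))\<^sup>2) * (v * cnj w)"
      by (simp only: complex_norm_square complex_cnj_mult mult_ac)
    then have "Im (inverse c * v * cnj (inverse c * w)) = (norm (inverse c))\<^sup>2 * Im (v * cnj w)"
      by (simp only: times_complex.sel Re_complex_of_real Im_complex_of_real)
    then show ?thesis using L2(2) c(1) by simp
  qed
  moreover have "norm (inverse c * v) = norm (inverse c * w)" using L2(3) by (simp add: norm_mult)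
  ultimately show ?thesis unfolding rhombic_def by blast
qed

section \<open>Diagonals on the quotients, and the obstruction to a lift\<close>

lemma sq_diagonal_neg:
  assumes "p \<noteq> 0" "q \<noteq> 0"
  shows "sq_diagonal p q (cp1_neg z) = sq_diagonal p q z"
proof -
  obtain x y where z: "z = abs_cp1 (x, y)" "(x, y) \<noteq> (0, 0)" by (rule cp1_cases)
  then have "(- x, y) \<noteq> (0, 0)" by simp
  then show ?thesis
    unfolding z(1) cp1_neg_abs[OF z(2)] using sq_diagonal_abs(1)[OF _ assms] z(2) by simp
qed

lemma sq_neg4:
  assumes "nondegenerate b"
  shows "sq_AC b (neg4 P) = sq_AC b P" "sq_BD b (neg4 P) = sq_BD b P"
proof -
  have "b$1 \<noteq> 0" "b$2 \<noteq> 0" "b$4 \<noteq> 0" using nondegenerate_complex(2)[OF assms] by simp_all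
  then show "sq_AC b (neg4 P) = sq_AC b P" "sq_BD b (neg4 P) = sq_BD b P"
    by (simp_all add: sq_AC_def sq_BD_def neg4_def sq_diagonal_neg)
qed

text \<open>Both quotients are uniformized by the same lattice, so equal parameters can be matched.
  The squared diagonals are even in the tangents, hence the comparison does not depend on the
  representatives.\<close>

lemma diagonal_isomorphism_exists:
  assumes nd: "nondegenerate a" "nondegenerate b"
    and Qa: "uniformized \<Lambda> (Q a) (\<lambda>u. unoriented (\<phi> u))" and Qb: "uniformized \<Lambda> (Q b) (\<lambda>u. unoriented (\<psi> u))"
    and ran: "points (Qor a) = range \<phi>"
    and same: "\<And>u. sq_AC a (\<phi> u) = sq_AC b (\<psi> u)" "\<And>u. sq_BD a (\<phi> u) = sq_BD b (\<psi> u)"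
  shows "\<exists>h. diagonal_isomorphism a b h"
proof -
  obtain h where h: "biholomorphic (Q a) (Q b) h" "\<And>u. h (unoriented (\<phi> u)) = unoriented (\<psi> u)"
    using uniformized_biholomorphic[OF Qa Qb] by blast
  have "sq_AC a P = sq_AC b P' \<and> sq_BD a P = sq_BD b P'"
    if "P \<in> points (Qor a)" "h (unoriented P) = unoriented P'" for P P'
  proof -
    obtain u where u: "P = \<phi> u" using \<open>P \<in> points (Qor a)\<close> ran by blast
    have "unoriented (\<psi> u) = unoriented P'" using that(2) h(2) u by simp
    then have "\<psi> u = P' \<or> \<psi> u = neg4 P'" by (simp add: unoriented_eq_iff)
    then show ?thesis using same[of u] sq_neg4[OF nd(2), of P'] u by auto
  qed
  then show ?thesis unfolding diagonal_isomorphism_def using h(1) by blast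
qed

text \<open>For every \<open>z\<close> one of two affine expressions, with slopes
  \<open>1 - c\<close> and \<open>1 + c\<close>, lies in a lattice. If both slopes were nonzero, the
  plane would be the union of two countable sets.\<close>

lemma no_lift:
  assumes \<phi>: "uniformized \<Lambda>1 (Qor a) \<phi>" and L1: "\<Lambda>1 = lattice_of v1 w1" "Im (v1 * cnj w1) \<noteq> 0"
    and \<psi>: "uniformized \<Lambda>2 (Qor b) \<psi>" and L2: "\<Lambda>2 = lattice_of v2 w2" "Im (v2 * cnj w2) \<noteq> 0"
    and same: "\<And>u. sq_AC a (\<phi> u) = sq_AC b (\<psi> u)"
    and fibre: "\<And>u v. sq_AC b (\<psi> u) = sq_AC b (\<psi> v) \<Longrightarrow> u - v \<in> plat L \<or> u + v \<in> plat L"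
    and h: "diagonal_isomorphism a b h" and g: "biholomorphic (Qor a) (Qor b) g" "is_lift a h g"
  shows "\<Lambda>1 = \<Lambda>2"
proof -
  obtain c d where c: "\<And>z. g (\<phi> z) = \<psi> (c * z + d)" "\<Lambda>2 = (\<lambda>l. c * l) ` \<Lambda>1"
    using uniformized_affine[OF uniformized_compose[OF \<phi> g(1)] L1 \<psi> L2] by auto
  have "z - (c * z + d) \<in> plat L \<or> z + (c * z + d) \<in> plat L" for z
  proof (rule fibre)
    have "\<phi> z \<in> points (Qor a)" "g (\<phi> z) \<in> points (Qor b)"
      using uniformizedD(2)[OF \<phi>] uniformizedD(2)[OF \<psi>] c(1) by auto
    then have "sq_AC a (\<phi> z) = sq_AC b (g (\<phi> z))"
      using h g(2) unfolding diagonal_isomorphism_def is_lift_def by metis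
    then show "sq_AC b (\<psi> z) = sq_AC b (\<psi> (c * z + d))" using same c(1) by simp
  qed
  moreover have "z - (c * z + d) = (1 - c) * z + (- d)" "z + (c * z + d) = (1 + c) * z + d" for z
    by (simp_all add: algebra_simps)
  ultimately have "UNIV = {z. (1 - c) * z + (- d) \<in> plat L} \<union> {z. (1 + c) * z + d \<in> plat L}" by auto
  moreover have "countable ({z. (1 - c) * z + (- d) \<in> plat L} \<union> {z. (1 + c) * z + d \<in> plat L})"
    if "1 - c \<noteq> 0" "1 + c \<noteq> 0"
    by (intro countable_Un countable_affine_preimage countable_lattice_of that)
  ultimately have "1 - c = 0 \<or> 1 + c = 0" using uncountable_UNIV_complex by auto
  then have "c = 1 \<or> c = - 1" by (auto simp: eq_neg_iff_add_eq_0 add.commute)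
  moreover have "(\<lambda>l. - l) ` \<Lambda>1 = \<Lambda>1"
  proof -
    have "- l \<in> \<Lambda>1" if "l \<in> \<Lambda>1" for l using lattice_of_minus that L1(1) by blast
    then show ?thesis by (metis (no_types, lifting) image_eqI image_subsetI minus_minus subsetI subset_antisym)
  qed
  ultimately show ?thesis using c(2) by auto
qed

context theta_quad
begin

lemma plat_cases:
  assumes "m \<in> plat L"
  obtains k l :: int where "m = of_int k * of_real L + of_int l * (of_real (2 * pi) * \<i>)"
  using assms unfolding lattice_of_def by blast

lemma lattice_A: "{m \<in> plat L. sgA m = 1} = lattice_of (of_real L) (\<i> * of_real (4 * pi))"
proof (intro set_eqI iffI)
  fix m assume m: "m \<in> {m \<in> plat L. sgA m = 1}"
  then obtain k l :: int where kl: "m = of_int k * of_real L + of_int l * (of_real (2 * pi) * \<i>)"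
    using plat_cases by blast
  then have "even l" using m sg_lattice(1)[of k l] by (auto split: if_splits)
  then obtain j where "l = 2 * j" by blast
  then have "m = of_int k * of_real L + of_int j * (\<i> * of_real (4 * pi))" by (simp add: kl)
  then show "m \<in> lattice_of (of_real L) (\<i> * of_real (4 * pi))" unfolding lattice_of_def by blast
next
  fix m assume "m \<in> lattice_of (of_real L) (\<i> * of_real (4 * pi))"
  then obtain k j :: int where "m = of_int k * of_real L + of_int j * (\<i> * of_real (4 * pi))"
    unfolding lattice_of_def by blast
  then have m: "m = of_int k * of_real L + of_int (2 * j) * (of_real (2 * pi) * \<i>)" by simp
  then have "m \<in> plat L" unfolding lattice_of_def by blast
  then show "m \<in> {m \<in> plat L. sgA m = 1}" using sg_lattice(1)[of k "2 * j"] m by simp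
qed

lemma lattice_B: "{m \<in> plat L. sgB m = 1} = lattice_of (Complex L (2 * pi)) (cnj (Complex L (2 * pi)))"
proof (intro set_eqI iffI)
  have e: "of_int i * Complex L (2 * pi) + of_int j * cnj (Complex L (2 * pi))
     = of_int (i + j) * of_real L + of_int (i - j) * (of_real (2 * pi) * \<i>)" for i j :: int
    by (simp add: complex_eq_iff algebra_simps)
  fix m
  {
    assume m: "m \<in> {m \<in> plat L. sgB m = 1}"
    then obtain k l :: int where kl: "m = of_int k * of_real L + of_int l * (of_real (2 * pi) * \<i>)"
      using plat_cases by blast
    then have "even (k + l)" using m sg_lattice(2)[of k l] by (auto split: if_splits)
    then obtain i where i: "k + l = 2 * i" by blast
    then have "k = i + (k - i)" "l = i - (k - i)" by simp_all
    then have "m = of_int i * Complex L (2 * pi) + of_int (k - i) * cnj (Complex L (2 * pi))"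
      unfolding e kl by simp
    then show "m \<in> lattice_of (Complex L (2 * pi)) (cnj (Complex L (2 * pi)))" unfolding lattice_of_def by blast
  next
    assume "m \<in> lattice_of (Complex L (2 * pi)) (cnj (Complex L (2 * pi)))"
    then obtain i j :: int where m: "m = of_int (i + j) * of_real L + of_int (i - j) * (of_real (2 * pi) * \<i>)"
      unfolding lattice_of_def e by blast
    then have "m \<in> plat L" unfolding lattice_of_def by blast
    then show "m \<in> {m \<in> plat L. sgB m = 1}" using sg_lattice(2)[of "i + j" "i - j"] m by simp
  }
qed

text \<open>The squared length of \<open>AC\<close> is a Moebius function of
  \<open>(F / G)\<^sup>2\<close> with determinant \<open>4 * b$1 * b$2\<close> up to sign, so it has
  the fibres of \<open>(F / G)\<^sup>2\<close>.\<close>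

lemma sq_AC_fibre:
  assumes "sq_AC b (\<Phi>A u) = sq_AC b (\<Phi>A v)"
  shows "u - v \<in> plat L \<or> u + v \<in> plat L"
proof (rule fibre)
  have b: "complex_of_real (b$1) \<noteq> 0" "complex_of_real (b$2) \<noteq> 0" using nondegenerate_complex(2)[OF nd] by blast+
  define N where "N = (\<lambda>u. of_real ((b$1 + b$2)\<^sup>2) * (G u)\<^sup>2 + of_real ((b$1 - b$2)\<^sup>2) * (F u)\<^sup>2)"
  have nz: "(N u, (G u)\<^sup>2 + (F u)\<^sup>2) \<noteq> (0, 0)" for u
    unfolding N_def using sq_diagonal_abs(2)[OF FG, of "b$1" "b$2" u] b by simp
  have "abs_cp1 (N u, (G u)\<^sup>2 + (F u)\<^sup>2) = abs_cp1 (N v, (G v)\<^sup>2 + (F v)\<^sup>2)"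
    using assms unfolding quad_param.sq_AC_\<Phi>[OF param_A] N_def .
  then have "N u * ((G v)\<^sup>2 + (F v)\<^sup>2) = N v * ((G u)\<^sup>2 + (F u)\<^sup>2)"
    using abs_cp1_eq_iff[OF nz nz, of u v] by simp
  then have "4 * of_real (b$1) * of_real (b$2) * ((F u)\<^sup>2 * (G v)\<^sup>2 - (F v)\<^sup>2 * (G u)\<^sup>2) = 0"
    unfolding N_def of_real_power of_real_add of_real_diff by algebra
  then show "(F u)\<^sup>2 * (G v)\<^sup>2 = (F v)\<^sup>2 * (G u)\<^sup>2" using b by simp
qed

end

lemma nested_uniformizations:
  assumes "nondegenerate b" "nested b"
  obtains L \<phi> \<psi> where "L > 0"
    "uniformized (lattice_of (of_real L) (\<i> * of_real (4 * pi))) (Qor b) \<phi>"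
    "uniformized (lattice_of (Complex L (2 * pi)) (cnj (Complex L (2 * pi)))) (Qor (bar b)) \<psi>"
    "uniformized (plat L) (Q b) (\<lambda>u. unoriented (\<phi> u))" "uniformized (plat L) (Q (bar b)) (\<lambda>u. unoriented (\<psi> u))"
    "\<forall>u. \<phi> (cnj u) = cnj4 (\<phi> u)" "\<forall>u. \<psi> (cnj u) = cnj4 (\<psi> u)"
    "\<forall>u. sq_AC b (\<phi> u) = sq_AC (bar b) (\<psi> u)" "\<forall>u. sq_BD b (\<phi> u) = sq_BD (bar b) (\<psi> u)"
    "\<forall>u v. sq_AC b (\<phi> u) = sq_AC b (\<phi> v) \<longrightarrow> u - v \<in> plat L \<or> u + v \<in> plat L"
proof -
  obtain F G H K \<eta> L where "theta_quad b F G H K \<eta> L" using theta_quad_exists[OF assms] .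
  then interpret theta_quad b F G H K \<eta> L .
  have "Im (of_real L * cnj (\<i> * of_real (4 * pi))) \<noteq> 0" using L by simp
  note A = quad_param.uniformized_\<Phi>[OF param_A lattice_A this]
  have "Im (Complex L (2 * pi) * cnj (cnj (Complex L (2 * pi)))) \<noteq> 0" using L by simp
  note B = quad_param.uniformized_\<Phi>[OF param_B lattice_B this]
  show ?thesis
    by (rule that[OF L A(1) B(1) A(2) B(2)])
      (use quad_param.\<Phi>_cnj[OF param_A] quad_param.\<Phi>_cnj[OF param_B] same_AC same_BD sq_AC_fibre in blast)+
qed

lemma unoriented_cnj: "unoriented (cnj4 P) = cnj4 ` unoriented P"
proof -
  have "cp1_neg (cp1_cnj z) = cp1_cnj (cp1_neg z)" for z
  proof -
    obtain x y where z: "z = abs_cp1 (x, y)" "(x, y) \<noteq> (0, 0)" by (rule cp1_cases)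
    then have "(cnj x, cnj y) \<noteq> (0, 0)" "(- x, y) \<noteq> (0, 0)" by simp_all
    then show ?thesis unfolding z(1) using z(2) by (simp add: cp1_neg_abs cp1_cnj_abs)
  qed
  then show ?thesis by (simp add: unoriented_def neg4_def cnj4_def vec_eq_iff)
qed

lemma nondegenerateI:
  assumes "\<forall>i. a $ i > 0" and "\<forall>i. a $ i < (\<Sum>j \<in> UNIV - {i}. a $ j)"
    and "\<forall>e2 \<in> {1, -1}. \<forall>e3 \<in> {1, -1}. \<forall>e4 \<in> {1, -1}.
           a $ 1 + e2 * a $ 2 + e3 * a $ 3 + e4 * a $ 4 \<noteq> (0::real)"
  shows "nondegenerate (a :: real ^ 4)"
proof -
  have "a $ i < half_perimeter a" for i
  proof -
    have "(\<Sum>j\<in>UNIV. a $ j) = a $ i + (\<Sum>j \<in> UNIV - {i}. a $ j)"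
      by (rule sum.remove) simp_all
    then show ?thesis using assms(2)[rule_format, of i] by (simp add: half_perimeter_def)
  qed
  moreover have "\<forall>i j. i \<noteq> j \<longrightarrow> a $ i + a $ j \<noteq> half_perimeter a"
    unfolding forall_4 half_perimeter_eq using assms(3) by auto
  ultimately show ?thesis using assms(1) by (simp add: nondegenerate_def)
qed

lemma real_rectangular_plat: "L > 0 \<Longrightarrow> real_rectangular (plat L)"
  unfolding real_rectangular_def by (rule exI[of _ L], rule exI[of _ "2 * pi"]) (simp add: mult.commute)

text \<open>The shapes in (iii) are taken in two senses: with the real structure, and for the bare
  torus. In the second sense a square lattice has both shapes, so it is set apart by
  \<open>\<not> rhombic \<Lambda>\<close>.\<close>

theorem theorem3:
  fixes a :: "real ^ 4"
  assumes "\<forall>i. a $ i > 0"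
    and "\<forall>i. a $ i < (\<Sum>j \<in> UNIV - {i}. a $ j)"
    and "\<forall>e2 \<in> {1, -1}. \<forall>e3 \<in> {1, -1}. \<forall>e4 \<in> {1, -1}.
           a $ 1 + e2 * a $ 2 + e3 * a $ 3 + e4 * a $ 4 \<noteq> 0"
  shows "has_rectangular_lattice (Q a) (image cnj4)
    \<and> (\<exists>h. diagonal_isomorphism a (bar a) h)
    \<and> (has_rectangular_lattice (Qor a) cnj4 \<longrightarrow> has_rhombic_lattice (Qor (bar a)) cnj4)
    \<and> ((\<exists>\<Lambda> h. rectangular \<Lambda> \<and> \<not> rhombic \<Lambda> \<and> biholomorphic (torus \<Lambda>) (Qor a) h) \<longrightarrow>
         (\<exists>\<Lambda> h. rhombic \<Lambda> \<and> biholomorphic (torus \<Lambda>) (Qor (bar a)) h))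
    \<and> (\<forall>h. diagonal_isomorphism a (bar a) h \<longrightarrow>
         \<not> (\<exists>g. biholomorphic (Qor a) (Qor (bar a)) g \<and> is_lift a h g))"
proof -
  have nd: "nondegenerate a" "nondegenerate (bar a)" using nondegenerateI[OF assms] nondegenerate_bar by blast+
  define rec where "rec = (\<lambda>L. lattice_of (complex_of_real L) (\<i> * of_real (4 * pi)))"
  define rho where "rho = (\<lambda>L. lattice_of (Complex L (2 * pi)) (cnj (Complex L (2 * pi))))"
  have rec_eq: "rec L = lattice_of (of_real L) (\<i> * of_real (4 * pi))"
    and rho_eq: "rho L = lattice_of (Complex L (2 * pi)) (cnj (Complex L (2 * pi)))" for L
    by (simp_all only: rec_def rho_def)
  have Im: "Im (of_real L * cnj (\<i> * of_real (4 * pi))) \<noteq> 0" "Im (Complex L (2 * pi) * cnj (cnj (Complex L (2 * pi)))) \<noteq> 0"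
    "Re (Complex L (2 * pi)) \<noteq> 0" "Im (Complex L (2 * pi)) \<noteq> 0" if "L > 0" for L using that by simp_all
  have rr: "real_rhombic (rho L)" if "L > 0" for L
    unfolding real_rhombic_def rho_def using that by (intro exI[of _ "Complex L (2 * pi)"]) simp
  have ne: "rec L \<noteq> rho L" if "L > 0" for L
    using not_real_rectangular_rhombic[of L "4 * pi" "Complex L (2 * pi)"] that by (auto simp: rec_def rho_def)
  from nested_or_bar[OF nd(1)] show ?thesis
  proof
    assume nest: "nested a"
    obtain L \<phi> \<psi> where L: "L > 0"
      and A: "uniformized (rec L) (Qor a) \<phi>" and B: "uniformized (rho L) (Qor (bar a)) \<psi>"
      and QA: "uniformized (plat L) (Q a) (\<lambda>u. unoriented (\<phi> u))" and QB: "uniformized (plat L) (Q (bar a)) (\<lambda>u. unoriented (\<psi> u))"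
      and cnjs: "\<forall>u. \<phi> (cnj u) = cnj4 (\<phi> u)" "\<forall>u. \<psi> (cnj u) = cnj4 (\<psi> u)"
      and sames: "\<forall>u. sq_AC a (\<phi> u) = sq_AC (bar a) (\<psi> u)" "\<forall>u. sq_BD a (\<phi> u) = sq_BD (bar a) (\<psi> u)"
      and fibs: "\<forall>u v. sq_AC a (\<phi> u) = sq_AC a (\<phi> v) \<longrightarrow> u - v \<in> plat L \<or> u + v \<in> plat L"
      using nested_uniformizations[OF nd(1) nest] unfolding rec_def rho_def .
    note cnjA = cnjs(1)[rule_format] and cnjB = cnjs(2)[rule_format] and fib = fibs[rule_format]
    note same = sames(1)[rule_format] sames(2)[rule_format]
    have "real_torus (rho L) (Qor (bar a)) cnj4"
      by (rule real_torus_uniformized[OF rho_eq B cnjB])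
    then have 3: "has_rhombic_lattice (Qor (bar a)) cnj4" "\<exists>\<Lambda> h. rhombic \<Lambda> \<and> biholomorphic (torus \<Lambda>) (Qor (bar a)) h"
      using rr[OF L] real_rhombic_imp_rhombic unfolding has_rhombic_lattice_def real_torus_def by blast+
    have "real_torus (plat L) (Q a) (image cnj4)"
      by (rule real_torus_uniformized[OF refl QA]) (simp only: cnjA unoriented_cnj)
    then have "has_rectangular_lattice (Q a) (image cnj4)"
      unfolding has_rectangular_lattice_def using real_rectangular_plat[OF L] by blast
    moreover have "\<exists>h. diagonal_isomorphism a (bar a) h"
      by (rule diagonal_isomorphism_exists[OF nd QA QB uniformizedD(2)[OF A] same])
    moreover have False if "diagonal_isomorphism a (bar a) h" "biholomorphic (Qor a) (Qor (bar a)) g" "is_lift a h g" for h g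
    proof -
      have "rec L = rho L"
        by (rule no_lift[OF A rec_eq Im(1)[OF L] B rho_eq Im(2)[OF L] same(1) _ that]) (rule fib, simp only: same)
      then show False using ne[OF L] by blast
    qed
    ultimately show ?thesis using 3 by blast
  next
    \<comment> \<open>The roles are exchanged: \<open>Qor a\<close> is the rhombic curve, so both
      premises of (iii) are refuted.\<close>
    assume nest: "nested (bar a)"
    obtain L \<phi> \<psi> where L: "L > 0"
      and A: "uniformized (rec L) (Qor (bar a)) \<phi>" and B: "uniformized (rho L) (Qor a) \<psi>"
      and QA: "uniformized (plat L) (Q (bar a)) (\<lambda>u. unoriented (\<phi> u))" and QB: "uniformized (plat L) (Q a) (\<lambda>u. unoriented (\<psi> u))"
      and cnjs: "\<forall>u. \<phi> (cnj u) = cnj4 (\<phi> u)" "\<forall>u. \<psi> (cnj u) = cnj4 (\<psi> u)"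
      and sames: "\<forall>u. sq_AC (bar a) (\<phi> u) = sq_AC a (\<psi> u)" "\<forall>u. sq_BD (bar a) (\<phi> u) = sq_BD a (\<psi> u)"
      and fibs: "\<forall>u v. sq_AC (bar a) (\<phi> u) = sq_AC (bar a) (\<phi> v) \<longrightarrow> u - v \<in> plat L \<or> u + v \<in> plat L"
      using nested_uniformizations[OF nd(2) nest, unfolded bar_bar] unfolding rec_def rho_def .
    note cnjA = cnjs(1)[rule_format] and cnjB = cnjs(2)[rule_format] and fib = fibs[rule_format]
    note same = sames(1)[rule_format] sames(2)[rule_format]
    have "real_torus (plat L) (Q a) (image cnj4)"
      by (rule real_torus_uniformized[OF refl QB]) (simp only: cnjB unoriented_cnj)
    then have "has_rectangular_lattice (Q a) (image cnj4)"
      unfolding has_rectangular_lattice_def using real_rectangular_plat[OF L] by blast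
    moreover have "\<exists>h. diagonal_isomorphism a (bar a) h"
      by (rule diagonal_isomorphism_exists[OF nd QB QA uniformizedD(2)[OF B] same[symmetric]])
    moreover have "\<not> has_rectangular_lattice (Qor a) cnj4"
      by (rule not_rectangular_if_rhombic[OF Im(3,4)[OF L] B[unfolded rho_def] cnjB])
    moreover have "rhombic \<Lambda>" if "rectangular \<Lambda>" "biholomorphic (torus \<Lambda>) (Qor a) h" for \<Lambda> h
      by (rule rhombic_if_isomorphic[OF that rho_eq Im(2)[OF L] _ B]) (simp only: complex_mod_cnj)
    moreover have False if "diagonal_isomorphism a (bar a) h" "biholomorphic (Qor a) (Qor (bar a)) g" "is_lift a h g" for h g
      using no_lift[OF B rho_eq Im(2)[OF L] A rec_eq Im(1)[OF L] same(1)[symmetric] fib that] ne[OF L] by blast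
    ultimately show ?thesis by blast
  qed
qed

end
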